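(* Let $G$ be a group acting properly and coboundedly on a CAT(0) space $X$. A subgroup $H\le G$ is stable if and only if $H$ is finitely generated and its orbit maps $H\to X_D$ to the curtain model $X_D$ are quasiisometric embeddings.
   Context: **Curtains.** Let $(X,d)$ be a CAT(0) space. A geodesic is an isometric embedding $\alpha:I\to X$ of an interval $I\subset\mathbb R$, and $\pi_\alpha:X\to\alpha$ is closest-point projection. For $r$ with $[r-\frac12,r+\frac12]$ in the interior of $I$, the curtain dual to $\alpha$ at $r$ is $h=h_{\alpha,r}=\pi_\alpha^{-1}(\alpha[r-\frac12,r+\frac12])$. Its halfspaces are $h^-=\pi_\alpha^{-1}\alpha(I\cap(-\infty,r-\frac12))$ and $h^+=\pi_\alpha^{-1}\alpha(I\cap(r+\frac12,\infty))$. The curtain $h$ separates $A,B\subset X$ if one of them is contained in $h^-$ and the other in $h^+$. A chain is a set of pairwise disjoint curtains $\{h_i\}$, indexed by consecutive integers, such that $h_i$ separates $h_{i-1}$ from $h_{i+1}$ for all $i$; it separates $A$ from $B$ if every $h_i$ does. **$L$-separation and $d_L$.** For $L\in\mathbb N=\{0,1,2,\dots\}$, disjoint curtains $h,h'$ are $L$-separated if every chain all of whose elements meet both $h$ and $h'$ has cardinality at most $L$. An $L$-chain is a chain whose elements are pairwise $L$-separated. Set $d_L(x,x)=0$ and, for $x\neq y$, $d_L(x,y)=1+\max\{|c| : c \text{ is an } L\text{-chain separating } x \text{ from } y\}$. **Curtain model.** Fix numbers $\lambda_L\in(0,1)$, $L\ge1$, with $\sum\lambda_L<\sum L\lambda_L<\sum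 L^2\lambda_L=\Lambda<\infty$. Put $D(x,y)=\sum_{L=1}^\infty\lambda_L d_L(x,y)$. The curtain model is $X_D=(X,D)$, on which $\operatorname{Isom}X$ acts by isometries. **Stability.** A geodesic $\gamma$ is $R$-contracting if $\operatorname{diam}\pi_\gamma(B)\le R$ for every ball $B$ of $X$ disjoint from $\gamma$. A subset $Y\subset X$ is stable if there exist $\mu,R\ge0$ such that every geodesic between points of $Y$ is $R$-contracting and stays in the $\mu$-neighbourhood of $Y$. A subgroup of a group acting properly coboundedly on $X$ is stable if it has a stable orbit in $X$. **Conventions.** Actions are by isometries; proper means that for every ball $B\subset X$ the set $\{g : gB\cap B\ne\varnothing\}$ is finite. A finitely generated group carries a word metric. *)

theory Defs
  imports
    "HOL-Analysis.Analysis"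
    "HOL-Algebra.Group_Action"
    "HOL-Algebra.Generated_Groups"
begin

section \<open>CAT(0) spaces\<close>

definition geodesic_on :: "real set \<Rightarrow> (real \<Rightarrow> 'a::metric_space) \<Rightarrow> bool" where
  "geodesic_on I \<alpha> \<longleftrightarrow> is_interval I \<and> (\<forall>s\<in>I. \<forall>t\<in>I. dist (\<alpha> s) (\<alpha> t) = dist s t)"

definition geodesic_from_to :: "(real \<Rightarrow> 'a::metric_space) \<Rightarrow> 'a \<Rightarrow> 'a \<Rightarrow> bool" where
  "geodesic_from_to \<alpha> p q \<longleftrightarrow>
     geodesic_on {0..dist p q} \<alpha> \<and> \<alpha> 0 = p \<and> \<alpha> (dist p q) = q"

text \<open>
  Completeness is not part of the definition. In the triangle condition it suffices to compare
  points on the two sides issuing from \<open>p\<close>, for every choice of the vertex \<open>p\<close>; the third side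
  exists because the space is geodesic. The points \<open>x'\<close> and \<open>y'\<close> are the comparison points of
  \<open>\<alpha> s\<close> and \<open>\<beta> t\<close> in the Euclidean comparison triangle \<open>p' q' r'\<close>.
\<close>

definition is_CAT0 :: "'a::metric_space itself \<Rightarrow> bool" where
  "is_CAT0 TYPE('a) \<longleftrightarrow>
     (\<forall>p q :: 'a. \<exists>\<alpha>. geodesic_from_to \<alpha> p q) \<and>
     (\<forall>(p::'a) q r \<alpha> \<beta> (p'::real^2) q' r' s t x' y'.
        geodesic_from_to \<alpha> p q \<and> geodesic_from_to \<beta> p r \<and>
        dist p' q' = dist p q \<and> dist p' r' = dist p r \<and> dist q' r' = dist q r \<and>
        s \<in> {0..dist p q} \<and> t \<in> {0..dist p r} \<and>
        x' \<in> closed_segment p' q' \<and> dist p' x' = s \<and>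
        y' \<in> closed_segment p' r' \<and> dist p' y' = t
        \<longrightarrow> dist (\<alpha> s) (\<beta> t) \<le> dist x' y')"

definition is_nearest_point :: "'a::metric_space set \<Rightarrow> 'a \<Rightarrow> 'a \<Rightarrow> bool" where
  "is_nearest_point S x p \<longleftrightarrow> p \<in> S \<and> (\<forall>q\<in>S. dist x p \<le> dist x q)"

definition nearest_point :: "'a::metric_space set \<Rightarrow> 'a \<Rightarrow> 'a" where
  "nearest_point S x = (THE p. is_nearest_point S x p)"


section \<open>Curtains\<close>

text \<open>
  The last conjunct says that closest-point projection onto the geodesic is defined on the whole
  space. In a CAT(0) space this is automatic when \<open>I\<close> is closed; it only excludes geodesics on
  non-closed intervals onto which some point has no projection.
\<close>

definition curtain_dual :: "real set \<Rightarrow> (real \<Rightarrow> 'a::metric_space) \<Rightarrow> real \<Rightarrow> bool" where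
  "curtain_dual I \<alpha> r \<longleftrightarrow>
     geodesic_on I \<alpha> \<and> {r - 1/2..r + 1/2} \<subseteq> interior I \<and>
     (\<forall>x. \<exists>!p. is_nearest_point (\<alpha> ` I) x p)"

definition curtain :: "real set \<Rightarrow> (real \<Rightarrow> 'a::metric_space) \<Rightarrow> real \<Rightarrow> 'a set" where
  "curtain I \<alpha> r = nearest_point (\<alpha> ` I) -` (\<alpha> ` {r - 1/2..r + 1/2})"

definition halfspace_minus :: "real set \<Rightarrow> (real \<Rightarrow> 'a::metric_space) \<Rightarrow> real \<Rightarrow> 'a set" where
  "halfspace_minus I \<alpha> r = nearest_point (\<alpha> ` I) -` (\<alpha> ` (I \<inter> {..<r - 1/2}))"

definition halfspace_plus :: "real set \<Rightarrow> (real \<Rightarrow> 'a::metric_space) \<Rightarrow> real \<Rightarrow> 'a set" where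
  "halfspace_plus I \<alpha> r = nearest_point (\<alpha> ` I) -` (\<alpha> ` (I \<inter> {r + 1/2<..}))"

definition is_curtain :: "'a::metric_space set \<Rightarrow> bool" where
  "is_curtain h \<longleftrightarrow> (\<exists>I \<alpha> r. curtain_dual I \<alpha> r \<and> h = curtain I \<alpha> r)"

text \<open>
  A curtain is treated as a subset of the space, possibly dual to several geodesics. In a CAT(0)
  space its two halfspaces are the connected components of its complement, so the choice of
  \<open>I\<close>, \<open>\<alpha>\<close>, \<open>r\<close> below is immaterial up to exchanging the halfspaces.
\<close>

definition separates :: "'a::metric_space set \<Rightarrow> 'a set \<Rightarrow> 'a set \<Rightarrow> bool" where
  "separates h A B \<longleftrightarrow>
     (\<exists>I \<alpha> r. curtain_dual I \<alpha> r \<and> h = curtain I \<alpha> r \<and>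
        (A \<subseteq> halfspace_minus I \<alpha> r \<and> B \<subseteq> halfspace_plus I \<alpha> r \<or>
         B \<subseteq> halfspace_minus I \<alpha> r \<and> A \<subseteq> halfspace_plus I \<alpha> r))"

text \<open>
  The index set \<open>J\<close> is a set of consecutive integers: it may be empty, finite, or infinite in one
  or both directions.
\<close>

definition curtain_chain :: "'a::metric_space set set \<Rightarrow> bool" where
  "curtain_chain c \<longleftrightarrow>
     (\<forall>h\<in>c. is_curtain h) \<and> disjoint c \<and>
     (\<exists>(J::int set) k. (\<forall>i\<in>J. \<forall>j\<in>J. {i..j} \<subseteq> J) \<and> bij_betw k J c \<and>
        (\<forall>i. i - 1 \<in> J \<and> i + 1 \<in> J \<longrightarrow> separates (k i) (k (i - 1)) (k (i + 1))))"

definition chain_separates :: "'a::metric_space set set \<Rightarrow> 'a set \<Rightarrow> 'a set \<Rightarrow> bool" where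
  "chain_separates c A B \<longleftrightarrow> (\<forall>h\<in>c. separates h A B)"

definition L_separated :: "nat \<Rightarrow> 'a::metric_space set \<Rightarrow> 'a set \<Rightarrow> bool" where
  "L_separated L h h' \<longleftrightarrow>
     is_curtain h \<and> is_curtain h' \<and> h \<inter> h' = {} \<and>
     (\<forall>c. curtain_chain c \<and> (\<forall>k\<in>c. k \<inter> h \<noteq> {} \<and> k \<inter> h' \<noteq> {}) \<longrightarrow> finite c \<and> card c \<le> L)"

definition L_chain :: "nat \<Rightarrow> 'a::metric_space set set \<Rightarrow> bool" where
  "L_chain L c \<longleftrightarrow> curtain_chain c \<and> pairwise (L_separated L) c"


section \<open>The curtain model\<close>

text \<open>
  The empty chain vacuously separates, so the maximum is over a nonempty set. In a CAT(0) space
  the set is finite, and every chain separating two points is finite: projections to geodesics are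
  1-Lipschitz, so a geodesic between the points spends length at least 1 in each of the disjoint
  curtains.
\<close>

definition dL :: "nat \<Rightarrow> 'a::metric_space \<Rightarrow> 'a \<Rightarrow> nat" where
  "dL L x y = (if x = y then 0
     else 1 + Max {card c | c. L_chain L c \<and> chain_separates c {x} {y}})"

text \<open>The weights are \<open>w 1, w 2, \<dots>\<close>; the value \<open>w 0\<close> plays no role, whence the shifted sums.\<close>

definition curtain_weights :: "(nat \<Rightarrow> real) \<Rightarrow> bool" where
  "curtain_weights w \<longleftrightarrow>
     (\<forall>L\<ge>1. 0 < w L \<and> w L < 1) \<and>
     summable (\<lambda>n. real (Suc n) ^ 2 * w (Suc n)) \<and>
     (\<Sum>n. w (Suc n)) < (\<Sum>n. real (Suc n) * w (Suc n)) \<and>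
     (\<Sum>n. real (Suc n) * w (Suc n)) < (\<Sum>n. real (Suc n) ^ 2 * w (Suc n))"

definition curtain_dist :: "(nat \<Rightarrow> real) \<Rightarrow> 'a::metric_space \<Rightarrow> 'a \<Rightarrow> real" where
  "curtain_dist w x y = (\<Sum>n. w (Suc n) * real (dL (Suc n) x y))"


section \<open>Stability\<close>

text \<open>The value of \<open>diameter\<close> on an unbounded set is unspecified, hence the boundedness clause.\<close>

definition contracting :: "real \<Rightarrow> 'a::metric_space set \<Rightarrow> bool" where
  "contracting R S \<longleftrightarrow>
     (\<forall>x \<rho>. ball x \<rho> \<inter> S = {} \<longrightarrow>
        bounded (nearest_point S ` ball x \<rho>) \<and> diameter (nearest_point S ` ball x \<rho>) \<le> R)"

definition stable_subset :: "'a::metric_space set \<Rightarrow> bool" where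
  "stable_subset Y \<longleftrightarrow>
     (\<exists>\<mu>\<ge>0. \<exists>R\<ge>0. \<forall>a b \<gamma>.
        a \<le> b \<and> geodesic_on {a..b} \<gamma> \<and> \<gamma> a \<in> Y \<and> \<gamma> b \<in> Y \<longrightarrow>
          contracting R (\<gamma> ` {a..b}) \<and> (\<forall>t\<in>{a..b}. \<exists>y\<in>Y. dist (\<gamma> t) y \<le> \<mu>))"


section \<open>Group actions and word metrics\<close>

definition isometric_action ::
  "('g, 'm) monoid_scheme \<Rightarrow> ('g \<Rightarrow> 'a::metric_space \<Rightarrow> 'a) \<Rightarrow> bool" where
  "isometric_action G \<phi> \<longleftrightarrow>
     group_action G UNIV \<phi> \<and>
     (\<forall>g\<in>carrier G. \<forall>x y. dist (\<phi> g x) (\<phi> g y) = dist x y)"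

definition proper_action ::
  "('g, 'm) monoid_scheme \<Rightarrow> ('g \<Rightarrow> 'a::metric_space \<Rightarrow> 'a) \<Rightarrow> bool" where
  "proper_action G \<phi> \<longleftrightarrow>
     (\<forall>x \<rho>. finite {g \<in> carrier G. \<phi> g ` ball x \<rho> \<inter> ball x \<rho> \<noteq> {}})"

definition cobounded_action ::
  "('g, 'm) monoid_scheme \<Rightarrow> ('g \<Rightarrow> 'a::metric_space \<Rightarrow> 'a) \<Rightarrow> bool" where
  "cobounded_action G \<phi> \<longleftrightarrow> (\<exists>B. bounded B \<and> (\<Union>g\<in>carrier G. \<phi> g ` B) = UNIV)"

definition stable_subgroup ::
  "('g, 'm) monoid_scheme \<Rightarrow> ('g \<Rightarrow> 'a::metric_space \<Rightarrow> 'a) \<Rightarrow> 'g set \<Rightarrow> bool" where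
  "stable_subgroup G \<phi> H \<longleftrightarrow> subgroup H G \<and> (\<exists>x. stable_subset (orbit (G\<lparr>carrier := H\<rparr>) \<phi> x))"

definition finite_generating_set :: "('g, 'm) monoid_scheme \<Rightarrow> 'g set \<Rightarrow> 'g set \<Rightarrow> bool" where
  "finite_generating_set G H S \<longleftrightarrow> finite S \<and> S \<subseteq> H \<and> generate G S = H"

definition word_length :: "('g, 'm) monoid_scheme \<Rightarrow> 'g set \<Rightarrow> 'g \<Rightarrow> nat" where
  "word_length G S g =
     (LEAST n. \<exists>u. length u = n \<and> set u \<subseteq> S \<union> m_inv G ` S \<and> foldr (mult G) u (one G) = g)"

definition word_dist :: "('g, 'm) monoid_scheme \<Rightarrow> 'g set \<Rightarrow> 'g \<Rightarrow> 'g \<Rightarrow> real" where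
  "word_dist G S g h = real (word_length G S (inv\<^bsub>G\<^esub> g \<otimes>\<^bsub>G\<^esub> h))"

definition quasiisometric_embedding ::
  "'b set \<Rightarrow> ('b \<Rightarrow> 'b \<Rightarrow> real) \<Rightarrow> ('c \<Rightarrow> 'c \<Rightarrow> real) \<Rightarrow> ('b \<Rightarrow> 'c) \<Rightarrow> bool" where
  "quasiisometric_embedding M d d' f \<longleftrightarrow>
     (\<exists>K\<ge>1. \<exists>C\<ge>0. \<forall>x\<in>M. \<forall>y\<in>M.
        d x y / K - C \<le> d' (f x) (f y) \<and> d' (f x) (f y) \<le> K * d x y + C)"

end

theory Submission
  imports Defs
begin

text \<open>
  Everything rests on one mechanism. Let \<open>h\<close>, \<open>h'\<close> be \<open>L\<close>-separated curtains that cross a geodesic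
  \<open>\<gamma>\<close>, let \<open>z\<close> be a point with foot \<open>a\<close> on \<open>\<gamma>\<close>. The geodesic \<open>[a, z]\<close> is perpendicular to \<open>\<gamma>\<close>, so all of
  \<open>\<gamma>\<close> projects to \<open>a\<close> on it. Curtains are connected; hence if \<open>h\<close> and \<open>h'\<close> both reach points whose
  projection to \<open>[a, z]\<close> is at distance at least \<open>2 L + 2\<close> from \<open>a\<close>, then both meet \<open>L + 1\<close> curtains dual to
  \<open>[a, z]\<close>, against \<open>L\<close>-separation (lemma \<open>bottleneck\<close>). Consequently, of an \<open>L\<close>-chain that crosses
  \<open>\<gamma>\<close> at most one curtain meets a ball that stays at distance \<open>2 L + 2\<close> from \<open>\<gamma>\<close>: as far as crossing
  curtains is concerned, \<open>\<gamma>\<close> is contracting.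

  \<^bold>\<open>From a quasi-isometric embedding to stability.\<close> Every \<open>d\<^sub>L\<close> is at most \<open>dist + 2\<close> and the weights
  are summable, so a linear lower bound for \<open>D\<close> gives a linear lower bound for a single \<open>d\<^sub>L\<close> (lemma
  \<open>curtain_dist_le_dL\<close>). A word of minimal length in \<open>H\<close> traces a path \<open>q\<close> in the orbit along
  which \<open>d\<^sub>L\<close> grows linearly. If \<open>q\<close> leaves a neighbourhood of the geodesic \<open>\<gamma>\<close> with the same ends, then
  the \<open>L\<close>-chain between the ends of the excursion has to be crossed by \<open>q\<close>, but each long block of \<open>q\<close>
  crosses at most one of its curtains; this bounds the excursion, as in the Morse lemma. Hence
  \<open>\<gamma>\<close> is close to the orbit and \<open>d\<^sub>L\<close> grows linearly along \<open>\<gamma>\<close> too. Finally \<open>\<gamma>\<close> is contracting: an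
  \<open>L\<close>-chain between the feet of the centre \<open>z\<close> and a point \<open>y\<close> of a ball disjoint from \<open>\<gamma>\<close> is
  crossed by the path that runs from foot to \<open>z\<close>, to \<open>y\<close>, to foot, and each leg crosses boundedly many of its
  curtains. These steps make up \<open>quasigeodesic_stability\<close>.

  \<^bold>\<open>From stability to a quasi-isometric embedding.\<close> Orbit points near the geodesics \<open>[x, \<phi> g x]\<close> give
  a finite generating set for which word length is at most displacement plus two
  (\<open>stable_orbit_generators\<close>). Curtains dual to an \<open>R\<close>-contracting geodesic \<open>\<gamma>\<close> at distance \<open>6 R + 6\<close>
  are \<open>L\<close>-separated for \<open>L \<ge> 20 R + 17\<close>: a curtain that meets two of them contains a geodesic whose
  endpoints have distant projections to \<open>\<gamma>\<close>, so it passes through a fixed ball, and a chain of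
  curtains meeting a ball is short (\<open>contracting_curtains_L_separated\<close>). Hence \<open>d\<^sub>L\<close>, and with it
  \<open>D\<close>, grows linearly along orbit geodesics (\<open>contracting_dL_lower_bound\<close>).
\<close>

section \<open>Convexity of the metric\<close>

lemma dist_sq_affine_point:
  fixes p q r :: "'b::real_inner"
  shows "(dist (p + l *\<^sub>R (q - p)) r)\<^sup>2
         = (1 - l) * (dist p r)\<^sup>2 + l * (dist q r)\<^sup>2 - l * (1 - l) * (dist p q)\<^sup>2"
  unfolding dist_norm power2_norm_eq_inner
  by (simp add: algebra_simps inner_commute)

lemma exists_comparison_triangle:
  fixes a b c :: real
  assumes "0 \<le> a" "0 \<le> b" "0 \<le> c" "a \<le> b + c" "b \<le> a + c" "c \<le> a + b"
  shows "\<exists>p q r :: real^2. dist p q = c \<and> dist p r = b \<and> dist q r = a"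
proof (cases "c = 0")
  case True
  with assms have "a = b" by simp
  have "dist (0::real^2) (vector [b, 0]) = b" using assms
    by (simp add: dist_norm norm_vec_def L2_set_def sum_2)
  with True \<open>a = b\<close> show ?thesis by (intro exI[of _ 0] exI[of _ "vector [b, 0]"]) auto
next
  case False
  with assms have c: "c > 0" by simp
  define u where "u = (b\<^sup>2 + c\<^sup>2 - a\<^sup>2) / (2 * c)"
  define v where "v = sqrt (b\<^sup>2 - u\<^sup>2)"
  have uc: "2 * c * u = b\<^sup>2 + c\<^sup>2 - a\<^sup>2" using c by (simp add: u_def)
  have "(b - c)\<^sup>2 \<le> a\<^sup>2" using assms by (intro abs_le_square_iff[THEN iffD1]) auto
  then have "2 * c * u \<le> 2 * c * b" unfolding uc by (simp add: power2_eq_square algebra_simps)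
  then have "u \<le> b" using c by simp
  have "a\<^sup>2 \<le> (b + c)\<^sup>2" using assms by (intro power_mono) auto
  then have "2 * c * (- b) \<le> 2 * c * u" unfolding uc by (simp add: power2_eq_square algebra_simps)
  then have "- b \<le> u" using c by (simp only: mult_le_cancel_left_pos)
  have "u\<^sup>2 \<le> b\<^sup>2" using \<open>u \<le> b\<close> \<open>- b \<le> u\<close> assms by (intro abs_le_square_iff[THEN iffD1]) auto
  then have v: "v\<^sup>2 = b\<^sup>2 - u\<^sup>2" by (simp add: v_def)
  define P :: "real^2" where "P = 0"
  define Q :: "real^2" where "Q = vector [c, 0]"
  define R :: "real^2" where "R = vector [u, v]"
  have "dist P Q = c" using assms
    by (simp add: P_def Q_def dist_norm norm_vec_def L2_set_def sum_2)
  moreover have "dist P R = b" using assms v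
    by (simp add: P_def R_def dist_norm norm_vec_def L2_set_def sum_2)
  moreover have "(c - u)\<^sup>2 + v\<^sup>2 = a\<^sup>2" using v uc by (simp add: power2_eq_square algebra_simps)
  then have "dist Q R = a" using assms
    by (simp add: Q_def R_def dist_norm norm_vec_def L2_set_def sum_2)
  ultimately show ?thesis by blast
qed

lemma geodesic_on_subset:
  "geodesic_on I \<alpha> \<Longrightarrow> is_interval J \<Longrightarrow> J \<subseteq> I \<Longrightarrow> geodesic_on J \<alpha>"
  unfolding geodesic_on_def by blast

lemma geodesic_on_dist: "geodesic_on I \<alpha> \<Longrightarrow> s \<in> I \<Longrightarrow> t \<in> I \<Longrightarrow> dist (\<alpha> s) (\<alpha> t) = \<bar>s - t\<bar>"
  unfolding geodesic_on_def by (simp add: dist_real_def)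

lemma geodesic_on_inj: "geodesic_on I \<alpha> \<Longrightarrow> inj_on \<alpha> I"
  by (rule inj_onI) (metis abs_eq_0 dist_self eq_iff_diff_eq_0 geodesic_on_dist)

lemma geodesic_on_continuous: "geodesic_on I \<alpha> \<Longrightarrow> continuous_on I \<alpha>"
  unfolding continuous_on_iff geodesic_on_def by metis

lemma geodesic_image_connected:
  assumes "geodesic_on I \<alpha>"
  shows "connected (\<alpha> ` I)"
  using assms geodesic_on_continuous[OF assms] unfolding geodesic_on_def
  by (intro connected_continuous_image) (auto simp: is_interval_connected)

lemma geodesic_on_convexD:
  assumes "geodesic_on I \<alpha>" "s \<in> I" "t \<in> I" "0 \<le> l" "l \<le> 1"
  shows "s + l * (t - s) \<in> I"
proof -
  have "convex I" using assms(1) by (simp add: geodesic_on_def is_interval_convex)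
  from convexD[OF this assms(2,3), of "1 - l" l] assms show ?thesis
    by (simp add: algebra_simps)
qed

lemma geodesic_from_toD:
  assumes "geodesic_from_to \<alpha> p q"
  shows "geodesic_on {0..dist p q} \<alpha>" "\<alpha> 0 = p" "\<alpha> (dist p q) = q"
  using assms by (auto simp: geodesic_from_to_def)

context
  assumes cat0: "is_CAT0 TYPE('a::metric_space)"
begin

lemma geodesic_exists: "\<exists>\<alpha>. geodesic_from_to \<alpha> p (q::'a)"
  using cat0 unfolding is_CAT0_def by blast

text \<open>
  The Bruhat--Tits inequality. Besides the existence of geodesics it is all that is used of the
  CAT(0) condition; the comparison point lies on the side opposite to \<open>x\<close>.
\<close>

lemma CN_inequality:
  fixes x :: 'a
  assumes \<alpha>: "geodesic_on I \<alpha>" and st: "s \<in> I" "t \<in> I" and l: "0 \<le> l" "l \<le> 1"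
  shows "(dist (\<alpha> (s + l * (t - s))) x)\<^sup>2
         \<le> (1 - l) * (dist (\<alpha> s) x)\<^sup>2 + l * (dist (\<alpha> t) x)\<^sup>2 - l * (1 - l) * (t - s)\<^sup>2"
proof -
  have main: "(dist (\<alpha> (s + l * (t - s))) x)\<^sup>2
         \<le> (1 - l) * (dist (\<alpha> s) x)\<^sup>2 + l * (dist (\<alpha> t) x)\<^sup>2 - l * (1 - l) * (t - s)\<^sup>2"
    if st: "s \<in> I" "t \<in> I" and le: "s \<le> t" and l: "0 \<le> l" "l \<le> 1" for s t l
  proof -
    define \<beta> where "\<beta> u = \<alpha> (s + u)" for u
    have d: "dist (\<alpha> s) (\<alpha> t) = t - s" using geodesic_on_dist[OF \<alpha> st] le by simp
    have sub: "s + u \<in> I" if "u \<in> {0..t - s}" for u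
    proof -
      have "{s..t} \<subseteq> I" using \<alpha> st unfolding geodesic_on_def
        by (meson atLeastAtMost_iff mem_is_interval_1_I subsetI)
      then show ?thesis using that by auto
    qed
    have \<beta>: "geodesic_from_to \<beta> (\<alpha> s) (\<alpha> t)"
      unfolding geodesic_from_to_def geodesic_on_def d \<beta>_def
      using geodesic_on_dist[OF \<alpha> sub sub] by (auto simp: dist_real_def is_interval_cc)
    obtain \<gamma> where \<gamma>: "geodesic_from_to \<gamma> (\<alpha> s) x" using geodesic_exists by blast
    have "dist (\<alpha> s) x \<le> dist (\<alpha> t) x + dist (\<alpha> s) (\<alpha> t)"
      "dist (\<alpha> t) x \<le> dist (\<alpha> s) x + dist (\<alpha> s) (\<alpha> t)"
      "dist (\<alpha> s) (\<alpha> t) \<le> dist (\<alpha> t) x + dist (\<alpha> s) x" by metric+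
    with exists_comparison_triangle[of "dist (\<alpha> t) x" "dist (\<alpha> s) x" "dist (\<alpha> s) (\<alpha> t)"]
    obtain p q r :: "real^2" where pqr: "dist p q = dist (\<alpha> s) (\<alpha> t)" "dist p r = dist (\<alpha> s) x"
      "dist q r = dist (\<alpha> t) x" by auto
    define y where "y = p + l *\<^sub>R (q - p)"
    have y: "y \<in> closed_segment p q" using l unfolding y_def closed_segment_def
      by (auto intro!: exI[of _ l] simp: algebra_simps)
    have dy: "dist p y = l * (t - s)"
    proof -
      have "dist p y = l * dist p q" unfolding y_def dist_norm using l by (simp add: norm_minus_commute)
      then show ?thesis by (simp add: pqr d)
    qed
    have mem: "l * (t - s) \<in> {0..dist (\<alpha> s) (\<alpha> t)}" using l le unfolding d
      by (auto intro: mult_left_le_one_le)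
    have "dist (\<beta> (l * (t - s))) (\<gamma> (dist (\<alpha> s) x)) \<le> dist y r"
      using cat0[unfolded is_CAT0_def, THEN conjunct2, rule_format,
          of \<beta> "\<alpha> s" "\<alpha> t" \<gamma> x p q r "l * (t - s)" "dist (\<alpha> s) x" y r]
        \<beta> \<gamma> pqr mem y dy by auto
    then have "dist (\<alpha> (s + l * (t - s))) x \<le> dist y r"
      using geodesic_from_toD(3)[OF \<gamma>] by (simp add: \<beta>_def)
    then have "(dist (\<alpha> (s + l * (t - s))) x)\<^sup>2 \<le> (dist y r)\<^sup>2" by (intro power_mono) auto
    also have "\<dots> = (1 - l) * (dist p r)\<^sup>2 + l * (dist q r)\<^sup>2 - l * (1 - l) * (dist p q)\<^sup>2"
      unfolding y_def by (rule dist_sq_affine_point)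
    finally show ?thesis unfolding pqr d .
  qed
  show ?thesis
  proof (cases "s \<le> t")
    case True
    with main[OF st True l] show ?thesis by simp
  next
    case False
    have "t + (1 - l) * (s - t) = s + l * (t - s)" by (simp add: algebra_simps)
    with main[OF st(2,1), of "1 - l"] False l show ?thesis
      by (simp add: power2_commute algebra_simps)
  qed
qed

text \<open>
  Apply the Bruhat--Tits inequality at the midpoint of the diagonal from \<open>x\<close> to \<open>q\<close>, seen from \<open>y\<close> and
  from \<open>p\<close>. Projections will turn out to be 1-Lipschitz because of this inequality.
\<close>

lemma quadrilateral_inequality:
  fixes x y q p :: 'a
  shows "(dist x q)\<^sup>2 + (dist y p)\<^sup>2 \<le> (dist x y)\<^sup>2 + (dist y q)\<^sup>2 + (dist q p)\<^sup>2 + (dist p x)\<^sup>2"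
proof -
  obtain \<alpha> where \<alpha>: "geodesic_from_to \<alpha> x q" using geodesic_exists by blast
  note A = geodesic_from_toD[OF \<alpha>]
  define m where "m = \<alpha> (0 + 1/2 * (dist x q - 0))"
  have c: "(dist m z)\<^sup>2 \<le> 1/2 * (dist x z)\<^sup>2 + 1/2 * (dist q z)\<^sup>2 - 1/4 * (dist x q)\<^sup>2" for z
    using CN_inequality[OF A(1), of 0 "dist x q" "1/2" z] unfolding m_def by (simp add: A(2,3))
  have "(dist y p)\<^sup>2 \<le> (dist m y + dist m p)\<^sup>2" by (intro power_mono) metric+
  also have "\<dots> \<le> 2 * (dist m y)\<^sup>2 + 2 * (dist m p)\<^sup>2"
    using sum_squares_bound[of "dist m y" "dist m p"] by (simp add: power2_sum)
  finally show ?thesis using c[of y] c[of p] by (simp add: dist_commute)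
qed

section \<open>Projection to a geodesic\<close>

text \<open>
  The angle at a foot is at least a right angle. Compare \<open>\<alpha> s\<close> with the points of the geodesic at
  parameter \<open>s + l * (t - s)\<close>, divide by \<open>l\<close> and let \<open>l\<close> tend to 0.
\<close>

lemma nearest_point_pythagoras:
  fixes x :: 'a
  assumes \<alpha>: "geodesic_on I \<alpha>" and s: "s \<in> I" and t: "t \<in> I"
    and min: "\<And>u. u \<in> I \<Longrightarrow> dist x (\<alpha> s) \<le> dist x (\<alpha> u)"
  shows "(dist x (\<alpha> s))\<^sup>2 + (t - s)\<^sup>2 \<le> (dist x (\<alpha> t))\<^sup>2"
proof -
  define X where "X = (dist x (\<alpha> t))\<^sup>2 - (dist x (\<alpha> s))\<^sup>2 - (t - s)\<^sup>2"
  have *: "0 \<le> X + l * (t - s)\<^sup>2" if l: "0 < l" "l \<le> 1" for l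
  proof -
    have "(dist x (\<alpha> s))\<^sup>2 \<le> (dist x (\<alpha> (s + l * (t - s))))\<^sup>2"
      using geodesic_on_convexD[OF \<alpha> s t, of l] l by (intro power_mono min) auto
    also have "\<dots> \<le> (1 - l) * (dist (\<alpha> s) x)\<^sup>2 + l * (dist (\<alpha> t) x)\<^sup>2 - l * (1 - l) * (t - s)\<^sup>2"
      using CN_inequality[OF \<alpha> s t, of l x] l by (simp add: dist_commute)
    finally have "0 \<le> l * (X + l * (t - s)\<^sup>2)" by (simp add: X_def dist_commute algebra_simps)
    then show ?thesis using l by (simp add: zero_le_mult_iff)
  qed
  have "((\<lambda>l. X + l * (t - s)\<^sup>2) \<longlongrightarrow> X + 0 * (t - s)\<^sup>2) (at_right 0)"
    by (intro tendsto_intros)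
  moreover have "\<forall>\<^sub>F l in at_right 0. 0 \<le> X + l * (t - s)\<^sup>2"
    unfolding eventually_at_right_field by (intro exI[of _ 1]) (auto intro: *)
  ultimately have "0 \<le> X + 0 * (t - s)\<^sup>2"
    by (rule tendsto_lowerbound) simp
  then show ?thesis by (simp add: X_def)
qed

lemma segment_has_nearest_points:
  assumes \<gamma>: "geodesic_on {a..b} (\<gamma> :: real \<Rightarrow> 'a)" and ab: "a \<le> b"
  shows "\<exists>!p. is_nearest_point (\<gamma> ` {a..b}) x p"
proof -
  have "compact (\<gamma> ` {a..b})"
    using geodesic_on_continuous[OF \<gamma>] by (intro compact_continuous_image) auto
  moreover have "\<gamma> ` {a..b} \<noteq> {}" using ab by auto
  ultimately obtain p where p: "p \<in> \<gamma> ` {a..b}" "\<forall>q\<in>\<gamma> ` {a..b}. dist x p \<le> dist x q"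
    by (rule continuous_attains_inf[of "\<gamma> ` {a..b}" "dist x", THEN bexE])
      (auto intro: continuous_intros)
  show ?thesis
  proof (rule ex1I[of _ p])
    show "is_nearest_point (\<gamma> ` {a..b}) x p" using p by (simp add: is_nearest_point_def)
    fix q assume q: "is_nearest_point (\<gamma> ` {a..b}) x q"
    from p(1) q obtain s t where st: "s \<in> {a..b}" "t \<in> {a..b}" "p = \<gamma> s" "q = \<gamma> t"
      by (auto simp: is_nearest_point_def)
    have "(dist x (\<gamma> s))\<^sup>2 + (t - s)\<^sup>2 \<le> (dist x (\<gamma> t))\<^sup>2"
      by (rule nearest_point_pythagoras[OF \<gamma> st(1,2)]) (use p st in auto)
    moreover have "dist x p = dist x q" using p q
      unfolding is_nearest_point_def by (intro antisym) auto
    ultimately show "q = p" using st by simp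
  qed
qed

end

text \<open>
  Projections are recorded by their parameters: membership in curtains and halfspaces becomes
  an inequality between real numbers.
\<close>

definition coord :: "real set \<Rightarrow> (real \<Rightarrow> 'a::metric_space) \<Rightarrow> 'a \<Rightarrow> real" where
  "coord I \<alpha> x = inv_into I \<alpha> (nearest_point (\<alpha> ` I) x)"

definition projectable :: "real set \<Rightarrow> (real \<Rightarrow> 'a::metric_space) \<Rightarrow> bool" where
  "projectable I \<alpha> \<longleftrightarrow> geodesic_on I \<alpha> \<and> (\<forall>x. \<exists>!p. is_nearest_point (\<alpha> ` I) x p)"

lemma projectableD: "projectable I \<alpha> \<Longrightarrow> geodesic_on I \<alpha>"
  by (simp add: projectable_def)

lemma projectable_is_interval: "projectable I \<alpha> \<Longrightarrow> is_interval I"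
  by (simp add: projectable_def geodesic_on_def)

lemma nearest_point_eqI:
  assumes "projectable I \<alpha>" "is_nearest_point (\<alpha> ` I) x p"
  shows "nearest_point (\<alpha> ` I) x = p"
  unfolding nearest_point_def using assms by (intro the1_equality) (auto simp: projectable_def)

lemma nearest_point_is_nearest:
  assumes "projectable I \<alpha>"
  shows "is_nearest_point (\<alpha> ` I) x (nearest_point (\<alpha> ` I) x)"
  using assms unfolding nearest_point_def projectable_def by (metis theI')

lemma
  assumes "projectable I \<alpha>"
  shows coord_mem: "coord I \<alpha> x \<in> I"
    and nearest_point_coord: "nearest_point (\<alpha> ` I) x = \<alpha> (coord I \<alpha> x)"
    and coord_nearest: "t \<in> I \<Longrightarrow> dist x (\<alpha> (coord I \<alpha> x)) \<le> dist x (\<alpha> t)"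
proof -
  have n: "is_nearest_point (\<alpha> ` I) x (nearest_point (\<alpha> ` I) x)"
    by (rule nearest_point_is_nearest[OF assms])
  then have m: "nearest_point (\<alpha> ` I) x \<in> \<alpha> ` I" by (simp add: is_nearest_point_def)
  show "coord I \<alpha> x \<in> I" unfolding coord_def using m by (rule inv_into_into)
  show eq: "nearest_point (\<alpha> ` I) x = \<alpha> (coord I \<alpha> x)"
    unfolding coord_def using f_inv_into_f[OF m] by simp
  show "dist x (\<alpha> (coord I \<alpha> x)) \<le> dist x (\<alpha> t)" if "t \<in> I"
    using n that unfolding eq is_nearest_point_def by auto
qed

lemma coord_eqI:
  assumes "projectable I \<alpha>" "s \<in> I" "\<And>t. t \<in> I \<Longrightarrow> dist x (\<alpha> s) \<le> dist x (\<alpha> t)"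
  shows "coord I \<alpha> x = s"
proof -
  have "nearest_point (\<alpha> ` I) x = \<alpha> s"
    using assms by (intro nearest_point_eqI) (auto simp: is_nearest_point_def)
  then have "\<alpha> (coord I \<alpha> x) = \<alpha> s" using nearest_point_coord[OF assms(1)] by metis
  then show ?thesis
    using geodesic_on_inj[OF projectableD[OF assms(1)]] coord_mem[OF assms(1)] assms(2)
    by (metis inj_onD)
qed

lemma coord_on: "projectable I \<alpha> \<Longrightarrow> s \<in> I \<Longrightarrow> coord I \<alpha> (\<alpha> s) = s"
  by (rule coord_eqI) auto

text \<open>
  By the triangle inequality, a point of the geodesic closer to \<open>y\<close> than the foot of \<open>x\<close> would be
  closer to \<open>x\<close> as well. Hence the fibres of a projection are star-shaped.
\<close>

lemma coord_between:
  assumes p: "projectable I \<alpha>" and "dist x y + dist y (\<alpha> (coord I \<alpha> x)) = dist x (\<alpha> (coord I \<alpha> x))"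
  shows "coord I \<alpha> y = coord I \<alpha> x"
proof (rule coord_eqI[OF p coord_mem[OF p]])
  fix t assume "t \<in> I"
  from coord_nearest[OF p this, of x] have "dist x (\<alpha> (coord I \<alpha> x)) \<le> dist x y + dist y (\<alpha> t)"
    using dist_triangle[of x "\<alpha> t" y] by simp
  with assms(2) show "dist y (\<alpha> (coord I \<alpha> x)) \<le> dist y (\<alpha> t)" by simp
qed

lemma coord_on_fibre:
  assumes p: "projectable I \<alpha>" and "geodesic_from_to \<sigma> x (\<alpha> (coord I \<alpha> x))"
    and u: "u \<in> {0..dist x (\<alpha> (coord I \<alpha> x))}"
  shows "coord I \<alpha> (\<sigma> u) = coord I \<alpha> x"
proof (rule coord_between[OF p])
  note \<sigma> = geodesic_from_toD[OF assms(2)]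
  show "dist x (\<sigma> u) + dist (\<sigma> u) (\<alpha> (coord I \<alpha> x)) = dist x (\<alpha> (coord I \<alpha> x))"
    using geodesic_on_dist[OF \<sigma>(1), of 0 u] geodesic_on_dist[OF \<sigma>(1), of u "dist x (\<alpha> (coord I \<alpha> x))"] \<sigma>(2,3) u
    by auto
qed

context
  assumes cat0: "is_CAT0 TYPE('a::metric_space)"
begin

lemma projectable_segment:
  "geodesic_on {a..b} (\<gamma> :: real \<Rightarrow> 'a) \<Longrightarrow> a \<le> b \<Longrightarrow> projectable {a..b} \<gamma>"
  unfolding projectable_def using segment_has_nearest_points[OF cat0] by blast

text \<open>
  Add the Pythagorean inequalities of \<open>x\<close> and of \<open>y\<close> and compare with the quadrilateral formed by
  the two points and their feet.
\<close>

lemma coord_lipschitz: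
  fixes x y :: 'a
  assumes p: "projectable I \<alpha>"
  shows "\<bar>coord I \<alpha> x - coord I \<alpha> y\<bar> \<le> dist x y"
proof -
  let ?s = "coord I \<alpha> x" and ?t = "coord I \<alpha> y"
  note g = projectableD[OF p] and m = coord_mem[OF p] and c = coord_nearest[OF p]
  have 1: "(dist x (\<alpha> ?s))\<^sup>2 + (?t - ?s)\<^sup>2 \<le> (dist x (\<alpha> ?t))\<^sup>2"
    by (rule nearest_point_pythagoras[OF cat0 g m m c])
  have 2: "(dist y (\<alpha> ?t))\<^sup>2 + (?s - ?t)\<^sup>2 \<le> (dist y (\<alpha> ?s))\<^sup>2"
    by (rule nearest_point_pythagoras[OF cat0 g m m c])
  have 3: "(dist (\<alpha> ?t) (\<alpha> ?s))\<^sup>2 = (?s - ?t)\<^sup>2"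
    using geodesic_on_dist[OF g m m] by (simp add: power2_commute)
  have "(?s - ?t)\<^sup>2 \<le> (dist x y)\<^sup>2"
    using 1 2 3 quadrilateral_inequality[OF cat0, of x "\<alpha> ?t" y "\<alpha> ?s"]
    by (simp add: dist_commute power2_commute)
  then show ?thesis by (simp add: abs_le_square_iff[symmetric])
qed

lemma coord_continuous: "projectable I (\<alpha> :: real \<Rightarrow> 'a) \<Longrightarrow> continuous_on A (coord I \<alpha>)"
  using coord_lipschitz unfolding continuous_on_iff dist_real_def
  by (meson le_less_trans)

text \<open>Slide along the fibre to the geodesic; the geodesic meets the preimage in an interval.\<close>

lemma coord_preimage_connected:
  assumes p: "projectable I (\<alpha> :: real \<Rightarrow> 'a)" and J: "is_interval J"
  shows "connected (coord I \<alpha> -` J)"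
proof -
  let ?V = "\<alpha> ` (I \<inter> J)"
  have geo: "geodesic_on (I \<inter> J) \<alpha>"
    by (rule geodesic_on_subset[OF projectableD[OF p]])
      (auto intro: is_interval_Int J projectable_is_interval[OF p])
  have V: "connected ?V" by (rule geodesic_image_connected[OF geo])
  have Vsub: "?V \<subseteq> coord I \<alpha> -` J" using coord_on[OF p] by auto
  have fib: "\<exists>T. connected T \<and> x \<in> T \<and> \<alpha> (coord I \<alpha> x) \<in> T \<and> T \<subseteq> coord I \<alpha> -` J"
    if x: "x \<in> coord I \<alpha> -` J" for x
  proof -
    obtain \<sigma> where \<sigma>0: "geodesic_from_to \<sigma> x (\<alpha> (coord I \<alpha> x))" using geodesic_exists[OF cat0] by blast
    note \<sigma> = geodesic_from_toD[OF \<sigma>0]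
    let ?d = "dist x (\<alpha> (coord I \<alpha> x))"
    have "coord I \<alpha> (\<sigma> u) = coord I \<alpha> x" if "u \<in> {0..?d}" for u
      using coord_on_fibre[OF p \<sigma>0 that] .
    then have "\<sigma> ` {0..?d} \<subseteq> coord I \<alpha> -` J" using x by auto
    moreover have "x \<in> \<sigma> ` {0..?d}" "\<alpha> (coord I \<alpha> x) \<in> \<sigma> ` {0..?d}"
      using \<sigma>(2,3) by (force intro: image_eqI[of _ _ 0], force intro: image_eqI[of _ _ ?d])
    ultimately show ?thesis using geodesic_image_connected[OF \<sigma>(1)] by blast
  qed
  show ?thesis
    unfolding connected_iff_connected_component
  proof (intro ballI)
    fix x y assume x: "x \<in> coord I \<alpha> -` J" and y: "y \<in> coord I \<alpha> -` J"
    have foot: "\<alpha> (coord I \<alpha> z) \<in> ?V" if "z \<in> coord I \<alpha> -` J" for z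
      using that coord_mem[OF p] by auto
    have "connected_component (coord I \<alpha> -` J) x (\<alpha> (coord I \<alpha> x))"
      "connected_component (coord I \<alpha> -` J) (\<alpha> (coord I \<alpha> y)) y"
      using fib[OF x] fib[OF y] unfolding connected_component_def by blast+
    moreover have "connected_component (coord I \<alpha> -` J) (\<alpha> (coord I \<alpha> x)) (\<alpha> (coord I \<alpha> y))"
      unfolding connected_component_def using V Vsub foot[OF x] foot[OF y] by blast
    ultimately show "connected_component (coord I \<alpha> -` J) x y"
      by (meson connected_component_trans)
  qed
qed

text \<open>
  Let \<open>a\<close> be the foot of \<open>z\<close> on \<open>\<alpha>\<close>, let \<open>y\<close> be a point of \<open>\<alpha>\<close> and \<open>q\<close> its foot on \<open>\<beta>\<close>. Since \<open>q\<close> lies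
  between \<open>z\<close> and \<open>a\<close>, its foot on \<open>\<alpha>\<close> is \<open>a\<close> again. The Pythagorean inequalities at \<open>a\<close> and at \<open>q\<close>
  then force \<open>dist q a = 0\<close>.
\<close>

lemma coord_perpendicular:
  fixes z :: 'a
  assumes p: "projectable I \<alpha>" and \<beta>: "geodesic_from_to \<beta> (\<alpha> (coord I \<alpha> z)) z" and t: "t \<in> I"
  shows "coord {0..dist (\<alpha> (coord I \<alpha> z)) z} \<beta> (\<alpha> t) = 0"
proof -
  let ?c = "coord I \<alpha> z"
  define d where "d = dist (\<alpha> ?c) z"
  note B = geodesic_from_toD[OF \<beta>, folded d_def]
  have d0: "0 \<le> d" by (simp add: d_def)
  have pB: "projectable {0..d} \<beta>" by (rule projectable_segment[OF B(1) d0])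
  define u where "u = coord {0..d} \<beta> (\<alpha> t)"
  have u: "u \<in> {0..d}" unfolding u_def by (rule coord_mem[OF pB])
  have 1: "(dist (\<alpha> t) (\<beta> u))\<^sup>2 + (0 - u)\<^sup>2 \<le> (dist (\<alpha> t) (\<beta> 0))\<^sup>2"
    unfolding u_def
    by (rule nearest_point_pythagoras[OF cat0 B(1) coord_mem[OF pB] _ coord_nearest[OF pB]]) (use d0 in auto)
  have uc: "coord I \<alpha> (\<beta> u) = ?c"
  proof (rule coord_between[OF p])
    show "dist z (\<beta> u) + dist (\<beta> u) (\<alpha> ?c) = dist z (\<alpha> ?c)"
      using geodesic_on_dist[OF B(1), of d u] geodesic_on_dist[OF B(1), of u 0] B(2,3) u d0
      by (auto simp: d_def dist_commute)
  qed
  have "(dist (\<beta> u) (\<alpha> ?c))\<^sup>2 + (t - ?c)\<^sup>2 \<le> (dist (\<beta> u) (\<alpha> t))\<^sup>2"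
    using nearest_point_pythagoras[OF cat0 projectableD[OF p] coord_mem[OF p] t coord_nearest[OF p], of "\<beta> u"]
    by (simp add: uc)
  moreover have "(dist (\<alpha> t) (\<beta> 0))\<^sup>2 = (t - ?c)\<^sup>2"
    using geodesic_on_dist[OF projectableD[OF p] t coord_mem[OF p], of z] by (simp add: B(2))
  moreover have "(dist (\<beta> u) (\<alpha> ?c))\<^sup>2 = u\<^sup>2"
    using geodesic_on_dist[OF B(1), of u 0] u d0 by (simp add: B(2))
  moreover have "(0 - u)\<^sup>2 = u\<^sup>2" by simp
  ultimately have "u\<^sup>2 \<le> 0" using 1 unfolding dist_commute[of "\<beta> u" "\<alpha> t"] by linarith
  then have "u = 0" by simp
  then show ?thesis by (simp add: u_def d_def)
qed

end

text \<open>
  Bounds of curtains are kept in the form \<open>r - 1/2\<close>, \<open>r + 1/2\<close>; clearing the denominators would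
  put goals and hypotheses into different shapes.
\<close>

declare le_divide_eq_numeral1 [simp del] divide_le_eq_numeral1 [simp del]
  less_divide_eq_numeral1 [simp del] divide_less_eq_numeral1 [simp del]

section \<open>Curtains as bands of Lipschitz functions\<close>

lemma curtain_dual_iff:
  "curtain_dual I \<alpha> r \<longleftrightarrow> projectable I \<alpha> \<and> {r - 1/2..r + 1/2} \<subseteq> interior I"
  by (auto simp: curtain_dual_def projectable_def)

lemma nearest_point_in_image_iff:
  assumes p: "projectable I \<alpha>" and "K \<subseteq> I"
  shows "nearest_point (\<alpha> ` I) x \<in> \<alpha> ` K \<longleftrightarrow> coord I \<alpha> x \<in> K"
  unfolding nearest_point_coord[OF p]
  using inj_on_image_mem_iff[OF geodesic_on_inj[OF projectableD[OF p]] coord_mem[OF p] assms(2)] .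

lemma
  assumes "curtain_dual I \<alpha> r"
  shows mem_curtain_iff: "x \<in> curtain I \<alpha> r \<longleftrightarrow> r - 1/2 \<le> coord I \<alpha> x \<and> coord I \<alpha> x \<le> r + 1/2"
    and mem_halfspace_minus_iff: "x \<in> halfspace_minus I \<alpha> r \<longleftrightarrow> coord I \<alpha> x < r - 1/2"
    and mem_halfspace_plus_iff: "x \<in> halfspace_plus I \<alpha> r \<longleftrightarrow> coord I \<alpha> x > r + 1/2"
proof -
  have p: "projectable I \<alpha>" and sub: "{r - 1/2..r + 1/2} \<subseteq> I"
    using assms interior_subset unfolding curtain_dual_iff by blast+
  show "x \<in> curtain I \<alpha> r \<longleftrightarrow> r - 1/2 \<le> coord I \<alpha> x \<and> coord I \<alpha> x \<le> r + 1/2"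
    unfolding curtain_def vimage_eq nearest_point_in_image_iff[OF p sub]
    by (simp only: atLeastAtMost_iff)
  show "x \<in> halfspace_minus I \<alpha> r \<longleftrightarrow> coord I \<alpha> x < r - 1/2"
    unfolding halfspace_minus_def vimage_eq
    by (subst nearest_point_in_image_iff[OF p]) (use coord_mem[OF p] in auto)
  show "x \<in> halfspace_plus I \<alpha> r \<longleftrightarrow> coord I \<alpha> x > r + 1/2"
    unfolding halfspace_plus_def vimage_eq
    by (subst nearest_point_in_image_iff[OF p]) (use coord_mem[OF p] in auto)
qed

lemma separates_commute: "separates h A B \<longleftrightarrow> separates h B A"
  unfolding separates_def by blast

text \<open>
  A level function of \<open>h\<close> forgets the geodesic to which \<open>h\<close> is dual and keeps what the arguments
  below use; replacing \<open>f\<close> by \<open>- f\<close> exchanges the halfspaces.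
\<close>

definition level_function :: "'a::metric_space set \<Rightarrow> ('a \<Rightarrow> real) \<Rightarrow> bool" where
  "level_function h f \<longleftrightarrow>
     (\<forall>x y. \<bar>f x - f y\<bar> \<le> dist x y) \<and> h = {x. - 1/2 \<le> f x \<and> f x \<le> 1/2} \<and> h \<noteq> {} \<and>
     (\<forall>J. is_interval J \<longrightarrow> connected (f -` J)) \<and>
     (\<forall>A B. (\<forall>a\<in>A. f a < - 1/2) \<longrightarrow> (\<forall>b\<in>B. 1/2 < f b) \<longrightarrow> separates h A B)"

lemma
  assumes "level_function h f"
  shows level_lipschitz: "\<bar>f x - f y\<bar> \<le> dist x y"
    and level_mem_iff: "x \<in> h \<longleftrightarrow> - 1/2 \<le> f x \<and> f x \<le> 1/2"
    and level_nonempty: "h \<noteq> {}"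
    and level_connected: "is_interval J \<Longrightarrow> connected (f -` J)"
    and level_separates: "(\<And>a. a \<in> A \<Longrightarrow> f a < - 1/2) \<Longrightarrow> (\<And>b. b \<in> B \<Longrightarrow> 1/2 < f b) \<Longrightarrow> separates h A B"
  using assms unfolding level_function_def by blast+

text \<open>Chains are infinite or have arbitrary size a priori, so a bound on the size includes finiteness.\<close>

definition at_most :: "'b set \<Rightarrow> real \<Rightarrow> bool" where
  "at_most C a \<longleftrightarrow> finite C \<and> real (card C) \<le> a"

lemma at_most_Un:
  assumes "at_most A a" "at_most B b" "C \<subseteq> A \<union> B"
  shows "at_most C (a + b)"
proof -
  have fin: "finite (A \<union> B)" using assms by (simp add: at_most_def)
  have "card C \<le> card A + card B"
    using card_mono[OF fin assms(3)] card_Un_le[of A B] by linarith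
  then have "real (card C) \<le> real (card A) + real (card B)" by linarith
  then show ?thesis using assms fin finite_subset unfolding at_most_def by fastforce
qed

lemma at_most_subset: "at_most A a \<Longrightarrow> C \<subseteq> A \<Longrightarrow> a \<le> b \<Longrightarrow> at_most C b"
  unfolding at_most_def
  by (meson card_mono finite_subset of_nat_mono order_trans)

lemma at_most_one: "(\<And>x y. x \<in> C \<Longrightarrow> y \<in> C \<Longrightarrow> x = y) \<Longrightarrow> at_most C 1"
proof -
  assume *: "\<And>x y. x \<in> C \<Longrightarrow> y \<in> C \<Longrightarrow> x = y"
  show "at_most C 1"
  proof (cases "C = {}")
    case False
    then obtain x where "x \<in> C" by blast
    with * have "C = {x}" by blast
    then show ?thesis by (simp add: at_most_def)
  qed (simp add: at_most_def)
qed

lemma at_most_containing: "disjoint C \<Longrightarrow> at_most {h \<in> C. w \<in> h} 1"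
  by (rule at_most_one) (auto simp: pairwise_def disjnt_iff)

lemma lipschitz_connected_hits:
  fixes f :: "'a::metric_space \<Rightarrow> real"
  assumes "\<And>x y. \<bar>f x - f y\<bar> \<le> dist x y" "connected C" "x \<in> C" "y \<in> C" "f x \<le> t" "t \<le> f y"
  shows "\<exists>z\<in>C. f z = t"
proof -
  have "continuous_on C f" unfolding continuous_on_iff dist_real_def
    using assms(1) by (meson le_less_trans)
  then have "connected (f ` C)" using assms(2) by (rule connected_continuous_image)
  from connected_contains_Icc[OF this, of "f x" "f y"] assms show ?thesis by auto
qed

lemma geodesic_from_to_tail:
  assumes "geodesic_on {a..b} \<gamma>" "a \<le> s" "s \<le> b"
  shows "geodesic_from_to (\<lambda>t. \<gamma> (s + t)) (\<gamma> s) (\<gamma> b)"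
proof -
  have d: "dist (\<gamma> s) (\<gamma> b) = b - s" using geodesic_on_dist[OF assms(1), of s b] assms by auto
  have "dist (\<gamma> (s + u)) (\<gamma> (s + v)) = dist u v" if "u \<in> {0..b - s}" "v \<in> {0..b - s}" for u v
    using geodesic_on_dist[OF assms(1), of "s + u" "s + v"] assms that by (auto simp: dist_real_def)
  then show ?thesis unfolding geodesic_from_to_def geodesic_on_def d by (auto simp: is_interval_cc)
qed

text \<open>
  Sides are described by connected sets, which do not depend on the geodesic that presents a
  curtain. This is what allows the order of a chain to be followed from one curtain to the next.
\<close>

definition same_side :: "'a::topological_space set \<Rightarrow> 'a set \<Rightarrow> 'a set \<Rightarrow> bool" where
  "same_side h A B \<longleftrightarrow> (\<exists>C. connected C \<and> A \<subseteq> C \<and> B \<subseteq> C \<and> C \<inter> h = {})"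

lemma same_side_trans:
  assumes "same_side h A B" "same_side h B D" "B \<noteq> {}"
  shows "same_side h A D"
proof -
  obtain C C' where "connected C" "A \<subseteq> C" "B \<subseteq> C" "C \<inter> h = {}"
    "connected C'" "B \<subseteq> C'" "D \<subseteq> C'" "C' \<inter> h = {}"
    using assms unfolding same_side_def by blast
  then show ?thesis unfolding same_side_def
    using assms(3) by (intro exI[of _ "C \<union> C'"] conjI connected_Un) blast+
qed

lemma same_side_commute: "same_side h A B \<longleftrightarrow> same_side h B A"
  unfolding same_side_def by blast

lemma connected_off_curtain:
  assumes "level_function h f" "connected A" "A \<inter> h = {}"
  shows "(\<forall>a\<in>A. f a < - 1/2) \<or> (\<forall>a\<in>A. 1/2 < f a)"
proof (rule ccontr)
  assume "\<not> ?thesis"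
  then obtain a b where ab: "a \<in> A" "\<not> f a < - 1/2" "b \<in> A" "\<not> 1/2 < f b" by blast
  have "a \<notin> h" "b \<notin> h" using ab assms(3) by auto
  then have "f a > 1/2" "f b < - 1/2"
    using ab level_mem_iff[OF assms(1)] by auto
  then obtain z where "z \<in> A" "f z = 0"
    using lipschitz_connected_hits[OF level_lipschitz[OF assms(1)] assms(2) ab(3,1), of 0] by auto
  then show False using assms(3) level_mem_iff[OF assms(1), of z] by auto
qed

lemma L_separated_disjoint:
  "pairwise (L_separated L) C \<Longrightarrow> disjoint C"
  by (auto simp: pairwise_def L_separated_def disjnt_def)

context
  assumes cat0: "is_CAT0 TYPE('a::metric_space)"
begin

lemma curtain_level:
  assumes cd: "curtain_dual I (\<alpha> :: real \<Rightarrow> 'a) r"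
  shows "level_function (curtain I \<alpha> r) (\<lambda>x. coord I \<alpha> x - r)"
    and "level_function (curtain I \<alpha> r) (\<lambda>x. r - coord I \<alpha> x)"
proof -
  have p: "projectable I \<alpha>" and sub: "{r - 1/2..r + 1/2} \<subseteq> I"
    using assms interior_subset unfolding curtain_dual_iff by blast+
  have "r \<in> {r - 1/2..r + 1/2}" by simp
  then have "r \<in> I" using sub by blast
  from coord_on[OF p this] have ne: "curtain I \<alpha> r \<noteq> {}"
    using mem_curtain_iff[OF cd, of "\<alpha> r"] by auto
  have lip: "\<bar>coord I \<alpha> x - coord I \<alpha> y\<bar> \<le> dist x y" for x y
    by (rule coord_lipschitz[OF cat0 p])
  have shift: "connected ((\<lambda>x. g (coord I \<alpha> x)) -` J)"
    if "is_interval (g -` J)" for g :: "real \<Rightarrow> real" and J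
    using coord_preimage_connected[OF cat0 p that] by (simp add: vimage_def)
  have sep: "separates (curtain I \<alpha> r) A B \<and> separates (curtain I \<alpha> r) B A"
    if "\<And>a. a \<in> A \<Longrightarrow> coord I \<alpha> a < r - 1/2" "\<And>b. b \<in> B \<Longrightarrow> coord I \<alpha> b > r + 1/2" for A B
  proof -
    have "A \<subseteq> halfspace_minus I \<alpha> r" "B \<subseteq> halfspace_plus I \<alpha> r"
      using that mem_halfspace_minus_iff[OF cd] mem_halfspace_plus_iff[OF cd] by auto
    then have "separates (curtain I \<alpha> r) A B"
      unfolding separates_def using cd by (intro exI[of _ I] exI[of _ \<alpha>] exI[of _ r]) simp
    then show ?thesis using separates_commute[of "curtain I \<alpha> r" A B] by simp
  qed
  show "level_function (curtain I \<alpha> r) (\<lambda>x. coord I \<alpha> x - r)"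
    unfolding level_function_def
  proof (intro conjI allI impI)
    fix J :: "real set" assume J: "is_interval J"
    have "is_interval ((\<lambda>t. t - r) -` J)" unfolding is_interval_1
    proof (intro ballI allI impI)
      fix a b x assume "a \<in> (\<lambda>t. t - r) -` J" "b \<in> (\<lambda>t. t - r) -` J" "a \<le> x \<and> x \<le> b"
      with J[unfolded is_interval_1, rule_format, of "a - r" "b - r" "x - r"]
      show "x \<in> (\<lambda>t. t - r) -` J" by auto
    qed
    then show "connected ((\<lambda>x. coord I \<alpha> x - r) -` J)" by (rule shift[of "\<lambda>t. t - r"])
  next
    fix A B assume *: "\<forall>a\<in>A. coord I \<alpha> a - r < - 1/2" "\<forall>b\<in>B. 1/2 < coord I \<alpha> b - r"
    have "coord I \<alpha> a < r - 1/2" if "a \<in> A" for a using *(1)[rule_format, OF that] by linarith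
    moreover have "coord I \<alpha> b > r + 1/2" if "b \<in> B" for b using *(2)[rule_format, OF that] by linarith
    ultimately show "separates (curtain I \<alpha> r) A B" using sep by blast
  next
    fix x y show "\<bar>coord I \<alpha> x - r - (coord I \<alpha> y - r)\<bar> \<le> dist x y" using lip[of x y] by simp
  next
    show "curtain I \<alpha> r = {x. - 1/2 \<le> coord I \<alpha> x - r \<and> coord I \<alpha> x - r \<le> 1/2}"
      by (auto simp: mem_curtain_iff[OF cd])
  qed (rule ne)
  show "level_function (curtain I \<alpha> r) (\<lambda>x. r - coord I \<alpha> x)"
    unfolding level_function_def
  proof (intro conjI allI impI)
    fix J :: "real set" assume J: "is_interval J"
    have "is_interval ((\<lambda>t. r - t) -` J)" unfolding is_interval_1
    proof (intro ballI allI impI)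
      fix a b x assume "a \<in> (\<lambda>t. r - t) -` J" "b \<in> (\<lambda>t. r - t) -` J" "a \<le> x \<and> x \<le> b"
      with J[unfolded is_interval_1, rule_format, of "r - b" "r - a" "r - x"]
      show "x \<in> (\<lambda>t. r - t) -` J" by auto
    qed
    then show "connected ((\<lambda>x. r - coord I \<alpha> x) -` J)" by (rule shift[of "\<lambda>t. r - t"])
  next
    fix A B assume *: "\<forall>a\<in>A. r - coord I \<alpha> a < - 1/2" "\<forall>b\<in>B. 1/2 < r - coord I \<alpha> b"
    have "coord I \<alpha> a > r + 1/2" if "a \<in> A" for a using *(1)[rule_format, OF that] by linarith
    moreover have "coord I \<alpha> b < r - 1/2" if "b \<in> B" for b using *(2)[rule_format, OF that] by linarith
    ultimately show "separates (curtain I \<alpha> r) A B" using sep by blast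
  next
    fix x y show "\<bar>r - coord I \<alpha> x - (r - coord I \<alpha> y)\<bar> \<le> dist x y" using lip[of x y] by simp
  next
    show "curtain I \<alpha> r = {x. - 1/2 \<le> r - coord I \<alpha> x \<and> r - coord I \<alpha> x \<le> 1/2}"
      by (auto simp: mem_curtain_iff[OF cd])
  qed (rule ne)
qed

lemma is_curtain_level: "is_curtain (h :: 'a set) \<Longrightarrow> \<exists>f. level_function h f"
  unfolding is_curtain_def using curtain_level by blast

lemma separates_level:
  assumes "separates (h :: 'a set) A B"
  obtains f where "level_function h f" "\<And>a. a \<in> A \<Longrightarrow> f a < - 1/2" "\<And>b. b \<in> B \<Longrightarrow> 1/2 < f b"
proof -
  obtain I \<alpha> r where cd: "curtain_dual I \<alpha> r" and h: "h = curtain I \<alpha> r"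
    and "A \<subseteq> halfspace_minus I \<alpha> r \<and> B \<subseteq> halfspace_plus I \<alpha> r \<or>
         B \<subseteq> halfspace_minus I \<alpha> r \<and> A \<subseteq> halfspace_plus I \<alpha> r" (is "?P \<or> ?Q")
    using assms unfolding separates_def by blast
  then consider ?P | ?Q by blast
  then show thesis
  proof cases
    case 1
    show thesis
      by (rule that[OF curtain_level(1)[OF cd, folded h]])
        (use 1 in \<open>auto dest!: subsetD simp: mem_halfspace_minus_iff[OF cd] mem_halfspace_plus_iff[OF cd]\<close>)
  next
    case 2
    show thesis
      by (rule that[OF curtain_level(2)[OF cd, folded h]])
        (use 2 in \<open>auto dest!: subsetD simp: mem_halfspace_minus_iff[OF cd] mem_halfspace_plus_iff[OF cd]\<close>)
  qed
qed

lemma separates_mono: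
  assumes "separates (h :: 'a set) A B" "A' \<subseteq> A" "B' \<subseteq> B"
  shows "separates h A' B'"
proof -
  obtain f where f: "level_function h f" "\<And>a. a \<in> A \<Longrightarrow> f a < - 1/2" "\<And>b. b \<in> B \<Longrightarrow> 1/2 < f b"
    using separates_level[OF assms(1)] by blast
  show ?thesis by (rule level_separates[OF f(1)]) (use f(2,3) assms(2,3) in blast)+
qed

lemma curtain_connected: "is_curtain (h :: 'a set) \<Longrightarrow> connected h"
proof -
  assume "is_curtain h"
  then obtain f where f: "level_function h f" using is_curtain_level by blast
  have "h = f -` {- 1/2..1/2}" by (simp add: set_eq_iff level_mem_iff[OF f])
  then show ?thesis using level_connected[OF f is_interval_cc] by simp
qed

lemma curtain_nonempty: "is_curtain (h :: 'a set) \<Longrightarrow> h \<noteq> {}"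
  using is_curtain_level level_nonempty by blast

lemma separates_not_same_side:
  assumes "separates (h :: 'a set) A B" "A \<noteq> {}" "B \<noteq> {}"
  shows "\<not> same_side h A B"
proof
  obtain f where f: "level_function h f" "\<And>a. a \<in> A \<Longrightarrow> f a < - 1/2" "\<And>b. b \<in> B \<Longrightarrow> 1/2 < f b"
    using separates_level[OF assms(1)] by blast
  assume "same_side h A B"
  then obtain C where C: "connected C" "A \<subseteq> C" "B \<subseteq> C" "C \<inter> h = {}" unfolding same_side_def by blast
  obtain a b where ab: "a \<in> A" "b \<in> B" using assms by blast
  obtain z where "z \<in> C" "f z = 0"
    using lipschitz_connected_hits[OF level_lipschitz[OF f(1)] C(1) subsetD[OF C(2) ab(1)] subsetD[OF C(3) ab(2)], of 0]
      f(2)[OF ab(1)] f(3)[OF ab(2)] by auto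
  then show False using C(4) level_mem_iff[OF f(1), of z] by auto
qed

lemma not_same_side_separates:
  assumes h: "is_curtain (h :: 'a set)" and A: "connected A" "A \<inter> h = {}"
    and B: "connected B" "B \<inter> h = {}" and n: "\<not> same_side h A B"
  shows "separates h A B"
proof -
  obtain f where f: "level_function h f" using is_curtain_level[OF h] by blast
  have conn: "connected (f -` {..<- 1/2})" "connected (f -` {1/2<..})"
    using level_connected[OF f] by auto
  have off: "f -` {..<- 1/2} \<inter> h = {}" "f -` {1/2<..} \<inter> h = {}"
    by (auto simp: level_mem_iff[OF f])
  have 1: "\<not> ((\<forall>a\<in>A. f a < - 1/2) \<and> (\<forall>b\<in>B. f b < - 1/2))"
    using n conn(1) off(1) unfolding same_side_def by blast
  have 2: "\<not> ((\<forall>a\<in>A. 1/2 < f a) \<and> (\<forall>b\<in>B. 1/2 < f b))"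
    using n conn(2) off(2) unfolding same_side_def by blast
  from connected_off_curtain[OF f A] connected_off_curtain[OF f B] 1 2
  consider "\<forall>a\<in>A. f a < - 1/2" "\<forall>b\<in>B. 1/2 < f b" | "\<forall>a\<in>A. 1/2 < f a" "\<forall>b\<in>B. f b < - 1/2"
    by blast
  then show ?thesis
  proof cases
    case 1 then show ?thesis by (intro level_separates[OF f]) auto
  next
    case 2 then have "separates h B A" by (intro level_separates[OF f]) auto
    then show ?thesis by (simp add: separates_commute)
  qed
qed

text \<open>
  Otherwise the closed halfspace of \<open>a\<close> that contains \<open>c\<close> but not \<open>b\<close> is a connected set that joins
  \<open>a\<close> to \<open>c\<close> and avoids \<open>b\<close>. So of three disjoint curtains at most one lies between the other two.
\<close>

lemma same_side_if_separates:
  assumes "is_curtain (a :: 'a set)" "is_curtain b" "is_curtain c" "a \<inter> b = {}" "a \<inter> c = {}"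
    and sep: "separates b a c"
  shows "same_side a b c"
proof (rule ccontr)
  assume "\<not> same_side a b c"
  then have "separates a c b"
    using assms by (subst separates_commute, intro not_same_side_separates) (auto simp: curtain_connected)
  then obtain f where f: "level_function a f" "\<And>x. x \<in> c \<Longrightarrow> f x < - 1/2" "\<And>x. x \<in> b \<Longrightarrow> 1/2 < f x"
    using separates_level by blast
  have "same_side b a c" unfolding same_side_def
  proof (intro exI conjI)
    show "connected (f -` {..1/2})" using level_connected[OF f(1)] by auto
    show "a \<subseteq> f -` {..1/2}" by (auto simp: level_mem_iff[OF f(1)])
    show "c \<subseteq> f -` {..1/2}" by (auto dest!: f(2))
    show "f -` {..1/2} \<inter> b = {}" by (auto dest!: f(3))
  qed
  then show False using separates_not_same_side[OF sep] assms curtain_nonempty by blast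
qed

section \<open>Chains\<close>

text \<open>
  The definition of a chain speaks of consecutive curtains only; the order extends to all triples,
  by induction on the gap between the outer two.
\<close>

lemma chain_separates_outer:
  fixes k :: "int \<Rightarrow> 'a set"
  assumes J: "\<And>i j. i \<in> J \<Longrightarrow> j \<in> J \<Longrightarrow> {i..j} \<subseteq> J"
    and cur: "\<And>i. i \<in> J \<Longrightarrow> is_curtain (k i)"
    and dis: "\<And>i j. i \<in> J \<Longrightarrow> j \<in> J \<Longrightarrow> i \<noteq> j \<Longrightarrow> k i \<inter> k j = {}"
    and sep: "\<And>i. i - 1 \<in> J \<Longrightarrow> i + 1 \<in> J \<Longrightarrow> separates (k i) (k (i - 1)) (k (i + 1))"
  shows "i \<in> J \<Longrightarrow> l \<in> J \<Longrightarrow> i < j \<Longrightarrow> j < l \<Longrightarrow> separates (k j) (k i) (k l)"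
proof (induction "nat (l - i)" arbitrary: i j l rule: less_induct)
  case less
  have mem: "m \<in> J" if "i \<le> m" "m \<le> l" for m using J[OF less.prems(1,2)] that by auto
  note curd = cur curtain_connected[OF cur] curtain_nonempty[OF cur]
  have ext: "separates (k j) (k a) (k c)"
    if ss: "same_side (k j) (k a) (k b)" and s: "separates (k j) (k b) (k c)"
      and m: "a \<in> J" "b \<in> J" "c \<in> J" "j \<in> J" "a \<noteq> j" "b \<noteq> j" "c \<noteq> j" for a b c
  proof (rule not_same_side_separates)
    show "\<not> same_side (k j) (k a) (k c)"
    proof
      assume "same_side (k j) (k a) (k c)"
      with ss have "same_side (k j) (k b) (k c)"
        using same_side_trans[of "k j" "k b" "k a" "k c"] same_side_commute curd(3)[OF m(1)] by blast
      then show False using separates_not_same_side[OF s] curd m by blast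
    qed
  qed (use m curd dis in auto)
  have j: "j \<in> J" using mem less.prems by simp
  consider "j > i + 1" | "j = i + 1" "l > i + 2" | "j = i + 1" "l = i + 2"
    using less.prems by linarith
  then show ?case
  proof cases
    case 1
    have i': "i + 1 \<in> J" using mem 1 less.prems by simp
    have "separates (k (i + 1)) (k i) (k j)"
      by (rule less.hyps) (use 1 less.prems j in auto)
    then have "same_side (k j) (k (i + 1)) (k i)"
      using i' j less.prems 1
      by (intro same_side_if_separates cur dis) (auto simp: separates_commute)
    moreover have "separates (k j) (k (i + 1)) (k l)"
      by (rule less.hyps) (use 1 less.prems i' in auto)
    ultimately show ?thesis
      using less.prems i' j 1 by (intro ext[of i "i + 1" l]) (auto simp: same_side_commute)
  next
    case 2
    have l': "l - 1 \<in> J" using mem 2 less.prems by simp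
    have "separates (k (l - 1)) (k j) (k l)"
      by (rule less.hyps) (use 2 less.prems j in auto)
    then have "same_side (k j) (k (l - 1)) (k l)"
      using l' j less.prems 2
      by (intro same_side_if_separates cur dis) auto
    moreover have "separates (k j) (k i) (k (l - 1))"
      by (rule less.hyps) (use 2 less.prems l' in auto)
    ultimately have "separates (k j) (k l) (k i)"
      using less.prems l' j 2 by (intro ext[of l "l - 1" i]) (auto simp: same_side_commute separates_commute)
    then show ?thesis by (simp add: separates_commute)
  next
    case 3
    then have "j - 1 = i" "j + 1 = l" by simp_all
    with sep[of j] less.prems show ?thesis by simp
  qed
qed

text \<open>
  Parametrise a geodesic from \<open>u\<close> to \<open>v\<close> by arc length: a curtain that separates \<open>u\<close> from \<open>v\<close> has
  width one and a 1-Lipschitz level function, so it contains a point with integral parameter.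
\<close>

lemma at_most_separating:
  fixes u v :: 'a
  assumes dis: "disjoint C" and sep: "\<And>h. h \<in> C \<Longrightarrow> separates h {u} {v}"
  shows "at_most C (dist u v + 1)"
proof -
  obtain g where g: "geodesic_from_to g u v" using geodesic_exists[OF cat0] by blast
  note G = geodesic_from_toD[OF g]
  define N where "N = nat \<lfloor>dist u v\<rfloor>"
  have N: "real N \<le> dist u v" "dist u v < real N + 1" unfolding N_def by (simp_all add: floor_less_iff)
  have "\<exists>n\<le>N. g (real n) \<in> h" if hC: "h \<in> C" for h
  proof -
    obtain f where f: "level_function h f" "f u < - 1/2" "1/2 < f v"
      using separates_level[OF sep[OF hC]] by (metis singletonI)
    have lip: "\<bar>f (g s) - f (g t)\<bar> \<le> \<bar>s - t\<bar>" if "s \<in> {0..dist u v}" "t \<in> {0..dist u v}" for s t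
      using level_lipschitz[OF f(1), of "g s" "g t"] geodesic_on_dist[OF G(1) that] by simp
    define n where "n = (GREATEST n. n \<le> N \<and> f (g (real n)) \<le> 1/2)"
    have n: "n \<le> N \<and> f (g (real n)) \<le> 1/2" unfolding n_def
      by (rule GreatestI_nat[of _ 0 N]) (use f G in auto)
    have nmax: "m \<le> n" if "m \<le> N \<and> f (g (real m)) \<le> 1/2" for m unfolding n_def
      by (rule Greatest_le_nat[of _ _ N]) (use that in auto)
    have "f (g (real n)) > - 1/2"
    proof (cases "n = N")
      case True
      then show ?thesis using lip[of "real n" "dist u v"] N f(3) G(3) by auto
    next
      case False
      with n have "n + 1 \<le> N" by simp
      with nmax[of "n + 1"] have "f (g (real (n + 1))) > 1/2" by force
      then show ?thesis using lip[of "real n" "real (n + 1)"] N \<open>n + 1 \<le> N\<close> by auto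
    qed
    with n have "g (real n) \<in> h" by (simp add: level_mem_iff[OF f(1)])
    with n show ?thesis by blast
  qed
  then obtain n where n: "\<And>h. h \<in> C \<Longrightarrow> n h \<le> N \<and> g (real (n h)) \<in> h" by metis
  have "inj_on n C"
    using n dis unfolding inj_on_def pairwise_def disjnt_iff by metis
  moreover have "n ` C \<subseteq> {..N}" using n by auto
  ultimately have "finite C" "card C \<le> N + 1"
    using inj_on_finite[of n C "{..N}"] card_inj_on_le[of n C "{..N}"] by auto
  then show ?thesis using N by (simp add: at_most_def)
qed

lemma separates_trichotomy:
  assumes "separates (h :: 'a set) {u} {v}" "w \<notin> h"
  shows "separates h {u} {w} \<or> separates h {w} {v}"
proof -
  obtain f where f: "level_function h f" "f u < - 1/2" "1/2 < f v"
    using separates_level[OF assms(1)] by (metis singletonI)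
  from assms(2) consider "1/2 < f w" | "f w < - 1/2"
    unfolding level_mem_iff[OF f(1)] by linarith
  then show ?thesis
  proof cases
    case 1 then show ?thesis using level_separates[OF f(1), of "{u}" "{w}"] f by auto
  next
    case 2 then show ?thesis using level_separates[OF f(1), of "{w}" "{v}"] f by auto
  qed
qed

text \<open>
  The step for counting along a broken geodesic with corner \<open>w\<close>.
\<close>

lemma at_most_split:
  assumes dis: "disjoint C" and sep: "\<And>h. h \<in> C \<Longrightarrow> separates h {u} {v :: 'a}"
    and "at_most {h \<in> C. separates h {u} {w}} a" "at_most {h \<in> C. separates h {w} {v}} b"
  shows "at_most C (a + b + 1)"
proof -
  have "at_most ({h \<in> C. separates h {u} {w}} \<union> {h \<in> C. separates h {w} {v}}) (a + b)"
    by (rule at_most_Un[OF assms(3,4)]) simp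
  from at_most_Un[OF this at_most_containing[OF dis, of w], of C]
  show ?thesis using separates_trichotomy[OF sep] by blast
qed

lemma separates_meets_segment:
  assumes "separates (h :: 'a set) {u} {v}" "geodesic_from_to g u v"
  shows "\<exists>t\<in>{0..dist u v}. g t \<in> h"
proof (rule ccontr)
  note G = geodesic_from_toD[OF assms(2)]
  assume "\<not> ?thesis"
  moreover have "u \<in> g ` {0..dist u v}" "v \<in> g ` {0..dist u v}"
    using G(2,3) by (force intro: image_eqI[of _ _ 0], force intro: image_eqI[of _ _ "dist u v"])
  ultimately have "same_side h {u} {v}" unfolding same_side_def
    using geodesic_image_connected[OF G(1)] by (intro exI[of _ "g ` {0..dist u v}"]) auto
  then show False using separates_not_same_side[OF assms(1)] by blast
qed

text \<open>
  The chains against which \<open>L\<close>-separation will be tested (with \<open>N = 2\<close>), and, for contracting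
  geodesics and large \<open>N\<close>, the \<open>L\<close>-chains that bound the curtain distance from below.
\<close>

lemma dual_chain:
  fixes \<alpha> :: "real \<Rightarrow> 'a"
  assumes p: "projectable I \<alpha>" and N: "N > 1"
    and sub: "\<And>i. i < n \<Longrightarrow> {r + N * real i - 1/2..r + N * real i + 1/2} \<subseteq> interior I"
  shows "curtain_chain ((\<lambda>i. curtain I \<alpha> (r + N * real i)) ` {..<n})"
    and "card ((\<lambda>i. curtain I \<alpha> (r + N * real i)) ` {..<n}) = n"
proof -
  define k where "k i = curtain I \<alpha> (r + N * of_int i)" for i :: int
  define c where "c = (\<lambda>i. curtain I \<alpha> (r + N * real i)) ` {..<n}"
  have cd: "curtain_dual I \<alpha> (r + N * of_int i)" if "i \<in> {0..<int n}" for i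
  proof -
    have "nat i < n" "real (nat i) = of_int i" using that by auto
    with sub[of "nat i"] p show ?thesis unfolding curtain_dual_iff by simp
  qed
  have kc: "k i = curtain I \<alpha> (r + N * real (nat i))" if "i \<in> {0..<int n}" for i
    using that by (simp add: k_def)
  have c_eq: "c = k ` {0..<int n}"
  proof
    show "c \<subseteq> k ` {0..<int n}"
    proof
      fix h assume "h \<in> c"
      then obtain i where "i < n" "h = curtain I \<alpha> (r + N * real i)" by (auto simp: c_def)
      then show "h \<in> k ` {0..<int n}" by (intro image_eqI[of _ _ "int i"]) (auto simp: k_def)
    qed
    show "k ` {0..<int n} \<subseteq> c"
    proof
      fix h assume "h \<in> k ` {0..<int n}"
      then obtain i where "i \<in> {0..<int n}" "h = k i" by blast
      with kc have "nat i < n" "h = curtain I \<alpha> (r + N * real (nat i))" by auto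
      then show "h \<in> c" by (auto simp: c_def)
    qed
  qed
  have memk: "x \<in> k i \<longleftrightarrow> r + N * of_int i - 1/2 \<le> coord I \<alpha> x \<and> coord I \<alpha> x \<le> r + N * of_int i + 1/2"
    if "i \<in> {0..<int n}" for i x
    unfolding k_def by (rule mem_curtain_iff[OF cd[OF that]])
  have gap: "N * of_int i + 1 < N * of_int j" if "i < j" for i j :: int
  proof -
    have "N * 1 \<le> N * of_int (j - i)" using that N by (intro mult_left_mono) auto
    then show ?thesis using N by (simp add: algebra_simps)
  qed
  have cur: "is_curtain (k i)" if "i \<in> {0..<int n}" for i
    using cd[OF that] unfolding is_curtain_def k_def by blast
  have dis: "k i \<inter> k j = {}" if "i \<in> {0..<int n}" "j \<in> {0..<int n}" "i \<noteq> j" for i j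
  proof (rule ccontr)
    assume "k i \<inter> k j \<noteq> {}"
    then obtain x where "x \<in> k i" "x \<in> k j" by blast
    with memk that gap[of i j] gap[of j i] show False by (cases "i < j") auto
  qed
  have inj: "inj_on k {0..<int n}"
    using dis curtain_nonempty[OF cur] by (force simp: inj_on_def)
  have bij: "bij_betw k {0..<int n} c" using inj c_eq by (simp add: bij_betw_def)
  have sep: "separates (k i) (k (i - 1)) (k (i + 1))"
    if "i - 1 \<in> {0..<int n}" "i + 1 \<in> {0..<int n}" for i
  proof -
    have i: "i \<in> {0..<int n}" using that by simp
    show ?thesis unfolding k_def[of i]
    proof (rule level_separates[OF curtain_level(1)[OF cd[OF i]]])
      show "coord I \<alpha> a - (r + N * of_int i) < - 1/2" if "a \<in> k (i - 1)" for a
        using that memk[OF \<open>i - 1 \<in> _\<close>] gap[of "i - 1" i] by auto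
      show "1/2 < coord I \<alpha> a - (r + N * of_int i)" if "a \<in> k (i + 1)" for a
        using that memk[OF \<open>i + 1 \<in> _\<close>] gap[of i "i + 1"] by auto
    qed
  qed
  have "disjoint c" unfolding pairwise_def disjnt_def c_eq using dis by blast
  then have "curtain_chain c" unfolding curtain_chain_def
    using cur bij sep by (intro conjI exI[of _ "{0..<int n}"] exI[of _ k]) (auto simp: c_eq)
  moreover have "card c = n" using card_image[OF inj] c_eq by simp
  ultimately show "curtain_chain ((\<lambda>i. curtain I \<alpha> (r + N * real i)) ` {..<n})"
    "card ((\<lambda>i. curtain I \<alpha> (r + N * real i)) ` {..<n}) = n" unfolding c_def by blast+
qed

section \<open>Separated curtains that cross a geodesic\<close>

text \<open>
  The geodesic projects to the foot of the perpendicular \<open>\<beta>\<close>. So by connectedness two curtains that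
  cross the geodesic and also go up along \<open>\<beta>\<close> to height \<open>2 L + 2\<close> both meet \<open>L + 1\<close> disjoint curtains
  dual to \<open>\<beta>\<close>, one more than \<open>L\<close>-separation allows.
\<close>

lemma bottleneck:
  fixes z :: 'a
  assumes p: "projectable I \<alpha>" and \<beta>: "geodesic_from_to \<beta> (\<alpha> (coord I \<alpha> z)) z"
    and d: "d = dist (\<alpha> (coord I \<alpha> z)) z" and LS: "L_separated L h h'"
    and meet: "h \<inter> \<alpha> ` I \<noteq> {}" "h' \<inter> \<alpha> ` I \<noteq> {}"
    and x: "x \<in> h" "2 * real L + 2 \<le> coord {0..d} \<beta> x"
    and x': "x' \<in> h'" "2 * real L + 2 \<le> coord {0..d} \<beta> x'"
  shows False
proof -
  have d0: "0 \<le> d" by (simp add: d)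
  have pB: "projectable {0..d} \<beta>"
    using projectable_segment[OF cat0 _ d0] geodesic_from_toD(1)[OF \<beta>] d by simp
  have long: "2 * real L + 2 \<le> d" using coord_mem[OF pB, of x] x(2) by simp
  let ?c = "(\<lambda>i. curtain {0..d} \<beta> (1 + 2 * real i)) ` {..<Suc L}"
  have sub: "{1 + 2 * real i - 1/2..1 + 2 * real i + 1/2} \<subseteq> interior {0..d}" if "i < Suc L" for i
    using that long by (auto simp: interior_atLeastAtMost_real)
  have hit: "\<exists>y\<in>k. coord {0..d} \<beta> y = 1 + 2 * real i"
    if k: "is_curtain k" "k \<inter> \<alpha> ` I \<noteq> {}" "y \<in> k" "2 * real L + 2 \<le> coord {0..d} \<beta> y" "i < Suc L" for k y i
  proof -
    obtain t where t: "t \<in> I" "\<alpha> t \<in> k" using k(2) by blast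
    have "coord {0..d} \<beta> (\<alpha> t) = 0" unfolding d by (rule coord_perpendicular[OF cat0 p \<beta> t(1)])
    then show ?thesis
      using lipschitz_connected_hits[OF coord_lipschitz[OF cat0 pB] curtain_connected[OF k(1)] t(2) k(3),
          of "1 + 2 * real i"] k(4,5) by auto
  qed
  have "k \<inter> h \<noteq> {} \<and> k \<inter> h' \<noteq> {}" if "k \<in> ?c" for k
  proof -
    obtain i where i: "i < Suc L" and k: "k = curtain {0..d} \<beta> (1 + 2 * real i)" using \<open>k \<in> ?c\<close> by auto
    have "curtain_dual {0..d} \<beta> (1 + 2 * real i)" using pB sub[OF i] by (simp add: curtain_dual_iff)
    note m = mem_curtain_iff[OF this, folded k]
    have "is_curtain h" "is_curtain h'" using LS by (auto simp: L_separated_def)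
    from hit[OF this(1) meet(1) x i] hit[OF this(2) meet(2) x' i] obtain y y'
      where "y \<in> h" "coord {0..d} \<beta> y = 1 + 2 * real i" "y' \<in> h'" "coord {0..d} \<beta> y' = 1 + 2 * real i"
      by blast
    moreover from this have "y \<in> k" "y' \<in> k" by (simp_all add: m)
    ultimately show ?thesis by blast
  qed
  with dual_chain(1)[OF pB _ sub] LS have "card ?c \<le> L" unfolding L_separated_def by simp
  with dual_chain(2)[OF pB _ sub] show False by simp
qed

context
  fixes I :: "real set" and \<alpha> :: "real \<Rightarrow> 'a" and L :: nat and C :: "'a set set"
  assumes p: "projectable I \<alpha>" and sepC: "pairwise (L_separated L) C"
    and meet: "\<And>h. h \<in> C \<Longrightarrow> h \<inter> \<alpha> ` I \<noteq> {}"
begin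

lemma coord_perpendicular_ge:
  assumes \<beta>: "geodesic_from_to \<beta> (\<alpha> (coord I \<alpha> z)) z" and d: "d = dist (\<alpha> (coord I \<alpha> z)) z"
    and r: "dist z x \<le> r"
  shows "d - r \<le> coord {0..d} \<beta> x"
proof -
  have d0: "0 \<le> d" by (simp add: d)
  note B = geodesic_from_toD[OF \<beta>, folded d]
  have pB: "projectable {0..d} \<beta>" by (rule projectable_segment[OF cat0 B(1) d0])
  have "coord {0..d} \<beta> z = d" using coord_on[OF pB, of d] d0 B(3) by simp
  then show ?thesis using coord_lipschitz[OF cat0 pB, of z x] r by linarith
qed

lemma at_most_one_meets_ball:
  assumes "r + (2 * real L + 2) \<le> dist z (\<alpha> (coord I \<alpha> z))"
  shows "at_most {h \<in> C. h \<inter> cball z r \<noteq> {}} 1"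
proof (rule at_most_one, rule ccontr)
  fix h h' assume h: "h \<in> {h \<in> C. h \<inter> cball z r \<noteq> {}}" "h' \<in> {h \<in> C. h \<inter> cball z r \<noteq> {}}" "h \<noteq> h'"
  obtain \<beta> where \<beta>: "geodesic_from_to \<beta> (\<alpha> (coord I \<alpha> z)) z" using geodesic_exists[OF cat0] by blast
  obtain x x' where x: "x \<in> h" "dist z x \<le> r" "x' \<in> h'" "dist z x' \<le> r" using h by auto
  have "L_separated L h h'" using h sepC by (auto simp: pairwise_def)
  note bot = bottleneck[OF p \<beta> refl this _ _ x(1) _ x(3)]
  have "r + (2 * real L + 2) \<le> dist (\<alpha> (coord I \<alpha> z)) z" using assms by (simp add: dist_commute)
  with coord_perpendicular_ge[OF \<beta> refl x(2)] coord_perpendicular_ge[OF \<beta> refl x(4)]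
  have "2 * real L + 2 \<le> coord {0..dist (\<alpha> (coord I \<alpha> z)) z} \<beta> x"
    "2 * real L + 2 \<le> coord {0..dist (\<alpha> (coord I \<alpha> z)) z} \<beta> x'" by linarith+
  then show False using bot meet h by blast
qed

text \<open>
  Travelling from a point to its foot crosses boundedly many curtains of \<open>C\<close>: few by length near
  the foot, and at most one by the bottleneck above that.
\<close>

lemma at_most_separating_foot:
  assumes sep: "\<And>h. h \<in> C \<Longrightarrow> separates h {\<alpha> (coord I \<alpha> z)} {z}"
  shows "at_most C (2 * real L + 5)"
proof -
  obtain \<beta> where \<beta>: "geodesic_from_to \<beta> (\<alpha> (coord I \<alpha> z)) z" using geodesic_exists[OF cat0] by blast
  define d where "d = dist (\<alpha> (coord I \<alpha> z)) z"
  note B = geodesic_from_toD[OF \<beta>, folded d_def]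
  have d0: "0 \<le> d" by (simp add: d_def)
  have pB: "projectable {0..d} \<beta>" by (rule projectable_segment[OF cat0 B(1) d0])
  note dis = L_separated_disjoint[OF sepC]
  show ?thesis
  proof (cases "d \<le> 2 * real L + 2")
    case True
    then show ?thesis
      by (intro at_most_subset[OF at_most_separating[OF dis sep]]) (auto simp: d_def)
  next
    case False
    define T where "T = 2 * real L + 2"
    define w where "w = \<beta> T"
    have T: "0 \<le> T" "T \<le> d" using False by (auto simp: T_def)
    have dw: "dist (\<alpha> (coord I \<alpha> z)) w = T" "dist w z = d - T"
      using geodesic_on_dist[OF B(1), of 0 T] geodesic_on_dist[OF B(1), of T d] T B(2,3)
      by (auto simp: w_def)
    have disj: "disjoint {h \<in> C. separates h {\<alpha> (coord I \<alpha> z)} {w}}"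
      by (rule pairwise_subset[OF dis]) auto
    have 1: "at_most {h \<in> C. separates h {\<alpha> (coord I \<alpha> z)} {w}} (T + 1)"
      by (rule at_most_subset[OF at_most_separating[OF disj]]) (auto simp: dw)
    have 2: "at_most {h \<in> C. separates h {w} {z}} 1"
    proof (rule at_most_one, rule ccontr)
      fix h h' assume h: "h \<in> {h \<in> C. separates h {w} {z}}" "h' \<in> {h \<in> C. separates h {w} {z}}" "h \<noteq> h'"
      have "\<exists>x\<in>k. T \<le> coord {0..d} \<beta> x" if "k \<in> {h \<in> C. separates h {w} {z}}" for k
      proof -
        have s: "separates k {w} {z}" using that by simp
        have g: "geodesic_from_to (\<lambda>t. \<beta> (T + t)) w z"
          using geodesic_from_to_tail[OF B(1) T] by (simp add: w_def B(3))
        obtain t where "t \<in> {0..d - T}" "\<beta> (T + t) \<in> k"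
          using separates_meets_segment[OF s g] unfolding dw(2) by blast
        then show ?thesis using coord_on[OF pB, of "T + t"] T by force
      qed
      from this[OF h(1)] this[OF h(2)] obtain x x'
        where x: "x \<in> h" "T \<le> coord {0..d} \<beta> x" "x' \<in> h'" "T \<le> coord {0..d} \<beta> x'" by blast
      have "L_separated L h h'" using h sepC by (auto simp: pairwise_def)
      from bottleneck[OF p \<beta> d_def this] meet h x show False by (auto simp: T_def)
    qed
    show ?thesis
      by (rule at_most_subset[OF at_most_split[OF dis sep 1 2]]) (auto simp: T_def)
  qed
qed

text \<open>
  Only the last piece of the geodesic from \<open>z\<close> to \<open>y\<close>, of length \<open>2 L + 2\<close>, can come near the
  geodesic \<open>\<alpha>\<close>; it is short, and the rest lies in a ball that meets at most one curtain of \<open>C\<close>.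
\<close>

lemma at_most_separating_in_ball:
  assumes sep: "\<And>h. h \<in> C \<Longrightarrow> separates h {z} {y}"
    and zy: "dist z y \<le> dist z (\<alpha> (coord I \<alpha> z))"
  shows "at_most C (2 * real L + 5)"
proof -
  define T where "T = 2 * real L + 2"
  define D where "D = dist z (\<alpha> (coord I \<alpha> z))"
  note dis = L_separated_disjoint[OF sepC]
  show ?thesis
  proof (cases "dist z y \<le> T")
    case True
    then show ?thesis
      by (intro at_most_subset[OF at_most_separating[OF dis sep]]) (auto simp: T_def)
  next
    case False
    obtain g where g: "geodesic_from_to g z y" using geodesic_exists[OF cat0] by blast
    note G = geodesic_from_toD[OF g]
    define s where "s = dist z y - T"
    have s: "0 \<le> s" "s \<le> dist z y" using False by (auto simp: s_def T_def)
    have dw: "dist z (g s) = s" "dist (g s) y = T"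
      using geodesic_on_dist[OF G(1), of 0 s] geodesic_on_dist[OF G(1), of s "dist z y"] s G(2,3)
      by (auto simp: s_def T_def)
    have disj: "disjoint {h \<in> C. separates h {g s} {y}}"
      by (rule pairwise_subset[OF dis]) auto
    have 1: "at_most {h \<in> C. separates h {g s} {y}} (T + 1)"
      by (rule at_most_subset[OF at_most_separating[OF disj]]) (auto simp: dw)
    have gs: "geodesic_from_to g z (g s)"
      unfolding geodesic_from_to_def dw(1) using G(2) s
      by (auto intro: geodesic_on_subset[OF G(1)] simp: is_interval_cc)
    have 2: "at_most {h \<in> C. separates h {z} {g s}} 1"
    proof (rule at_most_subset[OF at_most_one_meets_ball[of s z]])
      show "s + (2 * real L + 2) \<le> dist z (\<alpha> (coord I \<alpha> z))" using zy by (simp add: s_def T_def)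
      show "{h \<in> C. separates h {z} {g s}} \<subseteq> {h \<in> C. h \<inter> cball z s \<noteq> {}}"
      proof
        fix h assume h: "h \<in> {h \<in> C. separates h {z} {g s}}"
        then obtain t where t: "t \<in> {0..s}" "g t \<in> h"
          using separates_meets_segment[OF _ gs] unfolding dw(1) by blast
        have "dist z (g t) = t" using geodesic_on_dist[OF G(1), of 0 t] t s G(2) by auto
        with t h show "h \<in> {h \<in> C. h \<inter> cball z s \<noteq> {}}" by auto
      qed
    qed simp
    show ?thesis
      by (rule at_most_subset[OF at_most_split[OF dis sep 2 1]]) (auto simp: T_def)
  qed
qed

end
end

section \<open>The distances \<open>d\<^sub>L\<close>\<close>

lemma L_chain_empty: "L_chain L {}"
  unfolding L_chain_def curtain_chain_def by (auto intro!: exI[of _ "{}"] simp: bij_betw_def)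

context
  assumes cat0: "is_CAT0 TYPE('a::metric_space)"
begin

lemma L_chain_at_most:
  assumes "L_chain L c" "chain_separates c {x} {y :: 'a}"
  shows "at_most c (dist x y + 1)"
  by (rule at_most_separating[OF cat0])
    (use assms in \<open>auto simp: L_chain_def curtain_chain_def chain_separates_def\<close>)

lemma finite_chain_cards: "finite {card c | c. L_chain L c \<and> chain_separates c {x} {y :: 'a}}"
proof (rule finite_subset)
  show "{card c | c. L_chain L c \<and> chain_separates c {x} {y}} \<subseteq> {..nat \<lfloor>dist x y + 1\<rfloor>}"
  proof
    fix n assume "n \<in> {card c | c. L_chain L c \<and> chain_separates c {x} {y}}"
    then have "real n \<le> dist x y + 1" using L_chain_at_most by (auto simp: at_most_def)
    then show "n \<in> {..nat \<lfloor>dist x y + 1\<rfloor>}" unfolding atMost_iff by (rule le_nat_floor)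
  qed
qed simp

text \<open>
  This includes the diagonal, where \<open>d\<^sub>L\<close> is 0 by convention: only the empty chain separates a point
  from itself.
\<close>

lemma card_le_dL:
  assumes c: "L_chain L c" "chain_separates c {x} {y :: 'a}"
  shows "card c \<le> dL L x y"
proof (cases "x = y")
  case True
  have "c = {}"
  proof (rule ccontr)
    assume "c \<noteq> {}"
    then obtain h where "separates h {x} {x}" using c True unfolding chain_separates_def by blast
    then obtain f :: "'a \<Rightarrow> real" where "f x < - 1/2" "1/2 < f x" using separates_level[OF cat0] by (metis singletonI)
    then show False by simp
  qed
  then show ?thesis by simp
next
  case False
  have "card c \<le> Max {card c | c. L_chain L c \<and> chain_separates c {x} {y}}"
    by (rule Max_ge[OF finite_chain_cards]) (use c in blast)
  with False show ?thesis by (simp add: dL_def)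
qed

lemma dL_attained:
  obtains c where "L_chain L c" "chain_separates c {x} {y :: 'a}" "dL L x y \<le> card c + 1"
proof (cases "x = y")
  case True
  show thesis by (rule that[of "{}"]) (use True in \<open>auto simp: L_chain_empty chain_separates_def dL_def\<close>)
next
  case False
  let ?M = "{card c | c. L_chain L c \<and> chain_separates c {x} {y}}"
  have "card ({} :: 'a set set) \<in> ?M" using L_chain_empty unfolding chain_separates_def by blast
  then have "Max ?M \<in> ?M" by (intro Max_in finite_chain_cards) blast
  then obtain c where "L_chain L c" "chain_separates c {x} {y}" "Max ?M = card c" by auto
  with False show thesis by (intro that[of c]) (auto simp: dL_def)
qed

lemma dL_le_dist: "real (dL L x (y :: 'a)) \<le> dist x y + 2"
proof -
  obtain c where c: "L_chain L c" "chain_separates c {x} {y}" "dL L x y \<le> card c + 1"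
    by (rule dL_attained)
  have "real (dL L x y) \<le> real (card c) + 1" using c(3) by linarith
  then show ?thesis using L_chain_at_most[OF c(1,2)] by (simp add: at_most_def)
qed

lemma dL_mono:
  assumes "L \<le> L'"
  shows "dL L x (y :: 'a) \<le> dL L' x y"
proof (cases "x = y")
  case False
  have mono: "L_separated L h h' \<Longrightarrow> L_separated L' h h'" for h h' :: "'a set"
    using assms unfolding L_separated_def by (elim conjE, intro conjI allI impI) (auto dest: order_trans)
  have "L_chain L' c" if "L_chain L c" for c :: "'a set set"
    using that mono pairwise_mono[of "L_separated L" c "L_separated L'" c] unfolding L_chain_def by blast
  then have "{card c | c. L_chain L c \<and> chain_separates c {x} {y}}
      \<subseteq> {card c | c. L_chain L' c \<and> chain_separates c {x} {y}}" by auto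
  moreover have "{card c | c. L_chain L c \<and> chain_separates c {x} {y}} \<noteq> {}"
    using L_chain_empty unfolding chain_separates_def by blast
  ultimately have "Max {card c | c. L_chain L c \<and> chain_separates c {x} {y}}
      \<le> Max {card c | c. L_chain L' c \<and> chain_separates c {x} {y}}"
    by (intro Max_mono finite_chain_cards)
  then show ?thesis using False by (simp add: dL_def)
qed (simp add: dL_def)

section \<open>Contracting geodesics are crossed by long \<open>L\<close>-chains\<close>

text \<open>
  Pick a point of the ball in the first and in the last curtain of a long finite piece of the
  chain. All curtains between them separate these points, which are at distance at most \<open>2 \<rho>\<close>.
\<close>

lemma chain_meeting_ball:
  fixes c :: "'a set set"
  assumes c: "curtain_chain c" and meet: "\<And>k. k \<in> c \<Longrightarrow> k \<inter> cball m \<rho> \<noteq> {}" and \<rho>: "0 \<le> \<rho>"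
  shows "at_most c (2 * \<rho> + 3)"
proof (rule ccontr)
  assume not: "\<not> at_most c (2 * \<rho> + 3)"
  obtain J :: "int set" and k where J: "\<And>i j. i \<in> J \<Longrightarrow> j \<in> J \<Longrightarrow> {i..j} \<subseteq> J"
    and bij: "bij_betw k J c"
    and sep: "\<And>i. i - 1 \<in> J \<Longrightarrow> i + 1 \<in> J \<Longrightarrow> separates (k i) (k (i - 1)) (k (i + 1))"
    and cur: "\<And>h. h \<in> c \<Longrightarrow> is_curtain h" and dis: "disjoint c"
    using c unfolding curtain_chain_def by metis
  have kJ: "k i \<in> c" if "i \<in> J" for i using bij that by (auto simp: bij_betw_def)
  have inj: "inj_on k J" using bij by (simp add: bij_betw_def)
  have disk: "k i \<inter> k j = {}" if "i \<in> J" "j \<in> J" "i \<noteq> j" for i j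
  proof -
    have "k i \<noteq> k j" using inj that by (auto simp: inj_on_def)
    then show ?thesis using pairwiseD[OF dis kJ[OF that(1)] kJ[OF that(2)]] by (simp add: disjnt_def)
  qed
  have outer: "separates (k j) (k i) (k l)" if "i \<in> J" "l \<in> J" "i < j" "j < l" for i j l
    by (rule chain_separates_outer[OF cat0, of J k]) (use J cur kJ disk sep that in blast)+
  define n where "n = nat \<lfloor>2 * \<rho> + 3\<rfloor> + 1"
  have n: "real n > 2 * \<rho> + 3" "n \<ge> 3" using \<rho> unfolding n_def by linarith+
  have "\<exists>D\<subseteq>J. finite D \<and> card D = n"
  proof (cases "finite J")
    case True
    then have "finite c" "card c = card J"
      using bij bij_betw_finite bij_betw_same_card by metis+
    with not have "real (card J) > 2 * \<rho> + 3" by (simp add: at_most_def)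
    then have "n \<le> card J" unfolding n_def using \<rho> by linarith
    then show ?thesis using True by (metis obtain_subset_with_card_n)
  next
    case False
    then show ?thesis using infinite_arbitrarily_large by metis
  qed
  then obtain D where D: "D \<subseteq> J" "finite D" "card D = n" by blast
  have ne: "D \<noteq> {}" using D n by auto
  define i where "i = Min D"
  define l where "l = Max D"
  have il: "i \<in> J" "l \<in> J"
    using Min_in[OF D(2) ne] Max_in[OF D(2) ne] D(1) unfolding i_def l_def by blast+
  have "D \<subseteq> {i..l}" using D by (auto simp: i_def l_def)
  then have "n \<le> card {i..l}" using D card_mono by blast
  then have gap: "l - i + 1 \<ge> int n" using n by simp
  have sub: "{i<..<l} \<subseteq> J" using J[OF il] by auto
  obtain q q' where q: "q \<in> k i" "dist m q \<le> \<rho>" "q' \<in> k l" "dist m q' \<le> \<rho>"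
    using meet[OF kJ[OF il(1)]] meet[OF kJ[OF il(2)]] by auto
  have "at_most (k ` {i<..<l}) (dist q q' + 1)"
  proof (rule at_most_separating[OF cat0])
    show "disjoint (k ` {i<..<l})"
      by (rule pairwise_subset[OF dis]) (use kJ sub in auto)
    fix h assume "h \<in> k ` {i<..<l}"
    then obtain j where j: "j \<in> {i<..<l}" "h = k j" by blast
    then have "separates (k j) (k i) (k l)" by (intro outer[OF il]) auto
    then show "separates h {q} {q'}" using q j(2) separates_mono[OF cat0] by blast
  qed
  moreover have "card (k ` {i<..<l}) = card {i<..<l}"
    by (rule card_image) (use inj sub inj_on_subset in blast)
  moreover have "dist q q' \<le> 2 * \<rho>" using dist_triangle3[of q q' m] q by simp
  ultimately have "real (card {i<..<l}) \<le> 2 * \<rho> + 1" by (simp add: at_most_def)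
  moreover have "real (card {i<..<l}) = of_int (l - i - 1)" using gap n by simp
  moreover have "of_int (l - i - 1) \<ge> real n - 2" using gap by linarith
  ultimately show False using n by linarith
qed

text \<open>
  Curtains are far from convex, but two points of a curtain are joined inside it by two geodesics
  and a piece of the pole, whose length is at most one.
\<close>

lemma curtain_star_shaped:
  assumes "is_curtain (k :: 'a set)" "u \<in> k" "v \<in> k"
  obtains p q where "dist p q \<le> 1"
    "\<And>\<sigma> t. geodesic_from_to \<sigma> u p \<Longrightarrow> t \<in> {0..dist u p} \<Longrightarrow> \<sigma> t \<in> k"
    "\<And>\<sigma> t. geodesic_from_to \<sigma> v q \<Longrightarrow> t \<in> {0..dist v q} \<Longrightarrow> \<sigma> t \<in> k"
proof -
  obtain I \<alpha> r where cd: "curtain_dual I \<alpha> r" and k: "k = curtain I \<alpha> r"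
    using assms(1) unfolding is_curtain_def by blast
  have p: "projectable I \<alpha>" using cd by (simp add: curtain_dual_iff)
  note mem = mem_curtain_iff[OF cd, folded k]
  show thesis
  proof (rule that)
    show "dist (\<alpha> (coord I \<alpha> u)) (\<alpha> (coord I \<alpha> v)) \<le> 1"
      using geodesic_on_dist[OF projectableD[OF p] coord_mem[OF p] coord_mem[OF p], of u v]
        assms(2,3) unfolding mem by linarith
    show "\<sigma> t \<in> k" if "geodesic_from_to \<sigma> u (\<alpha> (coord I \<alpha> u))" "t \<in> {0..dist u (\<alpha> (coord I \<alpha> u))}" for \<sigma> t
      using coord_on_fibre[OF p that] assms(2) by (simp add: mem)
    show "\<sigma> t \<in> k" if "geodesic_from_to \<sigma> v (\<alpha> (coord I \<alpha> v))" "t \<in> {0..dist v (\<alpha> (coord I \<alpha> v))}" for \<sigma> t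
      using coord_on_fibre[OF p that] assms(3) by (simp add: mem)
  qed
qed

context
  fixes a b R :: real and \<gamma> :: "real \<Rightarrow> 'a"
  assumes \<gamma>: "geodesic_on {a..b} \<gamma>" and ab: "a \<le> b"
    and R: "0 \<le> R" and con: "contracting R (\<gamma> ` {a..b})"
begin

private lemma \<gamma>_projectable: "projectable {a..b} \<gamma>"
  by (rule projectable_segment[OF cat0 \<gamma> ab])

text \<open>
  The definition of contraction concerns open balls; the boundary sphere is reached by
  approximation along a geodesic.
\<close>

lemma contracting_coord:
  assumes xy: "dist x y \<le> dist x (\<gamma> (coord {a..b} \<gamma> x))"
  shows "\<bar>coord {a..b} \<gamma> x - coord {a..b} \<gamma> y\<bar> \<le> R"
proof -
  define \<rho> where "\<rho> = dist x (\<gamma> (coord {a..b} \<gamma> x))"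
  have less: "\<bar>coord {a..b} \<gamma> x - coord {a..b} \<gamma> y'\<bar> \<le> R" if y': "dist x y' < \<rho>" for y'
  proof -
    let ?P = "nearest_point (\<gamma> ` {a..b}) ` ball x \<rho>"
    have "ball x \<rho> \<inter> \<gamma> ` {a..b} = {}"
      using coord_nearest[OF \<gamma>_projectable, of _ x] by (fastforce simp: \<rho>_def)
    then have "bounded ?P" "diameter ?P \<le> R" using con unfolding contracting_def by blast+
    moreover have "\<gamma> (coord {a..b} \<gamma> x) \<in> ?P" "\<gamma> (coord {a..b} \<gamma> y') \<in> ?P"
    proof -
      have "0 < \<rho>" using y' zero_le_dist[of x y'] by linarith
      then show "\<gamma> (coord {a..b} \<gamma> x) \<in> ?P"
        by (intro image_eqI[where x = x]) (simp_all add: nearest_point_coord[OF \<gamma>_projectable])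
      show "\<gamma> (coord {a..b} \<gamma> y') \<in> ?P" using y'
        by (intro image_eqI[where x = y']) (simp_all add: nearest_point_coord[OF \<gamma>_projectable])
    qed
    ultimately have "dist (\<gamma> (coord {a..b} \<gamma> x)) (\<gamma> (coord {a..b} \<gamma> y')) \<le> R"
      using diameter_bounded_bound by (meson order_trans)
    then show ?thesis using geodesic_on_dist[OF \<gamma> coord_mem[OF \<gamma>_projectable] coord_mem[OF \<gamma>_projectable]] by simp
  qed
  show ?thesis
  proof (cases "x = y")
    case True
    then show ?thesis using R by simp
  next
    case False
    obtain \<sigma> where "geodesic_from_to \<sigma> x y" using geodesic_exists[OF cat0] by blast
    note \<sigma> = geodesic_from_toD[OF this]
    have pos: "0 < dist x y" using False by simp
    show ?thesis
    proof (rule field_le_epsilon)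
      fix e :: real assume "0 < e"
      define \<delta> where "\<delta> = min e (dist x y)"
      have \<delta>: "0 < \<delta>" "\<delta> \<le> e" "\<delta> \<le> dist x y" using \<open>0 < e\<close> pos by (auto simp: \<delta>_def)
      let ?y' = "\<sigma> (dist x y - \<delta>)"
      have "dist x ?y' = dist x y - \<delta>" "dist ?y' y = \<delta>"
        using geodesic_on_dist[OF \<sigma>(1), of 0 "dist x y - \<delta>"]
          geodesic_on_dist[OF \<sigma>(1), of "dist x y - \<delta>" "dist x y"] \<delta> \<sigma>(2,3) by auto
      then show "\<bar>coord {a..b} \<gamma> x - coord {a..b} \<gamma> y\<bar> \<le> R + e"
        using less[of ?y'] coord_lipschitz[OF cat0 \<gamma>_projectable, of ?y' y] xy \<delta> by (simp add: \<rho>_def)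
    qed
  qed
qed

text \<open>
  A geodesic whose endpoints have distant projections comes close to \<open>\<gamma>\<close> near the projection of its
  starting point. Stop at a point \<open>v'\<close> whose projection is at distance \<open>3 R + 1\<close>; the balls
  around \<open>u\<close> and \<open>v'\<close> that just reach \<open>\<gamma>\<close> have small projections, so they cannot overlap, and the
  gap between them along the geodesic is too short to avoid \<open>\<gamma>\<close>.
\<close>

lemma contracting_geodesic_close:
  assumes far: "3 * R + 1 \<le> \<bar>coord {a..b} \<gamma> u - coord {a..b} \<gamma> v\<bar>" and "geodesic_from_to \<sigma> u v"
  shows "\<exists>t\<in>{0..dist u v}. dist (\<sigma> t) (\<gamma> (coord {a..b} \<gamma> u)) \<le> 4 * R + 2"
proof -
  let ?c = "coord {a..b} \<gamma>"
  note \<sigma> = geodesic_from_toD[OF assms(2)]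
  have "\<exists>\<tau>\<ge>0. \<tau> \<le> dist u v \<and> \<bar>?c (\<sigma> \<tau>) - ?c u\<bar> = 3 * R + 1"
  proof (rule IVT')
    show "continuous_on {0..dist u v} (\<lambda>t. \<bar>?c (\<sigma> t) - ?c u\<bar>)"
      by (intro continuous_intros
          continuous_on_compose2[OF coord_continuous[OF cat0 \<gamma>_projectable, of UNIV] geodesic_on_continuous[OF \<sigma>(1)]]) auto
  qed (use \<sigma>(2,3) far R in \<open>auto simp: abs_minus_commute\<close>)
  then obtain \<tau> where \<tau>: "0 \<le> \<tau>" "\<tau> \<le> dist u v" "\<bar>?c (\<sigma> \<tau>) - ?c u\<bar> = 3 * R + 1" by blast
  define v' where "v' = \<sigma> \<tau>"
  define du where "du = dist u (\<gamma> (?c u))"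
  define dv where "dv = dist v' (\<gamma> (?c v'))"
  have nn: "0 \<le> du" "0 \<le> dv" by (auto simp: du_def dv_def)
  have ds: "dist (\<sigma> s) (\<sigma> t) = \<bar>s - t\<bar>" if "0 \<le> s" "s \<le> \<tau>" "0 \<le> t" "t \<le> \<tau>" for s t
    using geodesic_on_dist[OF \<sigma>(1), of s t] that \<tau> by auto
  have du': "dist u (\<sigma> s) = s" "dist v' (\<sigma> s) = \<tau> - s" if "0 \<le> s" "s \<le> \<tau>" for s
    using ds[of 0 s] ds[of \<tau> s] that \<tau> \<sigma>(2) by (auto simp: v'_def)
  have near_u: "\<bar>?c u - ?c (\<sigma> s)\<bar> \<le> R" if "0 \<le> s" "s \<le> \<tau>" "s \<le> du" for s
    using contracting_coord[of u "\<sigma> s"] du'(1)[OF that(1,2)] that(3) by (simp add: du_def)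
  have near_v: "\<bar>?c v' - ?c (\<sigma> s)\<bar> \<le> R" if "0 \<le> s" "s \<le> \<tau>" "\<tau> - s \<le> dv" for s
    using contracting_coord[of v' "\<sigma> s"] du'(2)[OF that(1,2)] that(3) by (simp add: dv_def)
  have le: "du + dv \<le> \<tau>"
  proof (rule ccontr)
    assume "\<not> du + dv \<le> \<tau>"
    then have m: "0 \<le> min du \<tau>" "min du \<tau> \<le> \<tau>" "min du \<tau> \<le> du" "\<tau> - min du \<tau> \<le> dv"
      using nn \<tau>(1) by linarith+
    from near_u[OF m(1-3)] near_v[OF m(1,2,4)] \<tau>(3) R show False
      unfolding v'_def by linarith
  qed
  have w: "\<bar>?c u - ?c (\<sigma> du)\<bar> \<le> R" "\<bar>?c v' - ?c (\<sigma> (\<tau> - dv))\<bar> \<le> R"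
    using near_u[of du] near_v[of "\<tau> - dv"] nn le by auto
  have "\<tau> = dist u v'" using du'(1)[of \<tau>] \<tau> by (simp add: v'_def)
  also have "\<dots> \<le> du + dist (\<gamma> (?c u)) (\<gamma> (?c v')) + dv"
    unfolding du_def dv_def by metric
  also have "dist (\<gamma> (?c u)) (\<gamma> (?c v')) = 3 * R + 1"
    using geodesic_on_dist[OF \<gamma> coord_mem[OF \<gamma>_projectable] coord_mem[OF \<gamma>_projectable], of u v'] \<tau>(3)
    by (simp add: v'_def abs_minus_commute)
  finally have short: "\<tau> - dv - du \<le> 3 * R + 1" by simp
  have ww: "dist (\<sigma> du) (\<sigma> (\<tau> - dv)) = \<tau> - dv - du" using ds[of du "\<tau> - dv"] nn le by auto
  have "dist (\<sigma> du) (\<gamma> (?c (\<sigma> du))) \<le> 3 * R + 1"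
  proof (rule ccontr)
    assume "\<not> ?thesis"
    with short ww have "\<bar>?c (\<sigma> du) - ?c (\<sigma> (\<tau> - dv))\<bar> \<le> R"
      by (intro contracting_coord) linarith
    with w \<tau>(3) show False unfolding v'_def by linarith
  qed
  moreover have "dist (\<gamma> (?c (\<sigma> du))) (\<gamma> (?c u)) \<le> R"
    using geodesic_on_dist[OF \<gamma> coord_mem[OF \<gamma>_projectable] coord_mem[OF \<gamma>_projectable], of "\<sigma> du" u] w(1)
    by (simp add: abs_minus_commute)
  moreover have "dist (\<sigma> du) (\<gamma> (?c u)) \<le> dist (\<sigma> du) (\<gamma> (?c (\<sigma> du))) + dist (\<gamma> (?c (\<sigma> du))) (\<gamma> (?c u))"
    by (rule dist_triangle)
  ultimately have "dist (\<sigma> du) (\<gamma> (?c u)) \<le> 4 * R + 2" by linarith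
  then show ?thesis using nn le \<tau> by (intro bexI[of _ du]) auto
qed

text \<open>
  A curtain that crosses two distant curtains dual to \<open>\<gamma>\<close> passes near \<open>\<gamma>\<close> at a prescribed place: one
  of the two geodesics that lead to its pole has endpoints with distant projections. A chain of such
  curtains meets a fixed ball, hence is short.
\<close>

lemma contracting_curtains_L_separated:
  assumes r: "curtain_dual {a..b} \<gamma> r" and r': "curtain_dual {a..b} \<gamma> r'"
    and far: "r + (6 * R + 6) \<le> r'" and L: "20 * R + 17 \<le> real L"
  shows "L_separated L (curtain {a..b} \<gamma> r) (curtain {a..b} \<gamma> r')"
  unfolding L_separated_def
proof (intro conjI allI impI)
  let ?c = "coord {a..b} \<gamma>"
  show "is_curtain (curtain {a..b} \<gamma> r)" "is_curtain (curtain {a..b} \<gamma> r')"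
    using r r' unfolding is_curtain_def by blast+
  show "curtain {a..b} \<gamma> r \<inter> curtain {a..b} \<gamma> r' = {}"
    using far R by (auto simp: mem_curtain_iff[OF r] mem_curtain_iff[OF r'])
  fix c assume c: "curtain_chain c \<and> (\<forall>k\<in>c. k \<inter> curtain {a..b} \<gamma> r \<noteq> {} \<and> k \<inter> curtain {a..b} \<gamma> r' \<noteq> {})"
  define s where "s = r + 1/2"
  define s' where "s' = s + (6 * R + 5)"
  have meet: "k \<inter> cball (\<gamma> s) (10 * R + 7) \<noteq> {}" if k: "k \<in> c" for k
  proof -
    have cur: "is_curtain k" using c k by (auto simp: curtain_chain_def)
    obtain u0 v0 where uv0: "u0 \<in> k" "?c u0 \<le> s" "v0 \<in> k" "s' \<le> ?c v0"
    proof -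
      obtain u0 v0 where *: "u0 \<in> k" "u0 \<in> curtain {a..b} \<gamma> r" "v0 \<in> k" "v0 \<in> curtain {a..b} \<gamma> r'"
        using c k by blast
      show thesis
        by (rule that[of u0 v0])
          (use * far in \<open>auto simp: mem_curtain_iff[OF r] mem_curtain_iff[OF r'] s_def s'_def\<close>)
    qed
    have ss': "s \<le> s'" using R by (simp add: s'_def)
    note hits = lipschitz_connected_hits[OF coord_lipschitz[OF cat0 \<gamma>_projectable] curtain_connected[OF cat0 cur] uv0(1,3)]
    obtain u where u: "u \<in> k" "?c u = s" using hits[of s] uv0 ss' by auto
    obtain v where v: "v \<in> k" "?c v = s'" using hits[of s'] uv0 ss' by auto
    have sin: "s \<in> {a..b}" "s' \<in> {a..b}" using coord_mem[OF \<gamma>_projectable, of u] coord_mem[OF \<gamma>_projectable, of v] u v by simp_all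
    obtain pu pv where pole: "dist pu pv \<le> 1"
      "\<And>\<sigma> t. geodesic_from_to \<sigma> u pu \<Longrightarrow> t \<in> {0..dist u pu} \<Longrightarrow> \<sigma> t \<in> k"
      "\<And>\<sigma> t. geodesic_from_to \<sigma> v pv \<Longrightarrow> t \<in> {0..dist v pv} \<Longrightarrow> \<sigma> t \<in> k"
      using curtain_star_shaped[OF cur u(1) v(1)] by blast
    \<comment> \<open>The projection of the pole is too short to come within \<open>3 R + 1\<close> of both \<open>s\<close> and \<open>s'\<close>.\<close>
    have "\<bar>?c pu - ?c pv\<bar> \<le> 1" using coord_lipschitz[OF cat0 \<gamma>_projectable, of pu pv] pole(1) by linarith
    then consider "3 * R + 1 \<le> \<bar>?c u - ?c pu\<bar>" | "3 * R + 1 \<le> \<bar>?c v - ?c pv\<bar>"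
      unfolding u(2) v(2) s'_def using R by linarith
    then show ?thesis
    proof cases
      case 1
      obtain \<sigma> where \<sigma>: "geodesic_from_to \<sigma> u pu" using geodesic_exists[OF cat0] by blast
      from contracting_geodesic_close[OF 1 \<sigma>] obtain t where
        "t \<in> {0..dist u pu}" "dist (\<sigma> t) (\<gamma> s) \<le> 4 * R + 2" unfolding u(2) by blast
      moreover from this have "\<sigma> t \<in> k" using pole(2)[OF \<sigma>] by blast
      ultimately show ?thesis using R by (auto simp: dist_commute intro!: exI[of _ "\<sigma> t"])
    next
      case 2
      obtain \<sigma> where \<sigma>: "geodesic_from_to \<sigma> v pv" using geodesic_exists[OF cat0] by blast
      from contracting_geodesic_close[OF 2 \<sigma>] obtain t where
        t: "t \<in> {0..dist v pv}" "dist (\<sigma> t) (\<gamma> s') \<le> 4 * R + 2" unfolding v(2) by blast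
      have "dist (\<gamma> s) (\<gamma> s') = 6 * R + 5" using geodesic_on_dist[OF \<gamma> sin] R by (simp add: s'_def)
      then have "dist (\<gamma> s) (\<sigma> t) \<le> 10 * R + 7" using dist_triangle2[of "\<gamma> s" "\<sigma> t" "\<gamma> s'"] t(2) by simp
      moreover have "\<sigma> t \<in> k" using pole(3)[OF \<sigma> t(1)] .
      ultimately show ?thesis by auto
    qed
  qed
  have "at_most c (2 * (10 * R + 7) + 3)"
    by (rule chain_meeting_ball[OF _ meet]) (use c R in auto)
  then have "finite c" "real (card c) \<le> real L" using L by (auto simp: at_most_def)
  then show "finite c" "card c \<le> L" by simp_all
qed

text \<open>
  The points \<open>x\<close> and \<open>y\<close> need not be the endpoints of \<open>\<gamma>\<close>, which allows the base point of an
  orbit to be changed.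
\<close>

lemma contracting_dL_lower_bound:
  assumes x: "dist x (\<gamma> a) \<le> A" and y: "dist y (\<gamma> b) \<le> A" and L: "20 * R + 17 \<le> real L"
  shows "(b - a - 2 * A - 2) / (6 * R + 6) \<le> real (dL L x y)"
proof -
  let ?N = "6 * R + 6"
  have N: "?N > 1" using R by simp
  have A: "0 \<le> A" using x zero_le_dist order_trans by blast
  \<comment> \<open>The curtains keep clear of the projections of \<open>x\<close> and \<open>y\<close>, which are within \<open>A\<close> of \<open>a\<close> and \<open>b\<close>.\<close>
  define X where "X = b - a - 2 * A - 2"
  define n where "n = nat \<lceil>X / ?N\<rceil>"
  define r where "r i = (a + A + 1) + ?N * real i" for i
  have rb: "a + A + 1/2 < r i" "r i + 1/2 < b - A" if i: "i < n" for i
  proof -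
    have "0 \<le> ?N * real i" using N by simp
    then show "a + A + 1/2 < r i" by (simp add: r_def)
    have "int i < \<lceil>X / ?N\<rceil>" using i unfolding n_def by simp
    then have "real i < X / ?N" by (simp add: less_ceiling_iff)
    then have "?N * real i < X" using N by (simp add: field_simps)
    then show "r i + 1/2 < b - A" by (simp add: r_def X_def)
  qed
  have int: "{r i - 1/2..r i + 1/2} \<subseteq> interior {a..b}" if "i < n" for i
    using rb[OF that] A by (auto simp: interior_atLeastAtMost_real)
  have cd: "curtain_dual {a..b} \<gamma> (r i)" if "i < n" for i
    using int[OF that] \<gamma>_projectable by (simp add: curtain_dual_iff)
  let ?C = "(\<lambda>i. curtain {a..b} \<gamma> (r i)) ` {..<n}"
  have chain: "curtain_chain ?C" and card: "card ?C = n"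
    using dual_chain[OF cat0 \<gamma>_projectable N, of n "a + A + 1"] int unfolding r_def by blast+
  have "L_separated L (curtain {a..b} \<gamma> (r i)) (curtain {a..b} \<gamma> (r j))" if "i < n" "j < n" "i \<noteq> j" for i j
  proof -
    have gap: "r i + ?N \<le> r j" if "i < j" for i j :: nat
    proof -
      have "?N * (real i + 1) \<le> ?N * real j" using that N by (intro mult_left_mono) auto
      then show ?thesis by (simp add: r_def algebra_simps)
    qed
    have comm: "L_separated L h h' \<Longrightarrow> L_separated L h' h" for h h' :: "'a set"
      unfolding L_separated_def by blast
    show ?thesis
    proof (cases "i < j")
      case True
      then show ?thesis using contracting_curtains_L_separated[OF cd cd gap L] that by blast
    next
      case False
      then have "j < i" using that by simp
      then show ?thesis using contracting_curtains_L_separated[OF cd cd gap L] that comm by blast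
    qed
  qed
  then have LC: "L_chain L ?C" using chain unfolding L_chain_def pairwise_def by auto
  have "separates h {x} {y}" if h: "h \<in> ?C" for h
  proof -
    obtain i where i: "i < n" "h = curtain {a..b} \<gamma> (r i)" using h by auto
    have "coord {a..b} \<gamma> (\<gamma> a) = a" "coord {a..b} \<gamma> (\<gamma> b) = b" using coord_on[OF \<gamma>_projectable] ab by auto
    then have "coord {a..b} \<gamma> x \<le> a + A" "b - A \<le> coord {a..b} \<gamma> y"
      using coord_lipschitz[OF cat0 \<gamma>_projectable, of x "\<gamma> a"] coord_lipschitz[OF cat0 \<gamma>_projectable, of y "\<gamma> b"] x y by auto
    then show ?thesis unfolding i(2)
      using rb[OF i(1)] by (intro level_separates[OF curtain_level(1)[OF cat0 cd[OF i(1)]]]) auto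
  qed
  then have "n \<le> dL L x y" using card_le_dL[OF LC] card by (simp add: chain_separates_def)
  moreover have "X / ?N \<le> real n" unfolding n_def by linarith
  ultimately show ?thesis unfolding X_def by linarith
qed

end
end

section \<open>Quasigeodesics that are detected by \<open>L\<close>-chains\<close>

lemma at_most_UN:
  assumes "\<And>m. m < k \<Longrightarrow> at_most (F m) 1"
  shows "at_most (\<Union>m<k. F m) (real k)"
  using assms
proof (induction k)
  case 0
  show ?case by (simp add: at_most_def)
next
  case (Suc k)
  have "at_most (\<Union>m<k. F m) (real k)" by (rule Suc.IH) (use Suc.prems in simp)
  from at_most_Un[OF this Suc.prems[of k], of "\<Union>m<Suc k. F m"]
  show ?case by (simp add: lessThan_Suc Un_commute add.commute)
qed

lemma dL_commute: "dL L x y = dL L y x"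
  unfolding dL_def chain_separates_def by (simp add: separates_commute[of _ "{x}" "{y}"] eq_commute[of x y])

context
  assumes cat0: "is_CAT0 TYPE('a::metric_space)"
begin

text \<open>
  Moving the endpoints by at most \<open>A\<close> destroys boundedly many curtains of a separating \<open>L\<close>-chain:
  those that separate an endpoint from its new position, and those that contain the latter. What
  remains is kept as a family of pairwise \<open>L\<close>-separated curtains, without its order.
\<close>

lemma separating_family_near:
  fixes u v u' v' :: 'a
  assumes u: "dist u u' \<le> A" and v: "dist v v' \<le> A"
  obtains C where "pairwise (L_separated L) C" "finite C" "real (dL L u v) \<le> real (card C) + 2 * A + 5"
    "\<And>h. h \<in> C \<Longrightarrow> separates h {u} {v}" "\<And>h. h \<in> C \<Longrightarrow> separates h {u'} {v'}"
proof -
  obtain c where c: "L_chain L c" "chain_separates c {u} {v}" "dL L u v \<le> card c + 1"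
    by (rule dL_attained[OF cat0])
  have pw: "pairwise (L_separated L) c" using c(1) by (simp add: L_chain_def)
  note dis = L_separated_disjoint[OF pw]
  have sep: "separates h {u} {v}" if "h \<in> c" for h using c(2) that by (simp add: chain_separates_def)
  define C where "C = {h \<in> c. separates h {u'} {v'}}"
  have fin: "finite c" using L_chain_at_most[OF cat0 c(1,2)] by (simp add: at_most_def)
  have "at_most C (real (card C))" using fin by (simp add: C_def at_most_def)
  moreover have "at_most {h \<in> c. separates h {u} {u'}} (A + 1)"
    by (rule at_most_subset[OF at_most_separating[OF cat0, of "{h \<in> c. separates h {u} {u'}}" u u']])
      (use u in \<open>auto intro: pairwise_subset[OF dis]\<close>)
  moreover have "at_most {h \<in> c. separates h {v'} {v}} (A + 1)"
    by (rule at_most_subset[OF at_most_separating[OF cat0, of "{h \<in> c. separates h {v'} {v}}" v' v]])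
      (use v in \<open>auto intro: pairwise_subset[OF dis] simp: dist_commute\<close>)
  moreover have "c \<subseteq> ((C \<union> {h \<in> c. separates h {u} {u'}}) \<union> {h \<in> c. separates h {v'} {v}})
      \<union> ({h \<in> c. u' \<in> h} \<union> {h \<in> c. v' \<in> h})"
  proof
    fix h assume h: "h \<in> c"
    from separates_trichotomy[OF cat0 sep[OF h], of u'] separates_trichotomy[OF cat0, of h u' v v'] h
    show "h \<in> ((C \<union> {h \<in> c. separates h {u} {u'}}) \<union> {h \<in> c. separates h {v'} {v}})
      \<union> ({h \<in> c. u' \<in> h} \<union> {h \<in> c. v' \<in> h})" unfolding C_def by blast
  qed
  ultimately have "at_most c (((real (card C) + (A + 1)) + (A + 1)) + (1 + 1))"
    using at_most_containing[OF dis] by (meson at_most_Un subset_refl)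
  then have "real (card c) \<le> real (card C) + 2 * A + 4" by (simp add: at_most_def)
  then have "real (dL L u v) \<le> real (card C) + 2 * A + 5" using c(3) by linarith
  then show thesis
    using fin sep pairwise_subset[OF pw, of C] by (intro that[of C]) (auto simp: C_def)
qed

text \<open>
  Either a vertex lies on the curtain, or two consecutive vertices lie on different sides and the
  short geodesic between them meets it.
\<close>

lemma separates_meets_discrete_path:
  fixes q :: "nat \<Rightarrow> 'a"
  assumes step: "\<And>m. m < k \<Longrightarrow> dist (q m) (q (Suc m)) \<le> r" and "separates h {q 0} {q k}"
  shows "\<exists>m<k. h \<inter> cball (q m) r \<noteq> {}"
  using assms
proof (induction k)
  case 0
  then obtain f :: "'a \<Rightarrow> real" where "f (q 0) < - 1/2" "1/2 < f (q 0)"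
    using separates_level[OF cat0] by (metis singletonI)
  then show ?case by simp
next
  case (Suc k)
  have r: "dist (q k) (q (Suc k)) \<le> r" using Suc.prems(1) by simp
  show ?case
  proof (cases "q k \<in> h")
    case True
    have "0 \<le> r" using r zero_le_dist order_trans by blast
    with True show ?thesis by (intro exI[of _ k]) auto
  next
    case False
    with separates_trichotomy[OF cat0 Suc.prems(2)]
    consider "separates h {q 0} {q k}" | "separates h {q k} {q (Suc k)}" by blast
    then show ?thesis
    proof cases
      case 1
      with Suc.IH Suc.prems(1) show ?thesis using less_Suc_eq by auto
    next
      case 2
      obtain g where g: "geodesic_from_to g (q k) (q (Suc k))" using geodesic_exists[OF cat0] by blast
      note G = geodesic_from_toD[OF g]
      obtain t where t: "t \<in> {0..dist (q k) (q (Suc k))}" "g t \<in> h"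
        using separates_meets_segment[OF cat0 2 g] by blast
      have "dist (q k) (g t) \<le> r" using geodesic_on_dist[OF G(1), of 0 t] t r G(2) by auto
      with t show ?thesis by (intro exI[of _ k]) auto
    qed
  qed
qed

context
  fixes M K C :: real and L :: nat
  assumes M: "1 \<le> M" and K: "0 < K" and C: "0 \<le> C"
begin

text \<open>
  A block of the path that advances by \<open>block_length\<close> steps increases \<open>d\<^sub>L\<close> by about two, while
  beyond \<open>far_distance\<close> from the geodesic it lies in a ball that meets at most one of the relevant
  curtains. So beyond that distance \<open>d\<^sub>L\<close> has to grow twice as fast as curtains are crossed, and the
  additive constants are used up after \<open>excursion_length\<close> steps. In \<open>contraction_bound\<close>, the number
  \<open>6 L + 22\<close> counts three legs with \<open>2 L + 5\<close> curtains, their two corners, and the constant 5 of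
  \<open>separating_family_near\<close>.
\<close>

definition "block_length = nat \<lceil>2 * K\<rceil>"
definition "far_distance = M * real block_length + (2 * real L + 2) + M"
definition "excursion_length = 2 * K * (C + 2 * far_distance + 6)"
definition "path_distance = far_distance + M * excursion_length + M"
definition "contraction_bound = M * K * (6 * real L + 22 + 2 * path_distance + C) + 2 * path_distance"

lemma block_length_bounds: "2 * K \<le> real block_length" "0 < block_length"
  using K unfolding block_length_def by linarith+

lemma path_constants_nonneg: "0 \<le> far_distance" "0 \<le> path_distance" "0 \<le> contraction_bound"
proof -
  show 1: "0 \<le> far_distance" using M by (simp add: far_distance_def)
  then have "0 \<le> excursion_length" using K C by (simp add: excursion_length_def)
  then show 2: "0 \<le> path_distance" using 1 M by (simp add: path_distance_def)
  then show "0 \<le> contraction_bound" using K C M by (simp add: contraction_bound_def)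
qed

context
  fixes a b :: real and \<gamma> :: "real \<Rightarrow> 'a" and q :: "nat \<Rightarrow> 'a" and n :: nat
  assumes \<gamma>: "geodesic_on {a..b} \<gamma>" and ab: "a \<le> b"
    and ends: "q 0 = \<gamma> a" "q n = \<gamma> b"
    and step: "\<And>i. i < n \<Longrightarrow> dist (q i) (q (Suc i)) \<le> M"
    and progress: "\<And>i j. i \<le> j \<Longrightarrow> j \<le> n \<Longrightarrow> real (j - i) / K - C \<le> real (dL L (q i) (q j))"
begin

private abbreviation "cd \<equiv> coord {a..b} \<gamma>"
private abbreviation "foot x \<equiv> \<gamma> (cd x)"

private lemma projectable_\<gamma>: "projectable {a..b} \<gamma>"
  by (rule projectable_segment[OF cat0 \<gamma> ab])

lemma path_lipschitz: "i \<le> j \<Longrightarrow> j \<le> n \<Longrightarrow> dist (q i) (q j) \<le> M * real (j - i)"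
proof (induction j rule: dec_induct)
  case base
  show ?case by simp
next
  case (step j)
  have "dist (q i) (q (Suc j)) \<le> dist (q i) (q j) + dist (q j) (q (Suc j))" by (rule dist_triangle)
  also have "\<dots> \<le> M * real (j - i) + M"
    using step \<open>\<And>i. i < n \<Longrightarrow> dist (q i) (q (Suc i)) \<le> M\<close>[of j] by (intro add_mono) auto
  also have "\<dots> = M * real (Suc j - i)" using step by (simp add: Suc_diff_le algebra_simps)
  finally show ?case .
qed

private lemma foot_dist_step: "dist x (foot x) \<le> dist x y + dist y (foot y)"
  using coord_nearest[OF projectable_\<gamma> coord_mem[OF projectable_\<gamma>], of x y] dist_triangle[of x "foot y" y] by linarith

private lemma separates_feet_meets:
  assumes "separates h {foot x} {foot y}"
  shows "h \<inter> \<gamma> ` {a..b} \<noteq> {}"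
proof
  assume "h \<inter> \<gamma> ` {a..b} = {}"
  then have "same_side h {foot x} {foot y}" unfolding same_side_def
    using geodesic_image_connected[OF \<gamma>] coord_mem[OF projectable_\<gamma>]
    by (intro exI[of _ "\<gamma> ` {a..b}"]) (auto simp: image_eqI)
  then show False using separates_not_same_side[OF cat0 assms] by blast
qed

text \<open>
  The argument of the Morse lemma. While the path is far from the geodesic, every curtain that
  separates both the ends of the excursion and their feet has to be crossed by the path, but each
  block of the path crosses at most one of them. So the excursion is short.
\<close>

lemma path_close_to_geodesic:
  assumes k: "k \<le> n"
  shows "dist (q k) (foot (q k)) \<le> far_distance + M * excursion_length"
proof (cases "dist (q k) (foot (q k)) \<le> far_distance")
  case True
  have "0 \<le> M * excursion_length"
    using M K C path_constants_nonneg(1) by (simp add: excursion_length_def)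
  with True show ?thesis by simp
next
  case False
  define D where "D i = dist (q i) (foot (q i))" for i
  define A where "A = far_distance"
  have Dk: "A < D k" using False by (simp add: D_def A_def)
  have A0: "0 \<le> A" using path_constants_nonneg by (simp add: A_def)
  have "cd (q 0) = a" "cd (q n) = b" using coord_on[OF projectable_\<gamma>] ab ends by auto
  then have D0n: "D 0 \<le> A" "D n \<le> A" using ends A0 by (auto simp: D_def)
  have Dstep: "D i \<le> D (Suc i) + M" "D (Suc i) \<le> D i + M" if "i < n" for i
    using foot_dist_step[of "q i" "q (Suc i)"] foot_dist_step[of "q (Suc i)" "q i"] step[OF that]
    by (auto simp: D_def dist_commute)
  define i where "i = (GREATEST i. i \<le> k \<and> D i \<le> A)"
  have i: "i \<le> k \<and> D i \<le> A" unfolding i_def by (rule GreatestI_nat[of _ 0 k]) (use D0n in auto)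
  have imax: "i' \<le> i" if "i' \<le> k" "D i' \<le> A" for i'
    unfolding i_def by (rule Greatest_le_nat[of _ _ k]) (use that in auto)
  define j where "j = (LEAST j. k \<le> j \<and> D j \<le> A)"
  have j: "k \<le> j \<and> D j \<le> A" unfolding j_def by (rule LeastI[of _ n]) (use D0n k in auto)
  have jmin: "j \<le> j'" if "k \<le> j'" "D j' \<le> A" for j'
    unfolding j_def by (rule Least_le) (use that in auto)
  have jn: "j \<le> n" using jmin[OF k D0n(2)] .
  have ij: "i < k" "k < j" using i j Dk by (metis le_neq_implies_less less_le_not_le)+
  have between: "A < D l" if "i < l" "l < j" for l
    using that imax[of l] jmin[of l] by (cases "l \<le> k") (auto simp: not_le[symmetric])
  have far: "A - M \<le> D l" if il: "i \<le> l" and lj: "l \<le> j" for l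
  proof -
    consider "l = i" | "l = j" | "i < l" "l < j" using il lj by linarith
    then show ?thesis
    proof cases
      case 1
      have "A < D (Suc i)" using between[of "Suc i"] ij by simp
      then show ?thesis using Dstep(2)[of i] ij jn 1 by simp
    next
      case 2
      have "A < D (j - 1)" using between[of "j - 1"] ij by simp
      moreover have "j - 1 < n" "Suc (j - 1) = j" using ij jn by simp_all
      ultimately show ?thesis using Dstep(1)[of "j - 1"] 2 by simp
    next
      case 3
      then show ?thesis using between[of l] M by simp
    qed
  qed
  obtain F where F: "pairwise (L_separated L) F" "finite F"
    "real (dL L (q i) (q j)) \<le> real (card F) + 2 * A + 5"
    "\<And>h. h \<in> F \<Longrightarrow> separates h {q i} {q j}" "\<And>h. h \<in> F \<Longrightarrow> separates h {foot (q i)} {foot (q j)}"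
    using separating_family_near[of "q i" "foot (q i)" A "q j" "foot (q j)" L] i j
    unfolding D_def by blast
  have meet: "h \<inter> \<gamma> ` {a..b} \<noteq> {}" if "h \<in> F" for h
    using separates_feet_meets[OF F(5)[OF that]] .
  define bl where "bl = block_length"
  define r where "r = M * real bl"
  define k0 where "k0 = (j - i) div bl + 1"
  define q' where "q' m = q (min (i + m * bl) j)" for m
  have bl: "0 < bl" using block_length_bounds by (simp add: bl_def)
  have q'ends: "q' 0 = q i" "q' k0 = q j"
  proof -
    show "q' 0 = q i" using ij by (simp add: q'_def)
    have "j - i < k0 * bl" using bl by (simp add: k0_def dividend_less_div_times add.commute)
    then have "j \<le> i + k0 * bl" by linarith
    then show "q' k0 = q j" by (simp add: q'_def min_absorb2)
  qed
  have q'step: "dist (q' m) (q' (Suc m)) \<le> r" for m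
  proof -
    have "dist (q' m) (q' (Suc m)) \<le> M * real (min (i + Suc m * bl) j - min (i + m * bl) j)"
      unfolding q'_def using jn by (intro path_lipschitz) (auto simp: min_def)
    also have "\<dots> \<le> M * real bl" using M by (intro mult_left_mono of_nat_mono) auto
    finally show ?thesis by (simp add: r_def)
  qed
  have "at_most (\<Union>m<k0. {h \<in> F. h \<inter> cball (q' m) r \<noteq> {}}) (real k0)"
  proof (rule at_most_UN, rule at_most_one_meets_ball[OF cat0 projectable_\<gamma> F(1) meet])
    fix m
    have "A - M \<le> D (min (i + m * bl) j)" by (rule far) (use ij in auto)
    then show "r + (2 * real L + 2) \<le> dist (q' m) (foot (q' m))"
      by (simp add: D_def q'_def A_def far_distance_def r_def bl_def)
  qed
  moreover have "F \<subseteq> (\<Union>m<k0. {h \<in> F. h \<inter> cball (q' m) r \<noteq> {}})"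
  proof
    fix h assume h: "h \<in> F"
    have "\<exists>m<k0. h \<inter> cball (q' m) r \<noteq> {}"
      by (rule separates_meets_discrete_path) (use q'step F(4)[OF h] q'ends in auto)
    with h show "h \<in> (\<Union>m<k0. {h \<in> F. h \<inter> cball (q' m) r \<noteq> {}})" by auto
  qed
  ultimately have "at_most F (real k0)" by (rule at_most_subset) simp
  then have cardF: "real (card F) \<le> real k0" by (simp add: at_most_def)
  have "real k0 \<le> real (j - i) / real bl + 1"
    unfolding k0_def using of_nat_div_le_of_nat[of "j - i" bl, where ?'a = real] by simp
  also have "real (j - i) / real bl \<le> real (j - i) / (2 * K)"
    using block_length_bounds K by (intro divide_left_mono) (auto simp: bl_def)
  finally have "real k0 \<le> real (j - i) / (2 * K) + 1" by simp
  moreover have "real (j - i) / K = 2 * (real (j - i) / (2 * K))" using K by simp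
  ultimately have "real (j - i) / (2 * K) \<le> C + 2 * A + 6"
    using progress[of i j] F(3) cardF ij jn by simp
  then have len: "real (j - i) \<le> excursion_length"
    using K by (simp add: pos_divide_le_eq excursion_length_def A_def mult.commute)
  have "D k \<le> dist (q k) (q i) + D i" unfolding D_def by (rule foot_dist_step)
  also have "dist (q k) (q i) \<le> M * real (k - i)"
    using path_lipschitz[of i k] ij k by (simp add: dist_commute)
  also have "M * real (k - i) \<le> M * excursion_length"
    using M len ij by (intro mult_left_mono) auto
  finally show ?thesis using i unfolding D_def A_def by linarith
qed

text \<open>
  The feet of consecutive vertices are at distance at most \<open>M\<close>, so they leave no gap larger than
  \<open>M\<close> between the ends of the geodesic.
\<close>

lemma geodesic_close_to_path:
  assumes t: "t \<in> {a..b}"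
  shows "\<exists>k\<le>n. dist (\<gamma> t) (q k) \<le> path_distance"
proof -
  have e: "cd (q 0) = a" "cd (q n) = b" using coord_on[OF projectable_\<gamma>] ab ends by auto
  define k where "k = (GREATEST k. k \<le> n \<and> cd (q k) \<le> t)"
  have k: "k \<le> n \<and> cd (q k) \<le> t" unfolding k_def
    by (rule GreatestI_nat[of _ 0 n]) (use e t in auto)
  have kmax: "k' \<le> k" if "k' \<le> n" "cd (q k') \<le> t" for k'
    unfolding k_def by (rule Greatest_le_nat[of _ _ n]) (use that in auto)
  have "t - cd (q k) \<le> M"
  proof (cases "k = n")
    case True
    then show ?thesis using e t M by simp
  next
    case False
    then have "k < n" using k by simp
    moreover from this have "t < cd (q (Suc k))" using kmax[of "Suc k"] by force
    ultimately show ?thesis using coord_lipschitz[OF cat0 projectable_\<gamma>, of "q k" "q (Suc k)"] step[of k] by linarith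
  qed
  then have "dist (\<gamma> t) (foot (q k)) \<le> M" using geodesic_on_dist[OF \<gamma> t coord_mem[OF projectable_\<gamma>]] k by simp
  moreover have "dist (\<gamma> t) (q k) \<le> dist (\<gamma> t) (foot (q k)) + dist (q k) (foot (q k))"
    by (rule dist_triangle2)
  ultimately have "dist (\<gamma> t) (q k) \<le> path_distance"
    using path_close_to_geodesic[of k] k unfolding path_distance_def by linarith
  with k show ?thesis by blast
qed

text \<open>
  A chain that separates the feet of \<open>z\<close> and \<open>y\<close> is crossed by the path that goes from one
  foot to \<open>z\<close>, then to \<open>y\<close>, then to the other foot, and each of the three legs crosses few curtains.
\<close>

lemma feet_close:
  assumes zy: "dist z y \<le> dist z (foot z)"
  shows "\<bar>cd z - cd y\<bar> \<le> contraction_bound"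
proof -
  let ?E = "path_distance"
  have E0: "0 \<le> ?E" by (rule path_constants_nonneg)
  obtain k where k: "k \<le> n" "dist (foot z) (q k) \<le> ?E"
    using geodesic_close_to_path[OF coord_mem[OF projectable_\<gamma>]] by blast
  obtain l where l: "l \<le> n" "dist (foot y) (q l) \<le> ?E"
    using geodesic_close_to_path[OF coord_mem[OF projectable_\<gamma>]] by blast
  define e where "e = real (max k l - min k l)"
  have prog: "e / K - C \<le> real (dL L (q k) (q l))"
  proof (cases "k \<le> l")
    case True
    then show ?thesis using progress[of k l] l by (simp add: e_def max_def min_def)
  next
    case False
    then show ?thesis using progress[of l k] k dL_commute[of L "q k" "q l"] by (simp add: e_def max_def min_def)
  qed
  have pl: "dist (q k) (q l) \<le> M * e"
  proof (cases "k \<le> l")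
    case True
    then show ?thesis using path_lipschitz[of k l] l by (simp add: e_def max_def min_def)
  next
    case False
    then show ?thesis using path_lipschitz[of l k] k by (simp add: e_def max_def min_def dist_commute)
  qed
  obtain F where F: "pairwise (L_separated L) F" "finite F"
    "real (dL L (q k) (q l)) \<le> real (card F) + 2 * ?E + 5" "\<And>h. h \<in> F \<Longrightarrow> separates h {foot z} {foot y}"
    using separating_family_near[of "q k" "foot z" ?E "q l" "foot y" L] k l by (metis dist_commute)
  note dis = L_separated_disjoint[OF F(1)]
  have legs: "at_most {h \<in> F. separates h {foot x} {x}} (2 * real L + 5)" for x
    by (rule at_most_separating_foot[OF cat0 projectable_\<gamma>])
      (use pairwise_subset[OF F(1)] separates_feet_meets[OF F(4)] in auto)
  have leg2: "at_most {h \<in> {h \<in> F. separates h {z} {foot y}}. separates h {z} {y}} (2 * real L + 5)"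
    by (rule at_most_separating_in_ball[OF cat0 projectable_\<gamma> _ _ _ zy])
      (use pairwise_subset[OF F(1)] separates_feet_meets[OF F(4)] in auto)
  have leg3: "at_most {h \<in> {h \<in> F. separates h {z} {foot y}}. separates h {y} {foot y}} (2 * real L + 5)"
    by (rule at_most_subset[OF legs[of y]]) (auto simp: separates_commute[of _ "{y}"])
  have "disjoint {h \<in> F. separates h {z} {foot y}}" by (rule pairwise_subset[OF dis]) auto
  then have "at_most {h \<in> F. separates h {z} {foot y}} (2 * real L + 5 + (2 * real L + 5) + 1)"
    by (rule at_most_split[OF cat0 _ _ leg2 leg3]) auto
  from at_most_split[OF cat0 dis F(4) legs this]
  have "real (card F) \<le> 6 * real L + 17" by (simp add: at_most_def)
  then have "e / K \<le> 6 * real L + 22 + 2 * ?E + C" using prog F(3) by linarith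
  then have "e \<le> K * (6 * real L + 22 + 2 * ?E + C)" using K by (simp add: pos_divide_le_eq mult.commute)
  then have "M * e \<le> M * K * (6 * real L + 22 + 2 * ?E + C)" using M by (simp add: mult.assoc)
  moreover have "dist (foot z) (foot y) \<le> 2 * ?E + dist (q k) (q l)"
    using k(2) l(2) dist_triangle[of "foot z" "foot y" "q k"] dist_triangle[of "q k" "foot y" "q l"]
    by (simp add: dist_commute)
  moreover have "dist (foot z) (foot y) = \<bar>cd z - cd y\<bar>"
    by (rule geodesic_on_dist[OF \<gamma> coord_mem[OF projectable_\<gamma>] coord_mem[OF projectable_\<gamma>]])
  ultimately show ?thesis using pl unfolding contraction_bound_def by linarith
qed

lemma geodesic_contracting: "contracting (2 * contraction_bound) (\<gamma> ` {a..b})"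
  unfolding contracting_def
proof (intro allI impI)
  fix z :: 'a and \<rho> assume disj: "ball z \<rho> \<inter> \<gamma> ` {a..b} = {}"
  let ?P = "nearest_point (\<gamma> ` {a..b}) ` ball z \<rho>"
  have "\<rho> \<le> dist z (foot z)"
  proof (rule ccontr)
    assume "\<not> \<rho> \<le> dist z (foot z)"
    then have "foot z \<in> ball z \<rho>" by simp
    then show False using disj coord_mem[OF projectable_\<gamma>] by blast
  qed
  then have z: "\<bar>cd z - cd y\<bar> \<le> contraction_bound" if "y \<in> ball z \<rho>" for y
    using that by (intro feet_close) auto
  have bound: "dist x y \<le> 2 * contraction_bound" if xy: "x \<in> ?P" "y \<in> ?P" for x y
  proof -
    obtain x' y' where *: "x' \<in> ball z \<rho>" "y' \<in> ball z \<rho>" "x = foot x'" "y = foot y'"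
      using xy unfolding nearest_point_coord[OF projectable_\<gamma>] by auto
    have "dist x y = \<bar>cd x' - cd y'\<bar>" unfolding *(3,4)
      by (rule geodesic_on_dist[OF \<gamma> coord_mem[OF projectable_\<gamma>] coord_mem[OF projectable_\<gamma>]])
    then show ?thesis using z[OF *(1)] z[OF *(2)] by linarith
  qed
  show "bounded ?P \<and> diameter ?P \<le> 2 * contraction_bound"
  proof
    show "bounded ?P" unfolding bounded_two_points using bound by blast
    show "diameter ?P \<le> 2 * contraction_bound"
    proof (cases "?P = {}")
      case True
      then show ?thesis using path_constants_nonneg(3) by (simp only: diameter_empty)
    next
      case False
      then have "?P \<times> ?P \<noteq> {}" by simp
      then show ?thesis unfolding diameter_def using False bound by (auto intro!: cSUP_least)
    qed
  qed
qed

end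
end

text \<open>
  The form needed for stability: \<open>\<mu>\<close> and \<open>R\<close> are chosen before the geodesic and the path.
\<close>

theorem quasigeodesic_stability:
  fixes M K C :: real and L :: nat
  assumes "1 \<le> M" "0 < K" "0 \<le> C"
  obtains \<mu> R where "0 \<le> \<mu>" "0 \<le> R"
    "\<And>a b (\<gamma> :: real \<Rightarrow> 'a) q n.
      geodesic_on {a..b} \<gamma> \<Longrightarrow> a \<le> b \<Longrightarrow> q 0 = \<gamma> a \<Longrightarrow> q n = \<gamma> b \<Longrightarrow>
      (\<And>i. i < n \<Longrightarrow> dist (q i) (q (Suc i)) \<le> M) \<Longrightarrow>
      (\<And>i j. i \<le> j \<Longrightarrow> j \<le> n \<Longrightarrow> real (j - i) / K - C \<le> real (dL L (q i) (q j))) \<Longrightarrow>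
      contracting R (\<gamma> ` {a..b}) \<and> (\<forall>t\<in>{a..b}. \<exists>k\<le>n. dist (\<gamma> t) (q k) \<le> \<mu>)"
proof (rule that[of "path_distance M K C L" "2 * contraction_bound M K C L"])
  show "0 \<le> path_distance M K C L" "0 \<le> 2 * contraction_bound M K C L"
    using path_constants_nonneg[OF assms] by auto
  fix a b and \<gamma> :: "real \<Rightarrow> 'a" and q n
  assume h: "geodesic_on {a..b} \<gamma>" "a \<le> b" "q 0 = \<gamma> a" "q n = \<gamma> b"
    and step: "\<And>i. i < n \<Longrightarrow> dist (q i) (q (Suc i)) \<le> M"
    and progress: "\<And>i j. i \<le> j \<Longrightarrow> j \<le> n \<Longrightarrow> real (j - i) / K - C \<le> real (dL L (q i) (q j))"
  have "contracting (2 * contraction_bound M K C L) (\<gamma> ` {a..b})"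
    by (rule geodesic_contracting[OF assms h]) (fact step, fact progress)
  moreover have "\<exists>k\<le>n. dist (\<gamma> t) (q k) \<le> path_distance M K C L" if t: "t \<in> {a..b}" for t
    by (rule geodesic_close_to_path[OF assms h _ _ t]) (fact step, fact progress)
  ultimately show "contracting (2 * contraction_bound M K C L) (\<gamma> ` {a..b})
      \<and> (\<forall>t\<in>{a..b}. \<exists>k\<le>n. dist (\<gamma> t) (q k) \<le> path_distance M K C L)" by blast
qed

end

section \<open>The curtain distance and the distances \<open>d\<^sub>L\<close>\<close>

context
  fixes w :: "nat \<Rightarrow> real"
  assumes weights: "curtain_weights w"
begin

lemma weight_pos: "0 < w (Suc n)"
  using weights by (simp add: curtain_weights_def)

lemma weights_summable: "summable (\<lambda>n. w (Suc n))"
proof (rule summable_comparison_test')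
  show "summable (\<lambda>n. real (Suc n) ^ 2 * w (Suc n))" using weights by (simp add: curtain_weights_def)
  fix n :: nat
  have "1 * w (Suc n) \<le> real (Suc n) ^ 2 * w (Suc n)"
    using weight_pos[of n] by (intro mult_right_mono one_le_power) auto
  then show "norm (w (Suc n)) \<le> real (Suc n) ^ 2 * w (Suc n)" using weight_pos[of n] by simp
qed

lemma total_weight_pos: "0 < (\<Sum>n. w (Suc n))"
  using weights_summable weight_pos by (rule suminf_pos)

context
  assumes cat0: "is_CAT0 TYPE('a::metric_space)"
begin

lemma weighted_dL_bounds:
  fixes x y :: 'a
  shows "0 \<le> w (Suc n) * real (dL (Suc n) x y)"
    and "w (Suc n) * real (dL (Suc n) x y) \<le> w (Suc n) * (dist x y + 2)"
  using weight_pos[of n] dL_le_dist[OF cat0, of "Suc n" x y] by (auto intro: mult_left_mono)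

lemma weighted_dL_summable: "summable (\<lambda>n. w (Suc n) * real (dL (Suc n) x (y :: 'a)))"
  by (rule summable_comparison_test'[OF summable_mult2[OF weights_summable, of "dist x y + 2"]])
    (use weighted_dL_bounds in simp)

lemma curtain_dist_le_dist: "curtain_dist w x y \<le> (\<Sum>n. w (Suc n)) * (dist x (y :: 'a) + 2)"
proof -
  have "curtain_dist w x y \<le> (\<Sum>n. w (Suc n) * (dist x y + 2))"
    unfolding curtain_dist_def
    by (intro suminf_le weighted_dL_bounds weighted_dL_summable summable_mult2 weights_summable)
  also have "\<dots> = (\<Sum>n. w (Suc n)) * (dist x y + 2)"
    by (rule suminf_mult2[OF weights_summable, symmetric])
  finally show ?thesis .
qed

lemma dL_le_curtain_dist: "w (Suc n) * real (dL (Suc n) x y) \<le> curtain_dist w x (y :: 'a)"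
  using sum_le_suminf[OF weighted_dL_summable, of "{n}" x y] weighted_dL_bounds(1)
  by (simp add: curtain_dist_def)

text \<open>
  Conversely \<open>D\<close> is controlled by a single \<open>d\<^sub>L\<close>: since \<open>d\<^sub>L\<close> is at most \<open>dist + 2\<close> for all \<open>L\<close>
  and increases with \<open>L\<close>, the tail of the series costs only a small multiple of the distance.
\<close>

lemma curtain_dist_le_dL:
  assumes \<epsilon>: "0 < \<epsilon>"
  obtains L where "\<And>x y :: 'a. curtain_dist w x y
      \<le> (\<Sum>n. w (Suc n)) * real (dL L x y) + \<epsilon> * (dist x y + 2)"
proof -
  let ?W = "\<Sum>n. w (Suc n)"
  obtain N where N: "norm (\<Sum>i. w (Suc (i + N))) < \<epsilon>"
    using suminf_exist_split[OF \<epsilon> weights_summable] by blast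
  show thesis
  proof (rule that[of N])
    fix x y :: 'a
    let ?f = "\<lambda>n. w (Suc n) * real (dL (Suc n) x y)"
    have s: "summable (\<lambda>n. w (Suc (n + N)))" using weights_summable by (subst summable_iff_shift)
    have "(\<Sum>n. ?f (n + N)) \<le> (\<Sum>n. w (Suc (n + N)) * (dist x y + 2))"
      by (rule suminf_le[OF weighted_dL_bounds(2)])
        (use weighted_dL_summable summable_iff_shift[of ?f N] summable_mult2[OF s] in auto)
    also have "\<dots> = (\<Sum>n. w (Suc (n + N))) * (dist x y + 2)" by (rule suminf_mult2[OF s, symmetric])
    also have "\<dots> \<le> \<epsilon> * (dist x y + 2)" using N by (intro mult_right_mono) auto
    finally have tail: "(\<Sum>n. ?f (n + N)) \<le> \<epsilon> * (dist x y + 2)" .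
    have "(\<Sum>n<N. ?f n) \<le> (\<Sum>n<N. w (Suc n) * real (dL N x y))"
      using weight_pos dL_mono[OF cat0] by (intro sum_mono mult_left_mono) (auto simp: less_imp_le Suc_leI)
    also have "\<dots> = (\<Sum>n<N. w (Suc n)) * real (dL N x y)" by (simp add: sum_distrib_right)
    also have "\<dots> \<le> ?W * real (dL N x y)"
      using weight_pos weights_summable by (intro mult_right_mono sum_le_suminf) (auto simp: less_imp_le)
    finally have head: "(\<Sum>n<N. ?f n) \<le> ?W * real (dL N x y)" .
    have "curtain_dist w x y = (\<Sum>n. ?f (n + N)) + (\<Sum>n<N. ?f n)"
      unfolding curtain_dist_def by (rule suminf_split_initial_segment[OF weighted_dL_summable])
    with head tail show "curtain_dist w x y \<le> ?W * real (dL N x y) + \<epsilon> * (dist x y + 2)" by linarith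
  qed
qed

end
end

section \<open>Word metrics\<close>

context group
begin

abbreviation "letters S \<equiv> S \<union> m_inv G ` S"
abbreviation "word_value u \<equiv> foldr (\<otimes>) u \<one>"

lemma letters_closed: "S \<subseteq> carrier G \<Longrightarrow> letters S \<subseteq> carrier G"
  by auto

lemma word_value_closed: "set u \<subseteq> carrier G \<Longrightarrow> word_value u \<in> carrier G"
  by (induction u) auto

lemma word_value_append:
  "set u \<subseteq> carrier G \<Longrightarrow> set v \<subseteq> carrier G \<Longrightarrow> word_value (u @ v) = word_value u \<otimes> word_value v"
  by (induction u) (auto simp: m_assoc word_value_closed)

lemma word_value_in_subgroup: "subgroup H G \<Longrightarrow> set u \<subseteq> H \<Longrightarrow> word_value u \<in> H"
  by (induction u) (auto intro: subgroup.one_closed subgroup.m_closed)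

lemma letters_in_subgroup: "subgroup H G \<Longrightarrow> S \<subseteq> H \<Longrightarrow> letters S \<subseteq> H"
  by (auto intro: subgroup.m_inv_closed)

lemma generate_word:
  assumes "S \<subseteq> carrier G" "g \<in> generate G S"
  shows "\<exists>u. set u \<subseteq> letters S \<and> word_value u = g"
  using assms(2)
proof (induction rule: generate.induct)
  case one
  show ?case by (intro exI[of _ "[]"]) simp
next
  case (incl h)
  then show ?case using assms(1) by (intro exI[of _ "[h]"]) auto
next
  case (inv h)
  then show ?case using assms(1) by (intro exI[of _ "[inv h]"]) auto
next
  case (eng h1 h2)
  then obtain u v where uv: "set u \<subseteq> letters S" "word_value u = h1" "set v \<subseteq> letters S" "word_value v = h2"
    by blast
  moreover have "set u \<subseteq> carrier G" "set v \<subseteq> carrier G"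
    using letters_closed[OF assms(1)] uv(1,3) by (meson order_trans)+
  ultimately show ?case using word_value_append[of u v] by (intro exI[of _ "u @ v"]) auto
qed

lemma word_length_le: "set u \<subseteq> letters S \<Longrightarrow> word_length G S (word_value u) \<le> length u"
  unfolding word_length_def by (rule Least_le) blast

lemma word_length_attained:
  assumes "S \<subseteq> carrier G" "g \<in> generate G S"
  obtains u where "length u = word_length G S g" "set u \<subseteq> letters S" "word_value u = g"
proof -
  obtain u0 where "set u0 \<subseteq> letters S" "word_value u0 = g" using generate_word[OF assms] by blast
  then have "\<exists>u. length u = length u0 \<and> set u \<subseteq> letters S \<and> word_value u = g" by blast
  from LeastI[of "\<lambda>n. \<exists>u. length u = n \<and> set u \<subseteq> letters S \<and> word_value u = g", OF this] that
  show thesis unfolding word_length_def by blast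
qed

lemma word_length_mult_le:
  assumes S: "S \<subseteq> carrier G" and "g \<in> generate G S" "h \<in> generate G S"
  shows "word_length G S (g \<otimes> h) \<le> word_length G S g + word_length G S h"
proof -
  obtain u v where uv: "length u = word_length G S g" "set u \<subseteq> letters S" "word_value u = g"
    "length v = word_length G S h" "set v \<subseteq> letters S" "word_value v = h"
    using word_length_attained[OF S] assms(2,3) by metis
  have "word_value (u @ v) = g \<otimes> h"
    using word_value_append[of u v] uv letters_closed[OF S] by (metis order_trans)
  with word_length_le[of "u @ v" S] uv show ?thesis by simp
qed

lemma letters_in_generate: "letters S \<subseteq> generate G S"
  by (auto intro: generate.incl generate.inv)

text \<open>
  Replace every letter of a word over \<open>T\<close> by a word over \<open>S\<close>; finitely many letters have bounded
  length.
\<close>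

lemma word_length_change_generators:
  assumes S: "S \<subseteq> carrier G" and T: "finite T" "T \<subseteq> carrier G" and gen: "generate G T = generate G S"
  obtains K :: real where "0 < K" "\<And>g. g \<in> generate G S \<Longrightarrow> real (word_length G S g) \<le> K * real (word_length G T g)"
proof -
  define k where "k = Max (insert 1 (word_length G S ` letters T))"
  have k: "1 \<le> k" "\<And>s. s \<in> letters T \<Longrightarrow> word_length G S s \<le> k"
    using T(1) unfolding k_def by (auto intro!: Max_ge)
  have *: "word_length G S (word_value u) \<le> k * length u" if "set u \<subseteq> letters T" for u
    using that
  proof (induction u)
    case Nil
    then show ?case using word_length_le[of "[]" S] by simp
  next
    case (Cons s u)
    have u: "set u \<subseteq> letters T" and s: "s \<in> letters T" using Cons.prems by auto
    have gs: "generate G T \<le> generate G S" "subgroup (generate G T) G"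
      using gen generate_is_subgroup[OF T(2)] by auto
    have "s \<in> generate G S" using s letters_in_generate[of T] gen by blast
    moreover have "word_value u \<in> generate G S"
      using word_value_in_subgroup[OF gs(2)] u letters_in_generate[of T] gen by blast
    ultimately have "word_length G S (s \<otimes> word_value u) \<le> word_length G S s + word_length G S (word_value u)"
      by (rule word_length_mult_le[OF S])
    also have "\<dots> \<le> k + k * length u" using k(2)[OF s] Cons.IH[OF u] by (rule add_mono)
    finally show ?case by simp
  qed
  show thesis
  proof (rule that[of "real k"])
    show "0 < real k" using k(1) by simp
    fix g assume "g \<in> generate G S"
    then have "g \<in> generate G T" by (simp add: gen)
    then obtain u where "length u = word_length G T g" "set u \<subseteq> letters T" "word_value u = g"
      by (rule word_length_attained[OF T(2)])
    with *[of u] have "word_length G S g \<le> k * word_length G T g" by simp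
    then show "real (word_length G S g) \<le> real k * real (word_length G T g)"
      by (metis of_nat_le_iff of_nat_mult)
  qed
qed

text \<open>
  The elements \<open>e i\<close> are the vertices of the path that a word of minimal length traces from \<open>g\<close>; a
  shorter expression for one of its segments would shorten the whole word.
\<close>

lemma geodesic_word_segment:
  assumes S: "S \<subseteq> carrier G" and g: "g \<in> carrier G" and u: "set u \<subseteq> letters S"
    and min: "word_length G S (word_value u) = length u" and ij: "i \<le> j" "j \<le> length u"
  defines "e \<equiv> \<lambda>i. g \<otimes> word_value (take i u)"
  shows "inv (e i) \<otimes> e j = word_value (drop i (take j u))"
    and "j - i \<le> word_length G S (inv (e i) \<otimes> e j)"
proof -
  let ?m = "drop i (take j u)"
  have sub: "set (take i u) \<subseteq> letters S" "set ?m \<subseteq> letters S" "set (drop j u) \<subseteq> letters S"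
    using u by (meson set_take_subset set_drop_subset order_trans)+
  then have car: "set (take i u) \<subseteq> carrier G" "set ?m \<subseteq> carrier G" "set (drop j u) \<subseteq> carrier G"
    using letters_closed[OF S] by (meson order_trans)+
  note cl = word_value_closed[OF car(1)] word_value_closed[OF car(2)] word_value_closed[OF car(3)]
  have tj: "take j u = take i u @ ?m" using ij
    by (metis append_take_drop_id min.absorb1 take_take)
  have "word_value (take j u) = word_value (take i u) \<otimes> word_value ?m"
    by (subst tj) (rule word_value_append[OF car(1,2)])
  then have "e j = e i \<otimes> word_value ?m" using cl g by (simp add: e_def m_assoc)
  moreover have "e i \<in> carrier G" using cl g by (simp add: e_def)
  ultimately show *: "inv (e i) \<otimes> e j = word_value ?m" using cl by (simp add: m_assoc[symmetric])
  have gen: "word_value v \<in> generate G S" if "set v \<subseteq> letters S" for v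
    using word_value_in_subgroup[OF generate_is_subgroup[OF S]] letters_in_generate that by blast
  have "word_value u = word_value (take j u) \<otimes> word_value (drop j u)"
  proof -
    have "set (take j u) \<subseteq> carrier G" using car tj by (metis Un_subset_iff set_append)
    from word_value_append[OF this car(3)] show ?thesis by simp
  qed
  also have "\<dots> = word_value (take i u) \<otimes> word_value ?m \<otimes> word_value (drop j u)"
    by (subst tj) (simp only: word_value_append[OF car(1,2)])
  finally have "length u \<le> word_length G S (word_value (take i u) \<otimes> word_value ?m) + word_length G S (word_value (drop j u))"
    using word_length_mult_le[OF S, of "word_value (take i u) \<otimes> word_value ?m" "word_value (drop j u)"]
      gen[OF sub(1)] gen[OF sub(2)] gen[OF sub(3)] min generate.eng by metis
  also have "word_length G S (word_value (take i u) \<otimes> word_value ?m)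
      \<le> word_length G S (word_value (take i u)) + word_length G S (word_value ?m)"
    by (rule word_length_mult_le[OF S gen[OF sub(1)] gen[OF sub(2)]])
  also have "word_length G S (word_value (take i u)) \<le> i" using word_length_le[OF sub(1)] by simp
  also have "word_length G S (word_value (drop j u)) \<le> length u - j" using word_length_le[OF sub(3)] by simp
  finally show "j - i \<le> word_length G S (inv (e i) \<otimes> e j)" unfolding * using ij by simp
qed

end

section \<open>Orbit maps\<close>

lemma quasiisometric_embeddingI:
  assumes c: "0 < c" "0 \<le> c'" "0 \<le> e" "0 \<le> e'"
    and nn: "\<And>x y. x \<in> A \<Longrightarrow> y \<in> A \<Longrightarrow> 0 \<le> d x y"
    and low: "\<And>x y. x \<in> A \<Longrightarrow> y \<in> A \<Longrightarrow> c * d x y - e \<le> d' (f x) (f y)"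
    and up: "\<And>x y. x \<in> A \<Longrightarrow> y \<in> A \<Longrightarrow> d' (f x) (f y) \<le> c' * d x y + e'"
  shows "quasiisometric_embedding A d d' f"
proof -
  define K where "K = max 1 (max (1 / c) c')"
  define C where "C = max e e'"
  have K: "1 \<le> K" "1 / c \<le> K" "c' \<le> K" by (auto simp: K_def)
  have "1 / K \<le> c" using K(1,2) c(1) by (simp add: field_simps)
  have "d x y / K - C \<le> d' (f x) (f y) \<and> d' (f x) (f y) \<le> K * d x y + C" if "x \<in> A" "y \<in> A" for x y
  proof
    have "1 / K * d x y \<le> c * d x y" using \<open>1 / K \<le> c\<close> nn[OF that] by (rule mult_right_mono)
    then show "d x y / K - C \<le> d' (f x) (f y)" using low[OF that] by (simp add: C_def)
    have "c' * d x y \<le> K * d x y" using K(3) nn[OF that] by (rule mult_right_mono)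
    then show "d' (f x) (f y) \<le> K * d x y + C" using up[OF that] by (simp add: C_def)
  qed
  moreover have "0 \<le> C" using c by (simp add: C_def)
  ultimately show ?thesis using K(1) unfolding quasiisometric_embedding_def by blast
qed

context
  fixes G :: "('g, 'm) monoid_scheme" (structure) and \<phi> :: "'g \<Rightarrow> 'a::metric_space \<Rightarrow> 'a" and H :: "'g set"
  assumes grp: "group G" and iso: "isometric_action G \<phi>" and H: "subgroup H G"
begin

interpretation group G by (rule grp)

lemma H_carrier: "h \<in> H \<Longrightarrow> h \<in> carrier G"
  using subgroup.subset[OF H] by blast

lemma
  shows act_mult: "g \<in> carrier G \<Longrightarrow> h \<in> carrier G \<Longrightarrow> \<phi> (g \<otimes> h) x = \<phi> g (\<phi> h x)"
    and act_one: "\<phi> \<one> x = x"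
    and act_dist: "g \<in> carrier G \<Longrightarrow> dist (\<phi> g x) (\<phi> g y) = dist x y"
proof -
  interpret group_action G UNIV \<phi> using iso by (simp add: isometric_action_def)
  show "g \<in> carrier G \<Longrightarrow> h \<in> carrier G \<Longrightarrow> \<phi> (g \<otimes> h) x = \<phi> g (\<phi> h x)"
    by (rule composition_rule) auto
  show "\<phi> \<one> x = x" using id_eq_one by (metis UNIV_I restrict_apply')
  show "g \<in> carrier G \<Longrightarrow> dist (\<phi> g x) (\<phi> g y) = dist x y"
    using iso by (simp add: isometric_action_def)
qed

lemma orbit_dist:
  assumes "g \<in> carrier G" "h \<in> carrier G"
  shows "dist (\<phi> g x) (\<phi> h x) = dist x (\<phi> (inv g \<otimes> h) x)"
proof -
  have "dist x (\<phi> (inv g \<otimes> h) x) = dist (\<phi> g x) (\<phi> (g \<otimes> (inv g \<otimes> h)) x)"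
    using assms by (simp add: act_mult act_dist)
  also have "g \<otimes> (inv g \<otimes> h) = h" using assms by (simp add: m_assoc[symmetric])
  finally show ?thesis by simp
qed

lemma displacement_bound:
  assumes S: "finite S" "S \<subseteq> H" "generate G S = H"
  obtains M where "1 \<le> M" "\<And>s. s \<in> letters S \<Longrightarrow> dist x (\<phi> s x) \<le> M"
    "\<And>g. g \<in> H \<Longrightarrow> dist x (\<phi> g x) \<le> M * real (word_length G S g)"
proof -
  define M where "M = Max (insert 1 ((\<lambda>s. dist x (\<phi> s x)) ` letters S))"
  have M: "1 \<le> M" "\<And>s. s \<in> letters S \<Longrightarrow> dist x (\<phi> s x) \<le> M"
    using S(1) unfolding M_def by (auto intro!: Max_ge)
  have SG: "S \<subseteq> carrier G" using S(2) H_carrier by blast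
  have *: "dist x (\<phi> (word_value u) x) \<le> M * real (length u)" if "set u \<subseteq> letters S" for u
    using that
  proof (induction u)
    case Nil
    then show ?case by (simp add: act_one)
  next
    case (Cons s u)
    have s: "s \<in> letters S" "s \<in> carrier G" and u: "set u \<subseteq> letters S" "set u \<subseteq> carrier G"
      using Cons.prems letters_closed[OF SG] by auto
    have "dist x (\<phi> (s \<otimes> word_value u) x) \<le> dist x (\<phi> s x) + dist (\<phi> s x) (\<phi> s (\<phi> (word_value u) x))"
      using s u by (simp add: act_mult word_value_closed dist_triangle)
    also have "\<dots> \<le> M + M * real (length u)"
      using M(2)[OF s(1)] Cons.IH[OF u(1)] s(2) by (simp add: act_dist)
    finally show ?case by (simp add: algebra_simps)
  qed
  have "dist x (\<phi> g x) \<le> M * real (word_length G S g)" if g: "g \<in> H" for g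
  proof -
    obtain u where "length u = word_length G S g" "set u \<subseteq> letters S" "word_value u = g"
      using word_length_attained[OF SG, of g] S(3) g by metis
    with *[of u] show ?thesis by simp
  qed
  with M show thesis by (rule that)
qed

context
  fixes w :: "nat \<Rightarrow> real"
  assumes cat0: "is_CAT0 TYPE('a)" and weights: "curtain_weights w"
begin

text \<open>
  A quasi-isometric embedding into the curtain model is detected by one \<open>d\<^sub>L\<close>, so words of minimal
  length trace paths to which the stability of quasigeodesics applies.
\<close>

lemma quasiisometric_orbit_stable:
  assumes S: "finite S" "S \<subseteq> H" "generate G S = H"
    and qi: "quasiisometric_embedding H (word_dist G S) (curtain_dist w) (\<lambda>h. \<phi> h x)"
  shows "stable_subset (orbit (G\<lparr>carrier := H\<rparr>) \<phi> x)"
proof -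
  let ?W = "\<Sum>n. w (Suc n)"
  have W: "0 < ?W" by (rule total_weight_pos[OF weights])
  have SG: "S \<subseteq> carrier G" using S(2) H_carrier by blast
  obtain K C where K: "1 \<le> K" and C: "0 \<le> C"
    and low: "\<And>g h. g \<in> H \<Longrightarrow> h \<in> H \<Longrightarrow> word_dist G S g h / K - C \<le> curtain_dist w (\<phi> g x) (\<phi> h x)"
    using qi unfolding quasiisometric_embedding_def by blast
  obtain M where M: "1 \<le> M" "\<And>s. s \<in> letters S \<Longrightarrow> dist x (\<phi> s x) \<le> M"
    "\<And>g. g \<in> H \<Longrightarrow> dist x (\<phi> g x) \<le> M * real (word_length G S g)"
    using displacement_bound[OF S, of x] by blast
  define \<epsilon> where "\<epsilon> = 1 / (2 * K * M)"
  have \<epsilon>: "0 < \<epsilon>" using K M by (simp add: \<epsilon>_def)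
  obtain L where L: "\<And>x y :: 'a. curtain_dist w x y \<le> ?W * real (dL L x y) + \<epsilon> * (dist x y + 2)"
    using curtain_dist_le_dL[OF weights cat0 \<epsilon>] by blast
  define K' where "K' = 2 * K * ?W"
  define C' where "C' = (C + 2 * \<epsilon>) / ?W"
  have K': "0 < K'" and C': "0 \<le> C'" using K C W \<epsilon> by (simp_all add: K'_def C'_def)
  have prog: "real (word_length G S (inv g \<otimes> h)) / K' - C' \<le> real (dL L (\<phi> g x) (\<phi> h x))"
    if gh: "g \<in> H" "h \<in> H" for g h
  proof -
    let ?l = "real (word_length G S (inv g \<otimes> h))"
    have "inv g \<otimes> h \<in> H" using gh H by (simp add: subgroup.m_closed subgroup.m_inv_closed)
    then have "dist (\<phi> g x) (\<phi> h x) \<le> M * ?l"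
      using M(3) gh H_carrier by (simp add: orbit_dist)
    then have "\<epsilon> * (dist (\<phi> g x) (\<phi> h x) + 2) \<le> \<epsilon> * (M * ?l + 2)" using \<epsilon> by (intro mult_left_mono) auto
    also have "\<dots> = ?l / (2 * K) + 2 * \<epsilon>" using M(1) K by (simp add: \<epsilon>_def field_simps)
    finally have "?l / K - C \<le> ?W * real (dL L (\<phi> g x) (\<phi> h x)) + (?l / (2 * K) + 2 * \<epsilon>)"
      using low[OF gh] L[of "\<phi> g x" "\<phi> h x"] unfolding word_dist_def by linarith
    moreover have "?l / K = 2 * (?l / (2 * K))" by simp
    ultimately have "?l / (2 * K) - (C + 2 * \<epsilon>) \<le> ?W * real (dL L (\<phi> g x) (\<phi> h x))" by linarith
    then have "(?l / (2 * K) - (C + 2 * \<epsilon>)) / ?W \<le> real (dL L (\<phi> g x) (\<phi> h x))"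
      using W by (simp add: pos_divide_le_eq mult.commute)
    then show ?thesis by (simp add: K'_def C'_def diff_divide_distrib)
  qed
  obtain \<mu> R where \<mu>: "0 \<le> \<mu>" and R: "0 \<le> R"
    and stab: "\<And>a b (\<gamma> :: real \<Rightarrow> 'a) q n.
      geodesic_on {a..b} \<gamma> \<Longrightarrow> a \<le> b \<Longrightarrow> q 0 = \<gamma> a \<Longrightarrow> q n = \<gamma> b \<Longrightarrow>
      (\<And>i. i < n \<Longrightarrow> dist (q i) (q (Suc i)) \<le> M) \<Longrightarrow>
      (\<And>i j. i \<le> j \<Longrightarrow> j \<le> n \<Longrightarrow> real (j - i) / K' - C' \<le> real (dL L (q i) (q j))) \<Longrightarrow>
      contracting R (\<gamma> ` {a..b}) \<and> (\<forall>t\<in>{a..b}. \<exists>k\<le>n. dist (\<gamma> t) (q k) \<le> \<mu>)"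
    by (rule quasigeodesic_stability[OF cat0 M(1) K' C', of L]) blast
  let ?Y = "orbit (G\<lparr>carrier := H\<rparr>) \<phi> x"
  have main: "contracting R (\<gamma> ` {a..b}) \<and> (\<forall>t\<in>{a..b}. \<exists>y\<in>?Y. dist (\<gamma> t) y \<le> \<mu>)"
    if ab: "a \<le> b" and geo: "geodesic_on {a..b} \<gamma>" and Y: "\<gamma> a \<in> ?Y" "\<gamma> b \<in> ?Y" for a b \<gamma>
  proof -
    obtain g h where gh: "g \<in> H" "h \<in> H" "\<gamma> a = \<phi> g x" "\<gamma> b = \<phi> h x"
      using Y unfolding orbit_def by auto
    have ghH: "inv g \<otimes> h \<in> H" using gh H by (simp add: subgroup.m_closed subgroup.m_inv_closed)
    then obtain u where u: "length u = word_length G S (inv g \<otimes> h)" "set u \<subseteq> letters S"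
      "word_value u = inv g \<otimes> h"
      using word_length_attained[OF SG, of "inv g \<otimes> h"] S(3) by metis
    have gc: "g \<in> carrier G" "h \<in> carrier G" using gh H_carrier by auto
    define e where "e i = g \<otimes> word_value (take i u)" for i
    define q where "q i = \<phi> (e i) x" for i
    have eH: "e i \<in> H" for i
    proof -
      have "set (take i u) \<subseteq> H" using u(2) letters_in_subgroup[OF H S(2)]
        by (meson set_take_subset order_trans)
      then show ?thesis unfolding e_def
        using word_value_in_subgroup[OF H] gh(1) subgroup.m_closed[OF H] by blast
    qed
    have seg: "inv (e i) \<otimes> e j = word_value (drop i (take j u))"
      "j - i \<le> word_length G S (inv (e i) \<otimes> e j)" if "i \<le> j" "j \<le> length u" for i j
      unfolding e_def using geodesic_word_segment[OF SG gc(1) u(2) _ that] u by simp_all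
    have "contracting R (\<gamma> ` {a..b}) \<and> (\<forall>t\<in>{a..b}. \<exists>k\<le>length u. dist (\<gamma> t) (q k) \<le> \<mu>)"
    proof (rule stab[OF geo ab])
      show "q 0 = \<gamma> a" using gh gc by (simp add: q_def e_def)
      have "g \<otimes> (inv g \<otimes> h) = h" using gc by (simp add: m_assoc[symmetric])
      then show "q (length u) = \<gamma> b" using gh u(3) by (simp add: q_def e_def)
    next
      fix i assume i: "i < length u"
      have "drop i (take (Suc i) u) = [u ! i]" using i by (simp add: take_Suc_conv_app_nth)
      moreover have "u ! i \<in> letters S" using u(2) nth_mem[OF i] by blast
      ultimately have "inv (e i) \<otimes> e (Suc i) = u ! i"
        using seg(1)[of i "Suc i"] i letters_closed[OF SG] by auto
      then show "dist (q i) (q (Suc i)) \<le> M"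
        using M(2)[OF \<open>u ! i \<in> letters S\<close>] orbit_dist[OF H_carrier[OF eH] H_carrier[OF eH]]
        by (simp add: q_def)
    next
      fix i j assume ij: "i \<le> j" "j \<le> length u"
      have "real (j - i) / K' \<le> real (word_length G S (inv (e i) \<otimes> e j)) / K'"
        using seg(2)[OF ij] K' by (intro divide_right_mono) auto
      then show "real (j - i) / K' - C' \<le> real (dL L (q i) (q j))"
        using prog[OF eH eH, of i j] unfolding q_def by linarith
    qed
    moreover have "q k \<in> ?Y" for k using eH by (auto simp: orbit_def q_def)
    ultimately show ?thesis by meson
  qed
  show ?thesis unfolding stable_subset_def using \<mu> R main by blast
qed

text \<open>
  Follow the geodesic from \<open>x\<close> to \<open>\<phi> g x\<close> by orbit points, at unit steps; consecutive ones differ by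
  an element of small displacement, and properness makes these finite in number.
\<close>

lemma stable_orbit_generators:
  assumes proper: "proper_action G \<phi>" and \<mu>: "0 \<le> \<mu>"
    and near: "\<And>a b \<gamma> t. a \<le> b \<Longrightarrow> geodesic_on {a..b} \<gamma> \<Longrightarrow> \<gamma> a \<in> orbit (G\<lparr>carrier := H\<rparr>) \<phi> x \<Longrightarrow>
      \<gamma> b \<in> orbit (G\<lparr>carrier := H\<rparr>) \<phi> x \<Longrightarrow> t \<in> {a..b} \<Longrightarrow> \<exists>y\<in>orbit (G\<lparr>carrier := H\<rparr>) \<phi> x. dist (\<gamma> t) y \<le> \<mu>"
  obtains S where "finite S" "S \<subseteq> H" "generate G S = H"
    "\<And>g. g \<in> H \<Longrightarrow> real (word_length G S g) \<le> dist x (\<phi> g x) + 2"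
proof -
  let ?Y = "orbit (G\<lparr>carrier := H\<rparr>) \<phi> x"
  define S where "S = {g \<in> H. dist x (\<phi> g x) \<le> 2 * \<mu> + 1}"
  let ?B = "ball x (2 * \<mu> + 2)"
  have "S \<subseteq> {g \<in> carrier G. \<phi> g ` ?B \<inter> ?B \<noteq> {}}"
  proof
    fix g assume g: "g \<in> S"
    then have "\<phi> g x \<in> \<phi> g ` ?B" "\<phi> g x \<in> ?B" using \<mu> by (auto simp: S_def)
    then show "g \<in> {g \<in> carrier G. \<phi> g ` ?B \<inter> ?B \<noteq> {}}" using g H_carrier by (auto simp: S_def)
  qed
  then have fin: "finite S" using proper unfolding proper_action_def by (meson finite_subset)
  have SH: "S \<subseteq> H" by (auto simp: S_def)
  have words: "\<exists>u. set u \<subseteq> S \<and> word_value u = g \<and> real (length u) \<le> dist x (\<phi> g x) + 2" if g: "g \<in> H" for g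
  proof -
    obtain \<gamma> where "geodesic_from_to \<gamma> x (\<phi> g x)" using geodesic_exists[OF cat0] by blast
    note \<gamma> = geodesic_from_toD[OF this]
    define l where "l = dist x (\<phi> g x)"
    have l0: "0 \<le> l" by (simp add: l_def)
    have oneH: "\<one> \<in> H" by (rule subgroup.one_closed[OF H])
    have xY: "x \<in> ?Y" using oneH act_one[of x] by (force simp: orbit_def)
    have gY: "\<phi> g x \<in> ?Y" using g by (auto simp: orbit_def)
    have "\<exists>h\<in>H. dist (\<gamma> t) (\<phi> h x) \<le> \<mu>" if t: "t \<in> {0..l}" for t
      using near[of 0 l \<gamma> t] \<gamma> xY gY t by (auto simp: l_def orbit_def)
    then obtain h where h: "\<And>t. t \<in> {0..l} \<Longrightarrow> h t \<in> H \<and> dist (\<gamma> t) (\<phi> (h t) x) \<le> \<mu>" by metis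
    \<comment> \<open>The additional step leaves room for the prescribed ends \<open>\<one>\<close> and \<open>g\<close> when \<open>g\<close> fixes \<open>x\<close>.\<close>
    define n where "n = nat \<lceil>l\<rceil> + 1"
    have n: "0 < n" "l \<le> real n" "real n \<le> l + 2" unfolding n_def using l0 by linarith+
    define t where "t i = min (real i) l" for i
    define k where "k i = (if i = 0 then \<one> else if i = n then g else h (t i))" for i
    have t: "t i \<in> {0..l}" "\<bar>t i - t (Suc i)\<bar> \<le> 1" for i using l0 by (auto simp: t_def)
    have k: "k i \<in> H" "dist (\<gamma> (t i)) (\<phi> (k i) x) \<le> \<mu>" for i
      using h[OF t(1)[of i]] oneH g act_one[of x] \<mu> \<gamma>(2,3) n l0
      by (auto simp: k_def t_def l_def min_def)
    define s where "s i = inv (k i) \<otimes> k (Suc i)" for i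
    have sS: "s i \<in> S" for i
    proof -
      have "dist x (\<phi> (s i) x) = dist (\<phi> (k i) x) (\<phi> (k (Suc i)) x)"
        unfolding s_def by (rule orbit_dist[symmetric]) (use k H_carrier in auto)
      also have "\<dots> \<le> dist (\<gamma> (t i)) (\<phi> (k i) x) + dist (\<gamma> (t i)) (\<gamma> (t (Suc i)))
          + dist (\<gamma> (t (Suc i))) (\<phi> (k (Suc i)) x)" by metric
      also have "\<dots> \<le> \<mu> + 1 + \<mu>"
        using k(2)[of i] k(2)[of "Suc i"] t(2)[of i] geodesic_on_dist[OF \<gamma>(1), of "t i" "t (Suc i)"]
          t(1)[of i] t(1)[of "Suc i"] by (simp add: l_def)
      finally have "dist x (\<phi> (s i) x) \<le> 2 * \<mu> + 1" by simp
      moreover have "s i \<in> H" unfolding s_def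
        by (intro subgroup.m_closed[OF H] subgroup.m_inv_closed[OF H] k)
      ultimately show ?thesis by (simp add: S_def)
    qed
    have sG: "set (map s [0..<m]) \<subseteq> carrier G" for m using sS SH H_carrier by auto
    have "word_value (map s [0..<m]) = k m" for m
    proof (induction m)
      case 0
      show ?case by (simp add: k_def)
    next
      case (Suc m)
      have c: "k m \<in> carrier G" "k (Suc m) \<in> carrier G" "s m \<in> carrier G"
        using k(1) sS SH H_carrier by auto
      have "word_value (map s [0..<Suc m]) = word_value (map s [0..<m]) \<otimes> word_value [s m]"
        using word_value_append[OF sG, of "[s m]" m] c by simp
      also have "\<dots> = k m \<otimes> s m" using Suc c by simp
      also have "\<dots> = k (Suc m)" unfolding s_def using c by (simp add: m_assoc[symmetric])
      finally show ?case .
    qed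
    from this[of n] show ?thesis using n sS
      by (intro exI[of _ "map s [0..<n]"]) (auto simp: k_def l_def)
  qed
  have gen: "generate G S = H"
  proof
    show "generate G S \<subseteq> H" by (rule generate_subgroup_incl[OF SH H])
    show "H \<subseteq> generate G S"
    proof
      fix g assume "g \<in> H"
      then obtain u where u: "set u \<subseteq> S" "word_value u = g" using words by blast
      have "set u \<subseteq> generate G S" using u(1) by (auto intro!: generate.incl)
      moreover have "S \<subseteq> carrier G" using SH H_carrier by blast
      ultimately show "g \<in> generate G S"
        using word_value_in_subgroup[OF generate_is_subgroup, of S u] u(2) by simp
    qed
  qed
  have "real (word_length G S g) \<le> dist x (\<phi> g x) + 2" if g: "g \<in> H" for g
  proof -
    obtain u where u: "set u \<subseteq> S" "word_value u = g" "real (length u) \<le> dist x (\<phi> g x) + 2"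
      using words[OF g] by blast
    have "set u \<subseteq> letters S" using u(1) by blast
    from word_length_le[OF this] u show ?thesis by simp
  qed
  with fin SH gen show thesis by (rule that)
qed

text \<open>
  The upper bound holds for every orbit map, as \<open>D\<close> is at most linear in the distance. For the lower
  bound it suffices to consider one weight: the index \<open>n + 1\<close> is large enough for curtains dual to
  the \<open>R\<close>-contracting orbit geodesics to form \<open>L\<close>-chains.
\<close>

lemma stable_orbit_quasiisometric:
  assumes proper: "proper_action G \<phi>" and stable: "stable_subset (orbit (G\<lparr>carrier := H\<rparr>) \<phi> x)"
  shows "\<exists>S. finite_generating_set G H S"
    and "finite_generating_set G H S \<Longrightarrow>
      quasiisometric_embedding H (word_dist G S) (curtain_dist w) (\<lambda>h. \<phi> h x')"
proof -
  let ?Y = "orbit (G\<lparr>carrier := H\<rparr>) \<phi> x"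
  obtain \<mu> R where \<mu>: "0 \<le> \<mu>" and R: "0 \<le> R"
    and st: "\<And>a b \<gamma>. a \<le> b \<Longrightarrow> geodesic_on {a..b} \<gamma> \<Longrightarrow> \<gamma> a \<in> ?Y \<Longrightarrow> \<gamma> b \<in> ?Y \<Longrightarrow>
      contracting R (\<gamma> ` {a..b}) \<and> (\<forall>t\<in>{a..b}. \<exists>y\<in>?Y. dist (\<gamma> t) y \<le> \<mu>)"
    using stable unfolding stable_subset_def by blast
  have "\<exists>S0. finite S0 \<and> S0 \<subseteq> H \<and> generate G S0 = H \<and>
      (\<forall>g\<in>H. real (word_length G S0 g) \<le> dist x (\<phi> g x) + 2)"
  proof (rule stable_orbit_generators[OF proper \<mu>, of x])
    show "\<exists>y\<in>?Y. dist (\<gamma> t) y \<le> \<mu>"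
      if "a \<le> b" "geodesic_on {a..b} \<gamma>" "\<gamma> a \<in> ?Y" "\<gamma> b \<in> ?Y" "t \<in> {a..b}" for a b \<gamma> t
      using st[OF that(1-4)] that(5) by simp
  qed blast
  then obtain S0 where S0: "finite S0" "S0 \<subseteq> H" "generate G S0 = H"
    "\<And>g. g \<in> H \<Longrightarrow> real (word_length G S0 g) \<le> dist x (\<phi> g x) + 2" by blast
  then show "\<exists>S. finite_generating_set G H S" unfolding finite_generating_set_def by auto
  assume "finite_generating_set G H S"
  then have S: "finite S" "S \<subseteq> H" "generate G S = H" by (auto simp: finite_generating_set_def)
  have SG: "S \<subseteq> carrier G" "S0 \<subseteq> carrier G" using S(2) S0(2) H_carrier by blast+
  have "generate G S0 = generate G S" using S(3) S0(3) by simp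
  then obtain k where k: "0 < k"
    "\<And>g. g \<in> generate G S \<Longrightarrow> real (word_length G S g) \<le> k * real (word_length G S0 g)"
    by (rule word_length_change_generators[OF SG(1) S0(1) SG(2)]) blast
  note k = k(1) k(2)[unfolded S(3)]
  obtain M where M: "1 \<le> M" "\<And>s. s \<in> letters S \<Longrightarrow> dist x' (\<phi> s x') \<le> M"
    "\<And>g. g \<in> H \<Longrightarrow> dist x' (\<phi> g x') \<le> M * real (word_length G S g)"
    using displacement_bound[OF S, of x'] by blast
  let ?W = "\<Sum>n. w (Suc n)"
  have W: "0 < ?W" by (rule total_weight_pos[OF weights])
  define n where "n = nat \<lceil>20 * R + 17\<rceil>"
  have n: "20 * R + 17 \<le> real (Suc n)" unfolding n_def by linarith
  have wn: "0 < w (Suc n)" by (rule weight_pos[OF weights])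
  define A where "A = dist x' x"
  define N where "N = 6 * R + 6"
  have N: "0 < N" using R by (simp add: N_def)
  have A: "0 \<le> A" by (simp add: A_def)
  define c where "c = w (Suc n) / (N * k)"
  define e where "e = w (Suc n) / N * (2 * A + 4)"
  show "quasiisometric_embedding H (word_dist G S) (curtain_dist w) (\<lambda>h. \<phi> h x')"
  proof (rule quasiisometric_embeddingI[where c = c and c' = "?W * M" and e = e and e' = "?W * 2"])
    show "0 < c" using wn N k by (simp add: c_def)
    show "0 \<le> ?W * M" "0 \<le> ?W * 2" using W M by simp_all
    show "0 \<le> e" using wn N A by (simp add: e_def)
    fix g h assume gh: "g \<in> H" "h \<in> H"
    show "0 \<le> word_dist G S g h" by (simp add: word_dist_def)
    have gc: "g \<in> carrier G" "h \<in> carrier G" using gh H_carrier by auto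
    have ghH: "inv g \<otimes> h \<in> H" using gh H by (simp add: subgroup.m_closed subgroup.m_inv_closed)
    define l where "l = word_dist G S g h"
    have "dist (\<phi> g x') (\<phi> h x') \<le> M * l"
      using M(3)[OF ghH] orbit_dist[OF gc] by (simp add: l_def word_dist_def)
    then have "?W * (dist (\<phi> g x') (\<phi> h x') + 2) \<le> ?W * (M * l + 2)"
      using W by (intro mult_left_mono) auto
    then have "curtain_dist w (\<phi> g x') (\<phi> h x') \<le> ?W * (M * l + 2)"
      using curtain_dist_le_dist[OF weights cat0, of "\<phi> g x'" "\<phi> h x'"] by linarith
    then show "curtain_dist w (\<phi> g x') (\<phi> h x') \<le> ?W * M * word_dist G S g h + ?W * 2"
      by (simp add: l_def algebra_simps)
    define D where "D = dist (\<phi> g x) (\<phi> h x)"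
    have "l \<le> k * (D + 2)"
    proof -
      have "l \<le> k * real (word_length G S0 (inv g \<otimes> h))" using k(2)[OF ghH] by (simp add: l_def word_dist_def)
      also have "\<dots> \<le> k * (D + 2)"
        using S0(4)[OF ghH] k(1) orbit_dist[OF gc, of x] by (intro mult_left_mono) (auto simp: D_def)
      finally show ?thesis .
    qed
    then have lD: "l / k \<le> D + 2" using k(1) by (simp add: pos_divide_le_eq mult.commute)
    obtain \<gamma> where "geodesic_from_to \<gamma> (\<phi> g x) (\<phi> h x)" using geodesic_exists[OF cat0] by blast
    note \<gamma> = geodesic_from_toD[OF this, folded D_def]
    have D0: "0 \<le> D" by (simp add: D_def)
    have "\<gamma> 0 \<in> ?Y" "\<gamma> D \<in> ?Y" using \<gamma>(2,3) gh by (auto simp: orbit_def)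
    then have con: "contracting R (\<gamma> ` {0..D})" using st[OF D0 \<gamma>(1)] by blast
    have "dist (\<phi> g x') (\<gamma> 0) \<le> A" "dist (\<phi> h x') (\<gamma> D) \<le> A"
      using \<gamma>(2,3) gc by (simp_all add: A_def act_dist)
    from contracting_dL_lower_bound[OF cat0 \<gamma>(1) D0 R con this n]
    have "(D - 2 * A - 2) / N \<le> real (dL (Suc n) (\<phi> g x') (\<phi> h x'))" by (simp add: N_def)
    moreover have "(l / k - (2 * A + 4)) / N \<le> (D - 2 * A - 2) / N"
      using lD N by (intro divide_right_mono) auto
    ultimately have "(l / k - (2 * A + 4)) / N \<le> real (dL (Suc n) (\<phi> g x') (\<phi> h x'))" by linarith
    then have "w (Suc n) * ((l / k - (2 * A + 4)) / N) \<le> w (Suc n) * real (dL (Suc n) (\<phi> g x') (\<phi> h x'))"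
      using wn by (intro mult_left_mono) auto
    also have "\<dots> \<le> curtain_dist w (\<phi> g x') (\<phi> h x')" by (rule dL_le_curtain_dist[OF weights cat0])
    finally have "w (Suc n) * ((l / k - (2 * A + 4)) / N) \<le> curtain_dist w (\<phi> g x') (\<phi> h x')" .
    moreover have "w (Suc n) * ((l / k - (2 * A + 4)) / N) = c * l - e"
      using N k(1) by (simp add: c_def e_def field_simps)
    ultimately show "c * word_dist G S g h - e \<le> curtain_dist w (\<phi> g x') (\<phi> h x')"
      by (simp add: l_def)
  qed
qed

end
end

theorem theorem4:
  fixes G :: "('g, 'm) monoid_scheme"
    and \<phi> :: "'g \<Rightarrow> 'a::metric_space \<Rightarrow> 'a"
    and H :: "'g set"
    and w :: "nat \<Rightarrow> real"
  assumes "is_CAT0 TYPE('a)"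
    and "curtain_weights w"
    and "group G"
    and "isometric_action G \<phi>"
    and "proper_action G \<phi>"
    and "cobounded_action G \<phi>"
    and "subgroup H G"
  shows "stable_subgroup G \<phi> H \<longleftrightarrow>
     (\<exists>S. finite_generating_set G H S) \<and>
     (\<forall>S x. finite_generating_set G H S \<longrightarrow>
        quasiisometric_embedding H (word_dist G S) (curtain_dist w) (\<lambda>h. \<phi> h x))"
    (is "_ \<longleftrightarrow> ?fg \<and> ?qi")
proof
  assume "stable_subgroup G \<phi> H"
  then obtain x where "stable_subset (orbit (G\<lparr>carrier := H\<rparr>) \<phi> x)"
    by (auto simp: stable_subgroup_def)
  from stable_orbit_quasiisometric[OF assms(3,4,7,1,2,5) this] show "?fg \<and> ?qi" by blast
next
  assume fq: "?fg \<and> ?qi"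
  then obtain S where S: "finite_generating_set G H S" by blast
  \<comment> \<open>Any base point will do.\<close>
  have "stable_subset (orbit (G\<lparr>carrier := H\<rparr>) \<phi> undefined)"
    by (rule quasiisometric_orbit_stable[OF assms(3,4,7,1,2), of S])
      (use S fq in \<open>auto simp: finite_generating_set_def\<close>)
  then show "stable_subgroup G \<phi> H" using assms(7) unfolding stable_subgroup_def by blast
qed

end
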